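(* Let $M$ be a compact Sasakian manifold of dimension $2n+1$ with $\overline{\mathrm{Rc}}\ge 0$. Let $U_1,U_2$ be smooth functions on $M$, put $$V=\Delta_{\mathrm{hor}}U_1+\tfrac12|\nabla_{\mathrm{hor}}U_1|^2-2U_2,$$ and suppose that for some positive constants $\kappa_1,\kappa_2$ one has, on $M$, $$V\le\kappa_1,\qquad \Delta_{\mathrm{hor}}V+\frac{n^2}{3\kappa_2}\left(1+\frac3n\right)^2|\nabla_{\mathrm{ver}}V|^2\le\kappa_2 .$$ Let $\rho_t$ ($t\ge 0$) be any smooth positive solution of $$\dot\rho_t=\Delta_{\mathrm{hor}}\rho_t+\langle\nabla_{\mathrm{hor}}U_1,\nabla_{\mathrm{hor}}\rho_t\rangle+U_2\rho_t$$ on $M$, and let $f_t=-2\log\rho_t-U_1$ and $c_2=\frac1{n+3}\sqrt{\frac{n\kappa_2}2}$. Then $$\left(1+\frac3n\right)\dot f_t(x)+\frac12|\nabla_{\mathrm{hor}}f_t|^2_x-V(x)+\left(1+\frac n3\right)\sqrt{\frac n{2\kappa_2}}\tanh(c_2t)\,|\nabla_{\mathrm{ver}}f_t(x)|^2\le\frac{\kappa_2}{c_2}\coth(c_2t)+\frac{3\kappa_1}n$$ for all $t>0$ and all $x\in M$.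
   Context: A Sasakian manifold is a manifold $M$ of dimension $2n+1$ with a Riemannian metric $\langle\cdot,\cdot\rangle$, a $(1,1)$-tensor $J$, a vector field $\mathbf w$ and a 1-form $\alpha$ that is contact ($d\alpha_x$ is non-degenerate on $D_x=\{v\in T_xM:\alpha(v)=0\}$ for each $x$), such that: (i) $J^2v=-v$ for $v\in D$, $\alpha(\mathbf w)=1$, $J\mathbf w=0$; (ii) (normality) $[J,J](w_1,w_2)+d\alpha(w_1,w_2)\mathbf w=0$ for all vector fields $w_1,w_2$, where $[J,J](w_1,w_2)=J^2[w_1,w_2]+[Jw_1,Jw_2]-J[Jw_1,w_2]-J[w_1,Jw_2]$; (iii) $\langle Jv_1,Jv_2\rangle=\langle v_1,v_2\rangle$ for $v_1,v_2\in D$ and $\langle\mathbf w,\mathbf w\rangle=1$; (iv) $\langle w_1,Jw_2\rangle=d\alpha(w_1,w_2)$ for all $w_1,w_2$. The convention is $d\alpha(w_1,w_2)=w_1(\alpha(w_2))-w_2(\alpha(w_1))-\alpha([w_1,w_2])$. For a tangent vector $v$, $v_{\mathrm{hor}}$ and $v_{\mathrm{ver}}$ are its orthogonal projections on $D$ and $D^\perp$. For a smooth function $f$, $\nabla_{\mathrm{hor}}f$ and $\nabla_{\mathrm{ver}}f$ are the projections of the gradient $\nabla f$. $\nabla$ also denotes the Levi-Civita connection, and the sub-Laplacian is $\Delta_{\mathrm{hor}}f=\sum_i\langle\nabla_{v_i}\nabla f,v_i\rangle$ for any local orthonormal frame $(v_i)$ of $D$. A dot denotes $\partial/\partial t$.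 The Tanaka connection is $\bar\nabla_{w_1}w_2=\nabla_{w_1}w_2+\frac12\langle\mathbf w,w_1\rangle Jw_2+\frac12\langle\mathbf w,w_2\rangle Jw_1-\frac12\langle Jw_1,w_2\rangle\mathbf w$; its curvature is $\overline{\mathrm{Rm}}(w_1,w_2)w_3=\bar\nabla_{w_1}\bar\nabla_{w_2}w_3-\bar\nabla_{w_2}\bar\nabla_{w_1}w_3-\bar\nabla_{[w_1,w_2]}w_3$, and $\overline{\mathrm{Rc}}(w_1,w_1)=\operatorname{trace}(w_2\mapsto\langle\overline{\mathrm{Rm}}(w_2,w_1)w_1,w_2\rangle)$. *)

theory Defs
  imports "HOL-Analysis.Analysis" "HOL-Library.Function_Algebras"
begin

section \<open>Functions into a real vector space\<close>

instantiation "fun" :: (type, real_vector) real_vector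
begin

definition scaleR_fun :: "real \<Rightarrow> ('a \<Rightarrow> 'b) \<Rightarrow> 'a \<Rightarrow> 'b" where
  "scaleR_fun c f = (\<lambda>x. c *\<^sub>R f x)"

instance
  by standard (auto simp: scaleR_fun_def fun_eq_iff algebra_simps)

end

definition lin_on :: "'a::real_vector set \<Rightarrow> ('a \<Rightarrow> 'b::real_vector) \<Rightarrow> bool" where
  "lin_on S L \<longleftrightarrow>
     (\<forall>u\<in>S. \<forall>v\<in>S. L (u + v) = L u + L v) \<and> (\<forall>c. \<forall>u\<in>S. L (c *\<^sub>R u) = c *\<^sub>R L u)"


section \<open>Inner products on a subspace: orthonormal bases, traces, projections\<close>

definition orthonormal_basis ::
  "('a::real_vector \<Rightarrow> 'a \<Rightarrow> real) \<Rightarrow> 'a set \<Rightarrow> 'a set \<Rightarrow> bool" where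
  "orthonormal_basis ip S B \<longleftrightarrow>
     finite B \<and> span B = S \<and> (\<forall>u\<in>B. \<forall>v\<in>B. ip u v = (if u = v then 1 else 0))"

(* The sum does not depend on the orthonormal basis when \<beta> is bilinear on S. *)
definition form_trace ::
  "('a::real_vector \<Rightarrow> 'a \<Rightarrow> real) \<Rightarrow> 'a set \<Rightarrow> ('a \<Rightarrow> 'a \<Rightarrow> real) \<Rightarrow> real" where
  "form_trace ip S \<beta> = (\<Sum>e\<in>(SOME B. orthonormal_basis ip S B). \<beta> e e)"

definition orth_proj :: "('a::real_vector \<Rightarrow> 'a \<Rightarrow> real) \<Rightarrow> 'a set \<Rightarrow> 'a \<Rightarrow> 'a" where
  "orth_proj ip S v = (THE u. u \<in> S \<and> (\<forall>s\<in>S. ip (v - u) s = 0))"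


section \<open>Smooth manifolds\<close>

primrec Ck_on :: "nat \<Rightarrow> 'a::euclidean_space set \<Rightarrow> ('a \<Rightarrow> 'b::real_normed_vector) \<Rightarrow> bool" where
  "Ck_on 0 S f \<longleftrightarrow> continuous_on S f"
| "Ck_on (Suc k) S f \<longleftrightarrow>
     (\<forall>x\<in>S. f differentiable (at x)) \<and> (\<forall>v. Ck_on k S (\<lambda>x. frechet_derivative f (at x) v))"

(* Used for open S only. *)
definition smooth_on :: "'a::euclidean_space set \<Rightarrow> ('a \<Rightarrow> 'b::real_normed_vector) \<Rightarrow> bool" where
  "smooth_on S f \<longleftrightarrow> (\<forall>k. Ck_on k S f)"

(* A chart is a pair (domain, coordinate map); the manifold is the whole type 'm. *)
type_synonym ('m, 'e) atlas = "('m set \<times> ('m \<Rightarrow> 'e)) set"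

locale smooth_manifold =
  fixes A :: "('m::{t2_space, second_countable_topology}, 'e::euclidean_space) atlas"
  assumes chart: "(U, \<phi>) \<in> A \<Longrightarrow>
        open U \<and> open (\<phi> ` U) \<and> homeomorphism U (\<phi> ` U) \<phi> (inv_into U \<phi>)"
    and cover: "(\<Union>(U, \<phi>)\<in>A. U) = UNIV"
    and compatible: "(U, \<phi>) \<in> A \<Longrightarrow> (V, \<psi>) \<in> A \<Longrightarrow>
        smooth_on (\<phi> ` (U \<inter> V)) (\<psi> \<circ> inv_into U \<phi>)"

definition smooth_funs :: "('m, 'e::euclidean_space) atlas \<Rightarrow> ('m \<Rightarrow> real) set" where
  "smooth_funs A = {f. \<forall>(U, \<phi>)\<in>A. smooth_on (\<phi> ` U) (f \<circ> inv_into U \<phi>)}"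

(* Smoothness up to t = 0: in coordinates, r is locally the restriction of a smooth function
   on an open set of \<real> \<times> 'e. *)
definition smooth_family_from_0 ::
  "('m, 'e::euclidean_space) atlas \<Rightarrow> (real \<Rightarrow> 'm \<Rightarrow> real) \<Rightarrow> bool" where
  "smooth_family_from_0 A r \<longleftrightarrow>
     (\<forall>(U, \<phi>)\<in>A. \<forall>t\<ge>0. \<forall>y\<in>\<phi> ` U. \<exists>W F.
        open W \<and> (t, y) \<in> W \<and> smooth_on W F \<and>
        (\<forall>(s, z)\<in>W. 0 \<le> s \<and> z \<in> \<phi> ` U \<longrightarrow> F (s, z) = r s (inv_into U \<phi> z)))"


section \<open>Tangent vectors and vector fields\<close>

type_synonym 'm tvec = "('m \<Rightarrow> real) \<Rightarrow> real"
type_synonym 'm vfield = "'m \<Rightarrow> 'm tvec"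

(* Derivations at x of the algebra of smooth functions.  A tangent vector is a total function, so
   its values outside that algebra are fixed to be 0 to make equality of tangent vectors correct. *)
definition tangent_space :: "('m, 'e::euclidean_space) atlas \<Rightarrow> 'm \<Rightarrow> 'm tvec set" where
  "tangent_space A x = {v.
     lin_on (smooth_funs A) v \<and>
     (\<forall>f\<in>smooth_funs A. \<forall>h\<in>smooth_funs A. v (f * h) = v f * h x + f x * v h) \<and>
     (\<forall>f. f \<notin> smooth_funs A \<longrightarrow> v f = 0)}"

definition vector_fields :: "('m, 'e::euclidean_space) atlas \<Rightarrow> 'm vfield set" where
  "vector_fields A = {X.
     (\<forall>x. X x \<in> tangent_space A x) \<and> (\<forall>f\<in>smooth_funs A. (\<lambda>x. X x f) \<in> smooth_funs A)}"

definition lie_bracket :: "'m vfield \<Rightarrow> 'm vfield \<Rightarrow> 'm vfield" where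
  "lie_bracket X Y = (\<lambda>x f. X x (\<lambda>y. Y y f) - Y x (\<lambda>y. X y f))"

(* Some vector field with value v at x.  It is used only to evaluate tensorial expressions at x,
   whose value does not depend on the extension. *)
definition extend :: "('m, 'e::euclidean_space) atlas \<Rightarrow> 'm \<Rightarrow> 'm tvec \<Rightarrow> 'm vfield" where
  "extend A x v = (SOME X. X \<in> vector_fields A \<and> X x = v)"

definition one_form :: "('m, 'e::euclidean_space) atlas \<Rightarrow> ('m \<Rightarrow> 'm tvec \<Rightarrow> real) \<Rightarrow> bool" where
  "one_form A \<alpha> \<longleftrightarrow>
     (\<forall>x. lin_on (tangent_space A x) (\<alpha> x)) \<and>
     (\<forall>X\<in>vector_fields A. (\<lambda>x. \<alpha> x (X x)) \<in> smooth_funs A)"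

definition tensor11 ::
  "('m, 'e::euclidean_space) atlas \<Rightarrow> ('m \<Rightarrow> 'm tvec \<Rightarrow> 'm tvec) \<Rightarrow> bool" where
  "tensor11 A J \<longleftrightarrow>
     (\<forall>x. lin_on (tangent_space A x) (J x) \<and>
          (\<forall>v\<in>tangent_space A x. J x v \<in> tangent_space A x)) \<and>
     (\<forall>X\<in>vector_fields A. (\<lambda>x. J x (X x)) \<in> vector_fields A)"

definition ext_deriv ::
  "('m \<Rightarrow> 'm tvec \<Rightarrow> real) \<Rightarrow> 'm vfield \<Rightarrow> 'm vfield \<Rightarrow> 'm \<Rightarrow> real" where
  "ext_deriv \<alpha> X Y x =
     X x (\<lambda>y. \<alpha> y (Y y)) - Y x (\<lambda>y. \<alpha> y (X y)) - \<alpha> x (lie_bracket X Y x)"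


section \<open>Riemannian geometry\<close>

locale riemannian_manifold = smooth_manifold A
  for A :: "('m::{t2_space, second_countable_topology}, 'e::euclidean_space) atlas" +
  fixes g :: "'m \<Rightarrow> 'm tvec \<Rightarrow> 'm tvec \<Rightarrow> real"
  assumes metric_lin: "v \<in> tangent_space A x \<Longrightarrow> lin_on (tangent_space A x) (\<lambda>u. g x u v)"
    and metric_sym: "u \<in> tangent_space A x \<Longrightarrow> v \<in> tangent_space A x \<Longrightarrow> g x u v = g x v u"
    and metric_pos: "v \<in> tangent_space A x \<Longrightarrow> v \<noteq> 0 \<Longrightarrow> 0 < g x v v"
    and metric_smooth: "X \<in> vector_fields A \<Longrightarrow> Y \<in> vector_fields A \<Longrightarrow>
        (\<lambda>x. g x (X x) (Y x)) \<in> smooth_funs A"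

(* nabla x v Y is the covariant derivative of the vector field Y along the tangent vector v at x. *)
type_synonym 'm connection = "'m \<Rightarrow> 'm tvec \<Rightarrow> 'm vfield \<Rightarrow> 'm tvec"

definition affine_connection :: "('m, 'e::euclidean_space) atlas \<Rightarrow> 'm connection \<Rightarrow> bool" where
  "affine_connection A nabla \<longleftrightarrow>
     (\<forall>X\<in>vector_fields A. \<forall>Y\<in>vector_fields A. (\<lambda>x. nabla x (X x) Y) \<in> vector_fields A) \<and>
     (\<forall>x. \<forall>Y\<in>vector_fields A.
        lin_on (tangent_space A x) (\<lambda>v. nabla x v Y) \<and>
        (\<forall>v\<in>tangent_space A x. nabla x v Y \<in> tangent_space A x \<and>
          (\<forall>Z\<in>vector_fields A. nabla x v (Y + Z) = nabla x v Y + nabla x v Z) \<and>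
          (\<forall>f\<in>smooth_funs A.
             nabla x v (\<lambda>y. f y *\<^sub>R Y y) = v f *\<^sub>R Y x + f x *\<^sub>R nabla x v Y)))"

definition levi_civita ::
  "('m, 'e::euclidean_space) atlas \<Rightarrow> ('m \<Rightarrow> 'm tvec \<Rightarrow> 'm tvec \<Rightarrow> real) \<Rightarrow> 'm connection \<Rightarrow> bool"
  where
  "levi_civita A g nabla \<longleftrightarrow>
     affine_connection A nabla \<and>
     (\<forall>X\<in>vector_fields A. \<forall>Y\<in>vector_fields A. \<forall>x.
        nabla x (X x) Y - nabla x (Y x) X = lie_bracket X Y x) \<and>
     (\<forall>Y\<in>vector_fields A. \<forall>Z\<in>vector_fields A. \<forall>x. \<forall>v\<in>tangent_space A x.
        v (\<lambda>y. g y (Y y) (Z y)) = g x (nabla x v Y) (Z x) + g x (Y x) (nabla x v Z))"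

definition grad ::
  "('m, 'e::euclidean_space) atlas \<Rightarrow> ('m \<Rightarrow> 'm tvec \<Rightarrow> 'm tvec \<Rightarrow> real) \<Rightarrow> ('m \<Rightarrow> real) \<Rightarrow> 'm vfield"
  where
  "grad A g f x =
     (THE u. u \<in> tangent_space A x \<and> (\<forall>v\<in>tangent_space A x. g x u v = v f))"

definition curvature :: "'m connection \<Rightarrow> 'm vfield \<Rightarrow> 'm vfield \<Rightarrow> 'm vfield \<Rightarrow> 'm vfield" where
  "curvature nabla X Y Z x =
     nabla x (X x) (\<lambda>y. nabla y (Y y) Z) - nabla x (Y x) (\<lambda>y. nabla y (X y) Z)
       - nabla x (lie_bracket X Y x) Z"

definition curvature_at ::
  "('m, 'e::euclidean_space) atlas \<Rightarrow> 'm connection \<Rightarrow> 'm \<Rightarrow> 'm tvec \<Rightarrow> 'm tvec \<Rightarrow> 'm tvec \<Rightarrow> 'm tvec"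
  where
  "curvature_at A nabla x u v z = curvature nabla (extend A x u) (extend A x v) (extend A x z) x"

definition ricci ::
  "('m, 'e::euclidean_space) atlas \<Rightarrow> ('m \<Rightarrow> 'm tvec \<Rightarrow> 'm tvec \<Rightarrow> real) \<Rightarrow> 'm connection \<Rightarrow>
   'm \<Rightarrow> 'm tvec \<Rightarrow> real"
  where
  "ricci A g nabla x v =
     form_trace (g x) (tangent_space A x) (\<lambda>u u'. g x (curvature_at A nabla x u v v) u')"


section \<open>Sasakian manifolds\<close>

definition contact_dist ::
  "('m, 'e::euclidean_space) atlas \<Rightarrow> ('m \<Rightarrow> 'm tvec \<Rightarrow> real) \<Rightarrow> 'm \<Rightarrow> 'm tvec set" where
  "contact_dist A \<alpha> x = {v \<in> tangent_space A x. \<alpha> x v = 0}"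

definition contact_form ::
  "('m, 'e::euclidean_space) atlas \<Rightarrow> ('m \<Rightarrow> 'm tvec \<Rightarrow> real) \<Rightarrow> bool" where
  "contact_form A \<alpha> \<longleftrightarrow> one_form A \<alpha> \<and>
     (\<forall>x. \<forall>u\<in>contact_dist A \<alpha> x.
        (\<forall>v\<in>contact_dist A \<alpha> x. ext_deriv \<alpha> (extend A x u) (extend A x v) x = 0) \<longrightarrow> u = 0)"

definition nijenhuis ::
  "('m \<Rightarrow> 'm tvec \<Rightarrow> 'm tvec) \<Rightarrow> 'm vfield \<Rightarrow> 'm vfield \<Rightarrow> 'm vfield" where
  "nijenhuis J X Y x =
     J x (J x (lie_bracket X Y x))
     + lie_bracket (\<lambda>y. J y (X y)) (\<lambda>y. J y (Y y)) x
     - J x (lie_bracket (\<lambda>y. J y (X y)) Y x)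
     - J x (lie_bracket X (\<lambda>y. J y (Y y)) x)"

locale sasakian_manifold = riemannian_manifold A g
  for A :: "('m::{t2_space, second_countable_topology}, 'e::euclidean_space) atlas"
    and g :: "'m \<Rightarrow> 'm tvec \<Rightarrow> 'm tvec \<Rightarrow> real" +
  fixes n :: nat
    and J :: "'m \<Rightarrow> 'm tvec \<Rightarrow> 'm tvec"
    and w :: "'m vfield"
    and \<alpha> :: "'m \<Rightarrow> 'm tvec \<Rightarrow> real"
  assumes dim: "DIM('e) = 2 * n + 1"
    and J_tensor: "tensor11 A J"
    and reeb_field: "w \<in> vector_fields A"
    and contact: "contact_form A \<alpha>"
    and J_squared: "v \<in> contact_dist A \<alpha> x \<Longrightarrow> J x (J x v) = - v"
    and alpha_reeb: "\<alpha> x (w x) = 1"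
    and J_reeb: "J x (w x) = 0"
    and normality: "X \<in> vector_fields A \<Longrightarrow> Y \<in> vector_fields A \<Longrightarrow>
        nijenhuis J X Y x + ext_deriv \<alpha> X Y x *\<^sub>R w x = 0"
    and J_isometry: "u \<in> contact_dist A \<alpha> x \<Longrightarrow> v \<in> contact_dist A \<alpha> x \<Longrightarrow>
        g x (J x u) (J x v) = g x u v"
    and reeb_unit: "g x (w x) (w x) = 1"
    and compat: "X \<in> vector_fields A \<Longrightarrow> Y \<in> vector_fields A \<Longrightarrow>
        g x (X x) (J x (Y x)) = ext_deriv \<alpha> X Y x"

definition hor ::
  "('m, 'e::euclidean_space) atlas \<Rightarrow> ('m \<Rightarrow> 'm tvec \<Rightarrow> 'm tvec \<Rightarrow> real) \<Rightarrow>
   ('m \<Rightarrow> 'm tvec \<Rightarrow> real) \<Rightarrow> 'm \<Rightarrow> 'm tvec \<Rightarrow> 'm tvec"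
  where
  "hor A g \<alpha> x v = orth_proj (g x) (contact_dist A \<alpha> x) v"

definition ver ::
  "('m, 'e::euclidean_space) atlas \<Rightarrow> ('m \<Rightarrow> 'm tvec \<Rightarrow> 'm tvec \<Rightarrow> real) \<Rightarrow>
   ('m \<Rightarrow> 'm tvec \<Rightarrow> real) \<Rightarrow> 'm \<Rightarrow> 'm tvec \<Rightarrow> 'm tvec"
  where
  "ver A g \<alpha> x v =
     orth_proj (g x) {u \<in> tangent_space A x. \<forall>s\<in>contact_dist A \<alpha> x. g x u s = 0} v"

definition hor_grad ::
  "('m, 'e::euclidean_space) atlas \<Rightarrow> ('m \<Rightarrow> 'm tvec \<Rightarrow> 'm tvec \<Rightarrow> real) \<Rightarrow>
   ('m \<Rightarrow> 'm tvec \<Rightarrow> real) \<Rightarrow> ('m \<Rightarrow> real) \<Rightarrow> 'm vfield"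
  where
  "hor_grad A g \<alpha> f x = hor A g \<alpha> x (grad A g f x)"

definition ver_grad ::
  "('m, 'e::euclidean_space) atlas \<Rightarrow> ('m \<Rightarrow> 'm tvec \<Rightarrow> 'm tvec \<Rightarrow> real) \<Rightarrow>
   ('m \<Rightarrow> 'm tvec \<Rightarrow> real) \<Rightarrow> ('m \<Rightarrow> real) \<Rightarrow> 'm vfield"
  where
  "ver_grad A g \<alpha> f x = ver A g \<alpha> x (grad A g f x)"

(* The summand is tensorial in the frame, so only the values at x of a local orthonormal frame of
   the contact distribution matter; these are exactly the orthonormal bases of its fibre at x. *)
definition sub_laplacian ::
  "('m, 'e::euclidean_space) atlas \<Rightarrow> ('m \<Rightarrow> 'm tvec \<Rightarrow> 'm tvec \<Rightarrow> real) \<Rightarrow>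
   ('m \<Rightarrow> 'm tvec \<Rightarrow> real) \<Rightarrow> 'm connection \<Rightarrow> ('m \<Rightarrow> real) \<Rightarrow> 'm \<Rightarrow> real"
  where
  "sub_laplacian A g \<alpha> nabla f x =
     form_trace (g x) (contact_dist A \<alpha> x) (\<lambda>u v. g x (nabla x u (grad A g f)) v)"

definition tanaka ::
  "('m \<Rightarrow> 'm tvec \<Rightarrow> 'm tvec \<Rightarrow> real) \<Rightarrow> ('m \<Rightarrow> 'm tvec \<Rightarrow> 'm tvec) \<Rightarrow> 'm vfield \<Rightarrow>
   'm connection \<Rightarrow> 'm connection"
  where
  "tanaka g J w nabla x v Y =
     nabla x v Y + (1/2 * g x (w x) v) *\<^sub>R J x (Y x) + (1/2 * g x (w x) (Y x)) *\<^sub>R J x v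
       - (1/2 * g x (J x v) (Y x)) *\<^sub>R w x"

definition norm_sq ::
  "('m \<Rightarrow> 'm tvec \<Rightarrow> 'm tvec \<Rightarrow> real) \<Rightarrow> 'm \<Rightarrow> 'm tvec \<Rightarrow> real" where
  "norm_sq g x v = g x v v"

definition coth :: "real \<Rightarrow> real" where
  "coth s = cosh s / sinh s"

end

theory Submission
  imports Defs
begin

text \<open>
  Write \<open>L\<close> for the sub-Laplacian, \<open>Z\<close> for the horizontal gradient of \<open>f\<close> and \<open>q = w f\<close> for its
  derivative along the Reeb field. The substitution \<open>\<rho> = e\<^sup>-\<^sup>(\<^sup>f\<^sup>+\<^sup>U\<^sup>1\<^sup>)\<^sup>/\<^sup>2\<close> turns the linear equation into
  \<open>\<partial>\<^sub>t f = L f - \<bar>Z\<bar>\<^sup>2 / 2 + V\<close> (\<open>log_solution\<close>). Let \<open>P = \<partial>\<^sub>t - L + Z\<close> be its linearisation. As \<open>V\<close> does not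
  depend on time, \<open>P (\<partial>\<^sub>t f) = 0\<close>. The Reeb field is a Killing field and commutes with \<open>L\<close>
  (\<open>reeb_Lap\<close>), so that \<open>P q = w V\<close>. For the Tanaka connection, which preserves the metric, \<open>w\<close> and \<open>J\<close> and
  has vertical torsion on the contact distribution, the Bochner formula (\<open>bochner\<close>) reads
  \<open>L \<bar>Z\<bar>\<^sup>2 / 2 = \<bar>D Z\<bar>\<^sup>2 + Z (L f) + Rc (Z, Z) - 2 (J Z) q\<close>.

  Now consider \<open>F = (1 + 3/n) \<partial>\<^sub>t f + \<bar>Z\<bar>\<^sup>2 / 2 - V + b q\<^sup>2\<close> with a function \<open>b\<close> of time. The indefinite term
  \<open>2 (J Z) q\<close> is dominated by the good term \<open>- 2 b \<bar>\<nabla>q\<bar>\<^sup>2\<close> that \<open>b q\<^sup>2\<close> contributes, at the price of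
  \<open>\<bar>Z\<bar>\<^sup>2 / (2 b)\<close> (\<open>mixed_term_bound\<close>). The trace and the skew part of the Hessian give
  \<open>\<bar>D Z\<bar>\<^sup>2 \<ge> (l/n) L f - l\<^sup>2 / (2 n) + (n/2) q\<^sup>2\<close> for every number \<open>l\<close> (\<open>hessian_norm_bound\<close>). Since \<open>L f\<close> is a
  combination of \<open>F\<close>, \<open>\<bar>Z\<bar>\<^sup>2\<close>, \<open>V\<close> and \<open>q\<^sup>2\<close>, there is a choice of \<open>l\<close> for which \<open>\<bar>Z\<bar>\<^sup>2\<close> disappears, and with
  \<open>b = B tanh (c t)\<close> the remaining \<open>q\<^sup>2\<close> absorbs \<open>2 b q w V\<close>. What is left is the Riccati inequality
  \<open>P F \<le> \<kappa>2 (1 + coth\<^sup>2 (c t)) - 2 c coth (c t) (F - 3 \<kappa>1 / n)\<close> (\<open>coefficient_arithmetic\<close>), for which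
  \<open>(\<kappa>2 / c) coth (c t) + 3 \<kappa>1 / n\<close> is a barrier that is infinite at the initial time. The maximum principle
  on the compact manifold finishes the proof (\<open>shifted_harnack\<close>). There the initial time is moved to some
  \<open>\<epsilon> > 0\<close>, so that \<open>f\<close> is smooth in a neighbourhood of the time interval, and \<open>\<epsilon>\<close> tends to zero in the end.

  The geometry is done with global objects. Tangent vectors are derivations; by Hadamard's lemma they have
  coordinates (\<open>tangent_coordinates\<close>). From local orthonormal frames one obtains finitely many
  global horizontal fields \<open>E\<^sub>a\<close> with \<open>u = \<Sum>\<^sub>a \<langle>u, E\<^sub>a\<rangle> E\<^sub>a\<close> for all horizontal \<open>u\<close> (\<open>global_frame_exists\<close>).
  All traces are sums over this frame, and it serves in place of local orthonormal frames in the
  Bochner formula because its tensor is parallel (\<open>frame_parallel\<close>).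
\<close>


section \<open>Calculus of smooth functions on open sets\<close>

lemma frechet_derivative_cong_open:
  assumes "open S" "x \<in> S" "\<And>y. y \<in> S \<Longrightarrow> f y = g y"
  shows "frechet_derivative f (at x) = frechet_derivative g (at x)"
proof -
  have "(f has_derivative D) (at x) \<longleftrightarrow> (g has_derivative D) (at x)" for D
    using assms by (metis has_derivative_transform_within_open)
  then show ?thesis by (simp add: frechet_derivative_def)
qed

lemma Ck_on_SucD: "Ck_on (Suc k) S f \<Longrightarrow> Ck_on k S f"
proof (induction k arbitrary: f)
  case 0
  then show ?case
    by (auto intro!: continuous_at_imp_continuous_on differentiable_imp_continuous_within)
next
  case (Suc k)
  then show ?case by (metis Ck_on.simps(2))
qed

lemma Ck_on_le: "Ck_on k S f \<Longrightarrow> j \<le> k \<Longrightarrow> Ck_on j S f"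
  by (induction k) (auto simp: le_Suc_eq dest: Ck_on_SucD simp del: Ck_on.simps)

lemma Ck_on_subset: "Ck_on k S f \<Longrightarrow> T \<subseteq> S \<Longrightarrow> Ck_on k T f"
proof (induction k arbitrary: f)
  case 0 then show ?case by (auto intro: continuous_on_subset)
next
  case (Suc k) then show ?case by (metis Ck_on.simps(2) subsetD)
qed

lemma Ck_on_cong:
  assumes "open S" "Ck_on k S f" "\<And>x. x \<in> S \<Longrightarrow> f x = g x"
  shows "Ck_on k S g"
  using assms(2,3)
proof (induction k arbitrary: f g)
  case 0 then show ?case by (metis Ck_on.simps(1) continuous_on_cong)
next
  case (Suc k)
  have "g differentiable (at x)" if "x \<in> S" for x
  proof -
    have "f differentiable (at x)" using Suc.prems(1) that by simp
    then show ?thesis unfolding differentiable_def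
      using has_derivative_transform_within_open[OF _ assms(1) that] Suc.prems(2) by metis
  qed
  moreover have "Ck_on k S (\<lambda>x. frechet_derivative g (at x) v)" for v
  proof (rule Suc.IH)
    show "Ck_on k S (\<lambda>x. frechet_derivative f (at x) v)" using Suc.prems(1) by simp
    show "frechet_derivative f (at x) v = frechet_derivative g (at x) v" if "x \<in> S" for x
      using frechet_derivative_cong_open[OF assms(1) that, of f g] Suc.prems(2) by simp
  qed
  ultimately show ?case by simp
qed

lemma Ck_on_local:
  assumes "\<And>x. x \<in> S \<Longrightarrow> \<exists>T. open T \<and> x \<in> T \<and> Ck_on k T f"
  shows "Ck_on k S f"
  using assms
proof (induction k arbitrary: f)
  case 0
  then have "isCont f x" if "x \<in> S" for x
    using that by (metis Ck_on.simps(1) continuous_on_eq_continuous_at)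
  then show ?case by (simp add: continuous_at_imp_continuous_on)
next
  case (Suc k)
  have "f differentiable (at x)" if "x \<in> S" for x using Suc.prems[OF that] by auto
  moreover have "Ck_on k S (\<lambda>x. frechet_derivative f (at x) v)" for v
    by (rule Suc.IH) (metis Suc.prems Ck_on.simps(2))
  ultimately show ?case by simp
qed

lemma Ck_on_SucI:
  assumes "open S" "\<And>x. x \<in> S \<Longrightarrow> (f has_derivative f' x) (at x)"
    "\<And>v. Ck_on k S (\<lambda>x. f' x v)"
  shows "Ck_on (Suc k) S f"
proof -
  have "frechet_derivative f (at x) = f' x" if "x \<in> S" for x
    using assms(2)[OF that] by (metis frechet_derivative_at)
  then have "Ck_on k S (\<lambda>x. frechet_derivative f (at x) v)" for v
    by (intro Ck_on_cong[OF assms(1) assms(3)]) auto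
  then show ?thesis using assms(2) by (auto simp: differentiable_def)
qed

lemma Ck_on_has_derivative:
  "Ck_on (Suc k) S f \<Longrightarrow> x \<in> S \<Longrightarrow> (f has_derivative frechet_derivative f (at x)) (at x)"
  using frechet_derivative_works by auto

lemma Ck_on_const: "open S \<Longrightarrow> Ck_on k S (\<lambda>x. c)"
  by (induction k arbitrary: c) (auto intro!: continuous_intros)

lemma Ck_on_bounded_linear:
  assumes "open S" "bounded_linear L" shows "Ck_on k S L"
proof (cases k)
  case 0 then show ?thesis using assms by (simp add: linear_continuous_on)
next
  case (Suc j)
  show ?thesis unfolding Suc
    by (rule Ck_on_SucI[OF assms(1), where f' = "\<lambda>_. L"])
      (use assms in \<open>auto intro: bounded_linear_imp_has_derivative Ck_on_const\<close>)
qed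

lemma Ck_on_add:
  assumes "open S" "Ck_on k S f" "Ck_on k S g" shows "Ck_on k S (\<lambda>x. f x + g x)"
  using assms(2,3)
proof (induction k arbitrary: f g)
  case 0 then show ?case by (auto intro: continuous_intros)
next
  case (Suc k)
  show ?case
    by (rule Ck_on_SucI[OF assms(1),
          where f' = "\<lambda>x v. frechet_derivative f (at x) v + frechet_derivative g (at x) v"])
      (use Suc in \<open>auto intro!: has_derivative_add simp: frechet_derivative_works[symmetric]\<close>)
qed

lemma Ck_on_bilinear:
  assumes "bounded_bilinear b" "open S" "Ck_on k S f" "Ck_on k S g"
  shows "Ck_on k S (\<lambda>x. b (f x) (g x))"
  using assms(3,4)
proof (induction k arbitrary: f g)
  case 0 then show ?case by (simp add: bounded_bilinear.continuous_on[OF assms(1)])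
next
  case (Suc k)
  show ?case
  proof (rule Ck_on_SucI[OF assms(2)])
    show "((\<lambda>x. b (f x) (g x)) has_derivative
        (\<lambda>v. b (f x) (frechet_derivative g (at x) v) + b (frechet_derivative f (at x) v) (g x))) (at x)"
      if "x \<in> S" for x
      by (rule bounded_bilinear.FDERIV[OF assms(1)])
        (use Suc.prems that in \<open>auto simp: frechet_derivative_works[symmetric]\<close>)
    show "Ck_on k S (\<lambda>x. b (f x) (frechet_derivative g (at x) v) + b (frechet_derivative f (at x) v) (g x))" for v
      using Suc by (intro Ck_on_add assms(2) Suc.IH Ck_on_SucD[OF Suc.prems(1)] Ck_on_SucD[OF Suc.prems(2)]) auto
  qed
qed

lemma Ck_on_sum:
  assumes "open S" "\<And>i. i \<in> I \<Longrightarrow> Ck_on k S (f i)" shows "Ck_on k S (\<lambda>x. \<Sum>i\<in>I. f i x)"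
proof (cases "finite I")
  case True
  then show ?thesis using assms(2)
    by (induction I rule: finite_induct) (auto intro!: Ck_on_const Ck_on_add assms(1))
qed (simp add: Ck_on_const assms(1))

text \<open>The chain rule applies the derivative of \<open>h\<close> to a varying vector. Expanding that vector in the
  standard basis leaves products of functions to which the induction hypothesis applies.\<close>

lemma Ck_on_compose:
  fixes f :: "'a::euclidean_space \<Rightarrow> 'b::euclidean_space"
  assumes "open S" "open T" "f ` S \<subseteq> T" "Ck_on k S f" "Ck_on k T h"
  shows "Ck_on k S (\<lambda>x. h (f x))"
  using assms(4,5)
proof (induction k arbitrary: h)
  case 0 then show ?case using assms(3) by (auto intro: continuous_on_compose2)
next
  case (Suc k)
  let ?Df = "\<lambda>x. frechet_derivative f (at x)" and ?Dh = "\<lambda>x. frechet_derivative h (at x)"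
  show ?case
  proof (rule Ck_on_SucI[OF assms(1)])
    fix x assume x: "x \<in> S"
    have df: "(f has_derivative ?Df x) (at x)" and dh: "(h has_derivative ?Dh (f x)) (at (f x))"
      using x Suc.prems assms(3) by (auto intro!: Ck_on_has_derivative)
    have "?Dh (f x) (?Df x v) = (\<Sum>b\<in>Basis. (?Df x v \<bullet> b) *\<^sub>R ?Dh (f x) b)" for v
    proof -
      interpret linear "?Dh (f x)" using dh by (rule has_derivative_linear)
      have "?Dh (f x) (?Df x v) = ?Dh (f x) (\<Sum>b\<in>Basis. (?Df x v \<bullet> b) *\<^sub>R b)"
        by (simp add: euclidean_representation)
      then show ?thesis by (simp only: sum scale)
    qed
    then show "((\<lambda>x. h (f x)) has_derivative
        (\<lambda>v. \<Sum>b\<in>Basis. (?Df x v \<bullet> b) *\<^sub>R ?Dh (f x) b)) (at x)"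
      using has_derivative_compose[OF df dh] by simp
  next
    fix v
    show "Ck_on k S (\<lambda>x. \<Sum>b\<in>Basis. (?Df x v \<bullet> b) *\<^sub>R ?Dh (f x) b)"
    proof (intro Ck_on_sum assms(1) Ck_on_bilinear[OF bounded_bilinear_scaleR]
        Ck_on_bilinear[OF bounded_bilinear_inner] Ck_on_const)
      show "Ck_on k S (\<lambda>x. ?Df x v)" using Suc.prems by simp
      show "Ck_on k S (\<lambda>x. ?Dh (f x) b)" for b
        using Suc.prems by (intro Suc.IH) (auto dest: Ck_on_SucD simp del: Ck_on.simps, simp)
    qed
  qed
qed

lemma smooth_on_subset: "smooth_on S f \<Longrightarrow> T \<subseteq> S \<Longrightarrow> smooth_on T f"
  unfolding smooth_on_def using Ck_on_subset by blast

lemma smooth_on_cong: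
  "open S \<Longrightarrow> smooth_on S f \<Longrightarrow> (\<And>x. x \<in> S \<Longrightarrow> f x = g x) \<Longrightarrow> smooth_on S g"
  unfolding smooth_on_def using Ck_on_cong by blast

lemma smooth_on_local:
  "(\<And>x. x \<in> S \<Longrightarrow> \<exists>T. open T \<and> x \<in> T \<and> smooth_on T f) \<Longrightarrow> smooth_on S f"
  unfolding smooth_on_def by (meson Ck_on_local)

lemma smooth_on_const: "open S \<Longrightarrow> smooth_on S (\<lambda>x. c)"
  by (simp add: smooth_on_def Ck_on_const)

lemma smooth_on_bounded_linear: "open S \<Longrightarrow> bounded_linear L \<Longrightarrow> smooth_on S L"
  by (simp add: smooth_on_def Ck_on_bounded_linear)

lemma smooth_on_add: "open S \<Longrightarrow> smooth_on S f \<Longrightarrow> smooth_on S g \<Longrightarrow> smooth_on S (\<lambda>x. f x + g x)"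
  by (simp add: smooth_on_def Ck_on_add)

lemma smooth_on_bilinear:
  "bounded_bilinear b \<Longrightarrow> open S \<Longrightarrow> smooth_on S f \<Longrightarrow> smooth_on S g \<Longrightarrow> smooth_on S (\<lambda>x. b (f x) (g x))"
  by (simp add: smooth_on_def Ck_on_bilinear)

lemma smooth_on_mult:
  "open S \<Longrightarrow> smooth_on S f \<Longrightarrow> smooth_on S g \<Longrightarrow> smooth_on S (\<lambda>x. f x * g x :: real)"
  by (rule smooth_on_bilinear[OF bounded_bilinear_mult])

lemma smooth_on_diff:
  fixes f :: "'a::euclidean_space \<Rightarrow> real"
  assumes "open S" "smooth_on S f" "smooth_on S g" shows "smooth_on S (\<lambda>x. f x - g x)"
  using smooth_on_add[OF assms(1,2) smooth_on_mult[OF assms(1) smooth_on_const[OF assms(1), of "-1"] assms(3)]]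
  by simp

lemma smooth_on_sum:
  "open S \<Longrightarrow> (\<And>i. i \<in> I \<Longrightarrow> smooth_on S (f i)) \<Longrightarrow> smooth_on S (\<lambda>x. \<Sum>i\<in>I. f i x)"
  by (simp add: smooth_on_def Ck_on_sum)

lemma smooth_on_compose:
  fixes f :: "'a::euclidean_space \<Rightarrow> 'b::euclidean_space"
  assumes "open S" "open T" "f ` S \<subseteq> T" "smooth_on S f" "smooth_on T h"
  shows "smooth_on S (\<lambda>x. h (f x))"
  unfolding smooth_on_def
  by (intro allI, rule Ck_on_compose[OF assms(1-3)]) (use assms(4,5) in \<open>auto simp: smooth_on_def\<close>)

lemma smooth_on_deriv: "smooth_on S f \<Longrightarrow> smooth_on S (\<lambda>x. frechet_derivative f (at x) v)"
  unfolding smooth_on_def by (metis Ck_on.simps(2))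

lemma smooth_on_has_derivative:
  "smooth_on S f \<Longrightarrow> x \<in> S \<Longrightarrow> (f has_derivative frechet_derivative f (at x)) (at x)"
  unfolding smooth_on_def using Ck_on_has_derivative by blast

lemma smooth_on_imp_continuous: "smooth_on S f \<Longrightarrow> continuous_on S f"
  unfolding smooth_on_def by (metis Ck_on.simps(1))

lemma Ck_on_Suc_realI:
  fixes f :: "real \<Rightarrow> real"
  assumes "open S" "\<And>x. x \<in> S \<Longrightarrow> (f has_real_derivative f' x) (at x)" "Ck_on k S f'"
  shows "Ck_on (Suc k) S f"
  by (rule Ck_on_SucI[OF assms(1), where f' = "\<lambda>x v. v * f' x"])
    (use assms in \<open>auto simp: has_field_derivative_def mult_commute_abs
      intro!: Ck_on_bilinear[OF bounded_bilinear_mult] Ck_on_const\<close>)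

lemma smooth_on_inverse: "smooth_on (- {0::real}) inverse"
proof -
  have "Ck_on k (- {0::real}) inverse" for k
  proof (induction k)
    case 0 show ?case by (auto intro!: continuous_intros)
  next
    case (Suc k)
    show ?case
    proof (rule Ck_on_Suc_realI)
      show "Ck_on k (- {0::real}) (\<lambda>x. (-1) * (inverse x * inverse x))"
        by (intro Ck_on_bilinear[OF bounded_bilinear_mult] Ck_on_const Suc) auto
    qed (auto intro!: derivative_eq_intros)
  qed
  then show ?thesis by (simp add: smooth_on_def)
qed

lemma smooth_on_sqrt: "smooth_on {0<..} sqrt"
proof -
  have "Ck_on k {0<..} sqrt" for k
  proof (induction k)
    case 0 show ?case by (auto intro!: continuous_intros)
  next
    case (Suc k)
    show ?case
    proof (rule Ck_on_Suc_realI)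
      have "Ck_on k {0<..} (\<lambda>x. inverse (sqrt x))"
        by (rule Ck_on_compose[where T = "- {0}" and f = sqrt])
          (use Suc smooth_on_inverse in \<open>auto simp: smooth_on_def\<close>)
      then show "Ck_on k {0<..} (\<lambda>x. (1/2) * inverse (sqrt x))"
        by (intro Ck_on_bilinear[OF bounded_bilinear_mult] Ck_on_const) auto
    qed (auto intro!: derivative_eq_intros)
  qed
  then show ?thesis by (simp add: smooth_on_def)
qed

lemma smooth_on_ln: "smooth_on {0<..} (ln :: real \<Rightarrow> real)"
proof -
  have "Ck_on k {0<..} (ln :: real \<Rightarrow> real)" for k
  proof (cases k)
    case 0 then show ?thesis by (auto intro!: continuous_intros)
  next
    case (Suc j)
    have "Ck_on j {0<..} (inverse :: real \<Rightarrow> real)"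
      using smooth_on_inverse by (auto simp: smooth_on_def intro: Ck_on_subset)
    then show ?thesis unfolding Suc
      by (intro Ck_on_Suc_realI) (auto intro!: derivative_eq_intros simp: field_simps)
  qed
  then show ?thesis by (simp add: smooth_on_def)
qed

section \<open>Bump functions\<close>

text \<open>The function \<open>x\<^sup>-\<^sup>m e\<^sup>-\<^sup>1\<^sup>/\<^sup>x\<close>, extended by zero. The power is there to make the family closed under
  differentiation up to linear combinations.\<close>

definition flat :: "nat \<Rightarrow> real \<Rightarrow> real" where
  "flat m x = (if x > 0 then inverse x ^ m * exp (- inverse x) else 0)"

lemma flat_tendsto_0: "(flat m \<longlongrightarrow> 0) (at 0)"
proof (rule filterlim_split_at)
  show "(flat m \<longlongrightarrow> 0) (at_left 0)"
    by (rule Lim_transform_eventually[OF tendsto_const])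
      (auto simp: eventually_at_filter flat_def)
  have "((\<lambda>x. inverse x ^ m / exp (inverse x)) \<longlongrightarrow> (0::real)) (at_right 0)"
    by (rule filterlim_compose[OF tendsto_power_div_exp_0 filterlim_inverse_at_top_right])
  then show "(flat m \<longlongrightarrow> 0) (at_right 0)"
    by (rule Lim_transform_eventually)
      (auto simp: eventually_at_filter flat_def exp_minus field_simps)
qed

lemma flat_deriv: "(flat m has_real_derivative (flat (m + 2) x - real m * flat (m + 1) x)) (at x)"
proof -
  consider "x > 0" | "x < 0" | "x = 0" by linarith
  then show ?thesis
  proof cases
    case 1
    have "((\<lambda>x. inverse x ^ m) has_real_derivative (- real m * inverse x ^ (m + 1))) (at x)"
    proof (cases m)
      case (Suc k)
      then show ?thesis using DERIV_power[OF DERIV_inverse[of x UNIV], of m] 1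
        by (simp add: mult_ac) (simp add: algebra_simps)
    qed simp
    moreover have "((\<lambda>x. exp (- inverse x)) has_real_derivative (exp (- inverse x) * inverse x ^ 2)) (at x)"
      using 1 by (auto intro!: derivative_eq_intros simp: power2_eq_square)
    ultimately have *: "((\<lambda>x. inverse x ^ m * exp (- inverse x)) has_real_derivative
        (- real m * inverse x ^ (m + 1)) * exp (- inverse x)
        + (exp (- inverse x) * inverse x ^ 2) * inverse x ^ m) (at x)"
      by (rule DERIV_mult)
    have "(- real m * inverse x ^ (m + 1)) * exp (- inverse x)
        + (exp (- inverse x) * inverse x ^ 2) * inverse x ^ m = flat (m + 2) x - real m * flat (m + 1) x"
      using 1 by (simp add: flat_def power_add algebra_simps power2_eq_square)
    with * have "((\<lambda>x. inverse x ^ m * exp (- inverse x)) has_real_derivative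
        (flat (m + 2) x - real m * flat (m + 1) x)) (at x)" by (simp only:)
    then show ?thesis
      by (rule has_field_derivative_transform_within_open[where S = "{0<..}"])
        (use 1 in \<open>auto simp: flat_def\<close>)
  next
    case 2
    have "((\<lambda>x. 0) has_real_derivative (flat (m + 2) x - real m * flat (m + 1) x)) (at x)"
      using 2 by (auto simp: flat_def)
    then show ?thesis
      by (rule has_field_derivative_transform_within_open[where S = "{..<0}"])
        (use 2 in \<open>auto simp: flat_def\<close>)
  next
    case 3
    have "((\<lambda>h. (flat m (0 + h) - flat m 0) / h) \<longlongrightarrow> 0) (at 0)"
      by (rule Lim_transform_eventually[OF flat_tendsto_0[of "m + 1"]])
        (auto simp: eventually_at_filter flat_def field_simps)
    then show ?thesis unfolding 3 DERIV_def by (simp add: flat_def)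
  qed
qed

lemma smooth_on_flat: "smooth_on UNIV (flat m)"
proof -
  have "Ck_on k UNIV (flat m)" for k
  proof (induction k arbitrary: m)
    case 0
    show ?case
      by (auto intro!: continuous_at_imp_continuous_on DERIV_isCont flat_deriv)
  next
    case (Suc k)
    have "Ck_on k UNIV (\<lambda>x. flat (m + 2) x + (- real m) * flat (m + 1) x)"
      by (intro Ck_on_add Ck_on_bilinear[OF bounded_bilinear_mult] Ck_on_const Suc) auto
    then show ?case by (intro Ck_on_Suc_realI[OF _ flat_deriv]) auto
  qed
  then show ?thesis by (simp add: smooth_on_def)
qed

text \<open>With \<open>\<psi>\<close> a flat function, \<open>\<psi> (r\<^sup>2 - q) / (\<psi> (r\<^sup>2 - q) + \<psi> (q - r\<^sup>2 / 4))\<close> works for the squared distance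
  \<open>q\<close>: the two summands of the denominator never vanish together.\<close>

lemma bump_function_exists:
  fixes y0 :: "'a::euclidean_space"
  assumes "r > 0"
  obtains \<eta> :: "'a \<Rightarrow> real" where "smooth_on UNIV \<eta>"
    "\<And>y. dist y y0 \<le> r / 2 \<Longrightarrow> \<eta> y = 1" "\<And>y. dist y y0 \<ge> r \<Longrightarrow> \<eta> y = 0"
proof -
  define q where "q y = (y - y0) \<bullet> (y - y0)" for y
  have qd: "q y = (dist y y0)\<^sup>2" for y by (simp add: q_def dist_norm power2_norm_eq_inner)
  define \<psi> where "\<psi> = flat 0"
  have \<psi>pos: "\<psi> s > 0" if "s > 0" for s using that by (simp add: \<psi>_def flat_def)
  have \<psi>0: "\<psi> s = 0" if "s \<le> 0" for s using that by (simp add: \<psi>_def flat_def)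
  have \<psi>nn: "\<psi> s \<ge> 0" for s by (simp add: \<psi>_def flat_def)
  define d where "d y = \<psi> (r\<^sup>2 - q y) + \<psi> (q y - r\<^sup>2 / 4)" for y
  have dpos: "d y > 0" for y
  proof (cases "q y < r\<^sup>2")
    case True then show ?thesis using \<psi>pos[of "r\<^sup>2 - q y"] \<psi>nn by (simp add: d_def add_pos_nonneg)
  next
    case False
    moreover have "r\<^sup>2 > 0" using assms by simp
    ultimately have "q y - r\<^sup>2 / 4 > 0" by linarith
    then show ?thesis using \<psi>pos[of "q y - r\<^sup>2/4"] \<psi>nn by (simp add: d_def add_nonneg_pos)
  qed
  have lin: "smooth_on UNIV (\<lambda>y. y + (- y0))"
    by (intro smooth_on_add smooth_on_const smooth_on_bounded_linear) auto
  have sq: "smooth_on UNIV q"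
    unfolding q_def using smooth_on_bilinear[OF bounded_bilinear_inner open_UNIV lin lin] by simp
  have s1: "smooth_on UNIV (\<lambda>y. \<psi> (r\<^sup>2 - q y))" unfolding \<psi>_def
    by (rule smooth_on_compose[where T = UNIV and f = "\<lambda>y. r\<^sup>2 - q y"])
      (auto intro!: smooth_on_flat smooth_on_diff smooth_on_const sq)
  have s2: "smooth_on UNIV (\<lambda>y. \<psi> (q y - r\<^sup>2 / 4))" unfolding \<psi>_def
    by (rule smooth_on_compose[where T = UNIV and f = "\<lambda>y. q y - r\<^sup>2 / 4"])
      (auto intro!: smooth_on_flat smooth_on_diff smooth_on_const sq)
  have s3: "smooth_on UNIV d" using smooth_on_add[OF open_UNIV s1 s2] by (simp add: d_def[abs_def])
  have s4: "smooth_on UNIV (\<lambda>y. inverse (d y))"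
    by (rule smooth_on_compose[where T = "- {0}" and f = d])
      (use dpos s3 smooth_on_inverse in \<open>auto simp: less_le\<close>)
  show ?thesis
  proof
    show "smooth_on UNIV (\<lambda>y. \<psi> (r\<^sup>2 - q y) * inverse (d y))"
      by (intro smooth_on_mult s1 s4) auto
  next
    fix y assume "dist y y0 \<le> r / 2"
    then have "q y \<le> (r/2)\<^sup>2" unfolding qd by (intro power_mono) auto
    then have "\<psi> (q y - r\<^sup>2/4) = 0" by (intro \<psi>0) (simp add: power2_eq_square)
    then show "\<psi> (r\<^sup>2 - q y) * inverse (d y) = 1"
      using dpos[of y] by (simp add: d_def)
  next
    fix y assume "r \<le> dist y y0"
    then have "r\<^sup>2 \<le> q y" unfolding qd using assms by (intro power_mono) auto
    then show "\<psi> (r\<^sup>2 - q y) * inverse (d y) = 0" by (simp add: \<psi>0)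
  qed
qed

section \<open>Hadamard's lemma and the symmetry of second derivatives\<close>

text \<open>Differentiation under the integral sign produces one more factor \<open>s\<close>, so the induction runs over all
  weights \<open>s\<^sup>m\<close> simultaneously.\<close>

lemma Ck_on_ray_average:
  fixes h :: "'a::euclidean_space \<Rightarrow> real"
  assumes "Ck_on k (ball y0 r) h"
  shows "Ck_on k (ball y0 r) (\<lambda>y. integral (cbox 0 1) (\<lambda>s::real. s ^ m * h (y0 + s *\<^sub>R (y - y0))))"
  using assms
proof (induction k arbitrary: h m)
  have in_ball: "y0 + s *\<^sub>R (y - y0) \<in> ball y0 r" if "y \<in> ball y0 r" "s \<in> cbox 0 (1::real)" for y s
  proof -
    have "\<bar>s\<bar> * norm (y - y0) \<le> 1 * norm (y - y0)" using that by (intro mult_right_mono) auto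
    then show ?thesis using that by (simp add: dist_norm norm_minus_commute)
  qed
  have cont: "continuous_on (ball y0 r \<times> cbox 0 1) (\<lambda>(y, s). s ^ j * h (y0 + s *\<^sub>R (y - y0)))"
    if "continuous_on (ball y0 r) h" for h :: "'a \<Rightarrow> real" and j
    unfolding split_beta
    by (intro continuous_intros continuous_on_compose2[OF that]) (use in_ball in auto)
  {
    case 0
    then show ?case unfolding Ck_on.simps by (intro integral_continuous_on_param cont)
  next
    case (Suc k)
    let ?D = "\<lambda>y. frechet_derivative h (at y)"
    have dh: "(h has_derivative ?D y) (at y)" if "y \<in> ball y0 r" for y
      using Suc.prems that by (rule Ck_on_has_derivative)
    have ch: "continuous_on (ball y0 r) h"
      using Ck_on_le[OF Suc.prems, of 0] by simp
    have cD: "continuous_on (ball y0 r) (\<lambda>y. ?D y v)" for v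
    proof -
      have "Ck_on k (ball y0 r) (\<lambda>y. ?D y v)" using Suc.prems by simp
      then show ?thesis using Ck_on_le[of k _ _ 0] by fastforce
    qed
    define fx where "fx y s = Blinfun (\<lambda>v. s ^ Suc m * ?D (y0 + s *\<^sub>R (y - y0)) v)" for y s
    have fx: "blinfun_apply (fx y s) = (\<lambda>v. s ^ Suc m * ?D (y0 + s *\<^sub>R (y - y0)) v)"
      if "y \<in> ball y0 r" "s \<in> cbox 0 1" for y s
      unfolding fx_def
      by (intro bounded_linear_Blinfun_apply bounded_linear_const_mult has_derivative_bounded_linear[OF dh[OF in_ball[OF that]]])
    have cfx: "continuous_on (ball y0 r \<times> cbox 0 1) (\<lambda>(y, s). fx y s)"
    proof (rule continuous_on_blinfun_componentwise)
      fix i :: 'a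
      have "continuous_on (ball y0 r \<times> cbox 0 1) (\<lambda>(y, s). s ^ Suc m * ?D (y0 + s *\<^sub>R (y - y0)) i)"
        by (rule cont[OF cD])
      then show "continuous_on (ball y0 r \<times> cbox 0 1) (\<lambda>p. blinfun_apply (case p of (y, s) \<Rightarrow> fx y s) i)"
        by (rule continuous_on_eq) (auto simp: fx)
    qed
    show ?case
    proof (rule Ck_on_SucI)
      fix y assume y: "y \<in> ball y0 r"
      have "((\<lambda>y. integral (cbox 0 1) (\<lambda>s. s ^ m * h (y0 + s *\<^sub>R (y - y0)))) has_derivative
          integral (cbox 0 1) (fx y)) (at y within ball y0 r)"
      proof (rule leibniz_rule[OF _ _ cfx y convex_ball])
        fix z and s :: real assume z: "z \<in> ball y0 r" and s: "s \<in> cbox 0 1"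
        have lin: "((\<lambda>z. y0 + s *\<^sub>R (z - y0)) has_derivative (\<lambda>v. s *\<^sub>R v)) (at z)"
          by (auto intro!: derivative_eq_intros)
        have "((\<lambda>z. h (y0 + s *\<^sub>R (z - y0))) has_derivative (\<lambda>v. ?D (y0 + s *\<^sub>R (z - y0)) (s *\<^sub>R v))) (at z)"
          by (rule has_derivative_compose[OF lin dh[OF in_ball[OF z s]]])
        then have "((\<lambda>z. s ^ m * h (y0 + s *\<^sub>R (z - y0))) has_derivative
            (\<lambda>v. s ^ m * ?D (y0 + s *\<^sub>R (z - y0)) (s *\<^sub>R v))) (at z)"
          by (rule has_derivative_mult_right)
        moreover have "(\<lambda>v. s ^ m * ?D (y0 + s *\<^sub>R (z - y0)) (s *\<^sub>R v)) = blinfun_apply (fx z s)"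
          unfolding fx[OF z s]
          by (simp add: linear_cmul[OF has_derivative_linear[OF dh[OF in_ball[OF z s]]]] mult_ac)
        ultimately show "((\<lambda>z. s ^ m * h (y0 + s *\<^sub>R (z - y0))) has_derivative blinfun_apply (fx z s))
            (at z within ball y0 r)"
          by (metis has_derivative_at_withinI)
      next
        fix z assume z: "z \<in> ball y0 r"
        show "(\<lambda>s. s ^ m * h (y0 + s *\<^sub>R (z - y0))) integrable_on cbox 0 1"
          by (intro integrable_continuous continuous_intros continuous_on_compose2[OF ch])
            (use in_ball z in auto)
      qed
      moreover have "(\<lambda>v. blinfun_apply (integral (cbox 0 1) (fx y)) v) =
          (\<lambda>v. integral (cbox 0 1) (\<lambda>s. s ^ Suc m * ?D (y0 + s *\<^sub>R (y - y0)) v))"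
      proof
        fix v
        have "continuous_on (cbox 0 1) (\<lambda>s. case (y, s) of (y, s) \<Rightarrow> fx y s)"
          by (rule continuous_on_compose2[OF cfx]) (use y in \<open>auto intro!: continuous_intros\<close>)
        then have ci: "continuous_on (cbox 0 1) (fx y)" by simp
        have "blinfun_apply (integral (cbox 0 1) (fx y)) v = integral (cbox 0 1) (\<lambda>s. blinfun_apply (fx y s) v)"
          by (rule blinfun_apply_integral[OF integrable_continuous[OF ci]])
        also have "\<dots> = integral (cbox 0 1) (\<lambda>s. s ^ Suc m * ?D (y0 + s *\<^sub>R (y - y0)) v)"
          by (rule Henstock_Kurzweil_Integration.integral_cong) (use fx y in auto)
        finally show "blinfun_apply (integral (cbox 0 1) (fx y)) v =
          integral (cbox 0 1) (\<lambda>s. s ^ Suc m * ?D (y0 + s *\<^sub>R (y - y0)) v)" .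
      qed
      ultimately show "((\<lambda>y. integral (cbox 0 1) (\<lambda>s. s ^ m * h (y0 + s *\<^sub>R (y - y0)))) has_derivative
          (\<lambda>v. integral (cbox 0 1) (\<lambda>s. s ^ Suc m * ?D (y0 + s *\<^sub>R (y - y0)) v))) (at y)"
        using y by (simp add: at_within_open[OF y open_ball])
    next
      show "Ck_on k (ball y0 r) (\<lambda>y. integral (cbox 0 1) (\<lambda>s. s ^ Suc m * ?D (y0 + s *\<^sub>R (y - y0)) v))" for v
        by (rule Suc.IH) (use Suc.prems in simp)
    qed simp
  }
qed

text \<open>Hadamard's lemma: integrate the derivative of \<open>h\<close> along the ray from \<open>y0\<close>. It is the reason why
  derivations of smooth functions are directional derivatives.\<close>

lemma hadamard:
  fixes h :: "'a::euclidean_space \<Rightarrow> real"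
  assumes "smooth_on (ball y0 r) h" "r > 0"
  obtains k where "\<forall>b\<in>Basis. smooth_on (ball y0 r) (k b)"
    "\<forall>b\<in>Basis. k b y0 = frechet_derivative h (at y0) b"
    "\<forall>y\<in>ball y0 r. h y = h y0 + (\<Sum>b\<in>Basis. ((y - y0) \<bullet> b) * k b y)"
proof -
  let ?D = "\<lambda>y. frechet_derivative h (at y)"
  define k where "k b y = integral (cbox 0 1) (\<lambda>s::real. s ^ 0 * ?D (y0 + s *\<^sub>R (y - y0)) b)" for b y
  have 1: "smooth_on (ball y0 r) (k b)" for b
    unfolding smooth_on_def k_def
    by (intro allI Ck_on_ray_average) (use smooth_on_deriv[OF assms(1)] in \<open>simp add: smooth_on_def\<close>)
  have 2: "k b y0 = ?D y0 b" for b by (simp add: k_def)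
  have 3: "h y = h y0 + (\<Sum>b\<in>Basis. ((y - y0) \<bullet> b) * k b y)" if y: "y \<in> ball y0 r" for y
  proof -
  have in_ball: "y0 + s *\<^sub>R (y - y0) \<in> ball y0 r" if "s \<in> {0..1::real}" for s
  proof -
    have "\<bar>s\<bar> * norm (y - y0) \<le> 1 * norm (y - y0)" using that by (intro mult_right_mono) auto
    then show ?thesis using y by (simp add: dist_norm norm_minus_commute)
  qed
  have dh: "(h has_derivative ?D z) (at z)" if "z \<in> ball y0 r" for z
    using smooth_on_has_derivative[OF assms(1) that] .
  have cD: "continuous_on {0..1} (\<lambda>s::real. ?D (y0 + s *\<^sub>R (y - y0)) b)" for b
    by (rule continuous_on_compose2[OF smooth_on_imp_continuous[OF smooth_on_deriv[OF assms(1)]]])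
      (use in_ball in \<open>auto intro!: continuous_intros\<close>)
  have "((\<lambda>s. ?D (y0 + s *\<^sub>R (y - y0)) (y - y0)) has_integral
      (h (y0 + 1 *\<^sub>R (y - y0)) - h (y0 + 0 *\<^sub>R (y - y0)))) {0..1}"
  proof (rule fundamental_theorem_of_calculus)
    fix s :: real assume s: "s \<in> {0..1}"
    have lin: "((\<lambda>s. y0 + s *\<^sub>R (y - y0)) has_derivative (\<lambda>t. t *\<^sub>R (y - y0))) (at s)"
      by (auto intro!: derivative_eq_intros)
    have "((\<lambda>s. h (y0 + s *\<^sub>R (y - y0))) has_derivative (\<lambda>t. ?D (y0 + s *\<^sub>R (y - y0)) (t *\<^sub>R (y - y0)))) (at s)"
      by (rule has_derivative_compose[OF lin dh[OF in_ball[OF s]]])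
    then show "((\<lambda>s. h (y0 + s *\<^sub>R (y - y0))) has_vector_derivative ?D (y0 + s *\<^sub>R (y - y0)) (y - y0)) (at s within {0..1})"
      unfolding has_vector_derivative_def
      using linear_cmul[OF has_derivative_linear[OF dh[OF in_ball[OF s]]]]
      by (simp add: has_derivative_at_withinI)
  qed simp
  then have "h y - h y0 = integral {0..1} (\<lambda>s. ?D (y0 + s *\<^sub>R (y - y0)) (y - y0))"
    by (simp add: integral_unique)
  also have "\<dots> = integral {0..1} (\<lambda>s. \<Sum>b\<in>Basis. ((y - y0) \<bullet> b) * ?D (y0 + s *\<^sub>R (y - y0)) b)"
  proof (rule Henstock_Kurzweil_Integration.integral_cong)
    fix s :: real assume s: "s \<in> {0..1}"
    interpret linear "?D (y0 + s *\<^sub>R (y - y0))"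
      by (rule has_derivative_linear[OF dh[OF in_ball[OF s]]])
    have "?D (y0 + s *\<^sub>R (y - y0)) (\<Sum>b\<in>Basis. ((y - y0) \<bullet> b) *\<^sub>R b) =
        (\<Sum>b\<in>Basis. ((y - y0) \<bullet> b) * ?D (y0 + s *\<^sub>R (y - y0)) b)"
      by (simp only: sum scale real_scaleR_def)
    then show "?D (y0 + s *\<^sub>R (y - y0)) (y - y0) = (\<Sum>b\<in>Basis. ((y - y0) \<bullet> b) * ?D (y0 + s *\<^sub>R (y - y0)) b)"
      by (simp add: euclidean_representation)
  qed
  also have "\<dots> = (\<Sum>b\<in>Basis. integral {0..1} (\<lambda>s. ((y - y0) \<bullet> b) * ?D (y0 + s *\<^sub>R (y - y0)) b))"
    by (intro integral_sum integrable_continuous_real continuous_intros cD) auto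
  also have "\<dots> = (\<Sum>b\<in>Basis. ((y - y0) \<bullet> b) * k b y)" by (simp add: k_def)
  finally show ?thesis by simp
  qed
  show thesis by (rule that[of k]) (use 1 2 3 in blast)+
qed

lemma has_real_derivative_along_line:
  assumes "smooth_on S f" "x + s *\<^sub>R u \<in> S"
  shows "((\<lambda>s. f (x + s *\<^sub>R u)) has_real_derivative frechet_derivative f (at (x + s *\<^sub>R u)) u) (at s)"
proof -
  let ?D = "frechet_derivative f (at (x + s *\<^sub>R u))"
  have dh: "(f has_derivative ?D) (at (x + s *\<^sub>R u))" using smooth_on_has_derivative assms by blast
  have lin: "((\<lambda>s. x + s *\<^sub>R u) has_derivative (\<lambda>t. t *\<^sub>R u)) (at s)"
    by (auto intro!: derivative_eq_intros)
  show ?thesis unfolding has_field_derivative_def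
    using has_derivative_compose[OF lin dh] linear_cmul[OF has_derivative_linear[OF dh]]
    by (simp add: mult_commute_abs)
qed

text \<open>The left-hand side of the equation is symmetric in \<open>u\<close> and \<open>v\<close>, whereas two applications of the mean
  value theorem express it by a second derivative in a prescribed order.\<close>

lemma second_difference_mvt:
  assumes "smooth_on (ball x \<delta>) f" "h > 0" "h * (norm u + norm v) < \<delta>"
  obtains p where "dist p x < \<delta>"
    "f (x + h *\<^sub>R u + h *\<^sub>R v) - f (x + h *\<^sub>R u) - f (x + h *\<^sub>R v) + f x
      = h * h * frechet_derivative (\<lambda>y. frechet_derivative f (at y) u) (at p) v"
proof -
  have inb: "x + s *\<^sub>R u + t *\<^sub>R v \<in> ball x \<delta>" if "0 \<le> s" "s \<le> h" "0 \<le> t" "t \<le> h" for s t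
  proof -
    have "norm (s *\<^sub>R u + t *\<^sub>R v) \<le> s * norm u + t * norm v"
      by (rule order_trans[OF norm_triangle_ineq]) (use that in simp)
    also have "\<dots> \<le> h * norm u + h * norm v" using that by (intro add_mono mult_right_mono) auto
    also have "\<dots> < \<delta>" using assms(3) by (simp add: algebra_simps)
    finally have "norm (x - (x + (s *\<^sub>R u + t *\<^sub>R v))) < \<delta>" by (simp add: norm_minus_commute del: norm_minus_cancel) (metis norm_minus_cancel add.commute minus_add_distrib uminus_add_conv_diff)
    then show ?thesis by (simp add: dist_norm add.assoc)
  qed
  let ?D = "\<lambda>y. frechet_derivative f (at y) u"
  have "\<exists>z>0. z < h \<and> (f (x + h *\<^sub>R v + h *\<^sub>R u) - f (x + h *\<^sub>R u)) - (f (x + h *\<^sub>R v + 0 *\<^sub>R u) - f (x + 0 *\<^sub>R u))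
      = (h - 0) * (?D (x + h *\<^sub>R v + z *\<^sub>R u) - ?D (x + z *\<^sub>R u))"
    by (rule MVT2[OF assms(2)], intro DERIV_diff has_real_derivative_along_line[OF assms(1)])
      (use inb[of _ h] inb[of _ 0] assms(2) in \<open>auto simp: add_ac\<close>)
  then obtain s where s: "0 < s" "s < h" and 1: "(f (x + h *\<^sub>R v + h *\<^sub>R u) - f (x + h *\<^sub>R u)) - (f (x + h *\<^sub>R v) - f x)
      = h * (?D (x + h *\<^sub>R v + s *\<^sub>R u) - ?D (x + s *\<^sub>R u))" by auto
  have "\<exists>z>0. z < h \<and> ?D (x + s *\<^sub>R u + h *\<^sub>R v) - ?D (x + s *\<^sub>R u + 0 *\<^sub>R v)
      = (h - 0) * frechet_derivative ?D (at (x + s *\<^sub>R u + z *\<^sub>R v)) v"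
    by (rule MVT2[OF assms(2)], intro has_real_derivative_along_line[OF smooth_on_deriv[OF assms(1)]])
      (use inb[of s] s in auto)
  then obtain t where t: "0 < t" "t < h" and 2: "?D (x + s *\<^sub>R u + h *\<^sub>R v) - ?D (x + s *\<^sub>R u)
      = h * frechet_derivative ?D (at (x + s *\<^sub>R u + t *\<^sub>R v)) v" by auto
  show ?thesis
  proof
    show "dist (x + s *\<^sub>R u + t *\<^sub>R v) x < \<delta>" using inb[of s t] s t by (simp add: dist_commute)
    show "f (x + h *\<^sub>R u + h *\<^sub>R v) - f (x + h *\<^sub>R u) - f (x + h *\<^sub>R v) + f x
      = h * h * frechet_derivative ?D (at (x + s *\<^sub>R u + t *\<^sub>R v)) v"
      using 1 2 by (simp add: algebra_simps)
  qed
qed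

lemma second_derivative_symmetric:
  fixes f :: "'a::euclidean_space \<Rightarrow> real"
  assumes "open S" "smooth_on S f" "x \<in> S"
  shows "frechet_derivative (\<lambda>y. frechet_derivative f (at y) u) (at x) v
       = frechet_derivative (\<lambda>y. frechet_derivative f (at y) v) (at x) u" (is "?A x = ?B x")
proof (rule ccontr)
  assume ne: "?A x \<noteq> ?B x"
  define e where "e = \<bar>?A x - ?B x\<bar> / 2"
  have e: "e > 0" using ne by (simp add: e_def)
  have cA: "isCont ?A x" and cB: "isCont ?B x"
    using smooth_on_imp_continuous[OF smooth_on_deriv[OF smooth_on_deriv[OF assms(2)]]] assms
    by (auto simp: continuous_on_eq_continuous_at)
  obtain d1 where d1: "d1 > 0" "\<And>p. dist p x < d1 \<Longrightarrow> \<bar>?A p - ?A x\<bar> < e"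
    using cA e unfolding continuous_at_eps_delta by (auto simp: dist_real_def)
  obtain d2 where d2: "d2 > 0" "\<And>p. dist p x < d2 \<Longrightarrow> \<bar>?B p - ?B x\<bar> < e"
    using cB e unfolding continuous_at_eps_delta by (auto simp: dist_real_def)
  obtain d3 where d3: "d3 > 0" "ball x d3 \<subseteq> S" using assms(1,3) openE by blast
  define d where "d = min d1 (min d2 d3)"
  have d: "d > 0" using d1 d2 d3 by (simp add: d_def)
  have sm: "smooth_on (ball x d) f"
    by (rule smooth_on_subset[OF assms(2)]) (use d3 in \<open>auto simp: d_def\<close>)
  define h where "h = d / (norm u + norm v + 1)"
  have np: "norm u + norm v + 1 > 0" using norm_ge_zero[of u] norm_ge_zero[of v] by linarith
  have h: "h > 0" "h * (norm u + norm v) < d" using d np by (auto simp: h_def field_simps)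
  obtain p where p: "dist p x < d" and 1:
    "f (x + h *\<^sub>R u + h *\<^sub>R v) - f (x + h *\<^sub>R u) - f (x + h *\<^sub>R v) + f x = h * h * ?A p"
    using second_difference_mvt[OF sm h] by blast
  have h': "h * (norm v + norm u) < d" using h by (simp add: add.commute)
  obtain q where q: "dist q x < d" and 2:
    "f (x + h *\<^sub>R v + h *\<^sub>R u) - f (x + h *\<^sub>R v) - f (x + h *\<^sub>R u) + f x = h * h * ?B q"
    using second_difference_mvt[OF sm h(1) h'] by blast
  have "h * h * ?A p = h * h * ?B q" using 1 2 by (simp add: algebra_simps)
  then have "?A p = ?B q" using h by simp
  moreover have "\<bar>?A p - ?A x\<bar> < e" "\<bar>?B q - ?B x\<bar> < e" using d1 d2 p q by (auto simp: d_def)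
  ultimately show False unfolding e_def by (simp add: abs_if split: if_splits)
qed


section \<open>Smooth functions and bump functions on a manifold\<close>

lemma smooth_funsD:
  "f \<in> smooth_funs A \<Longrightarrow> (U, \<phi>) \<in> A \<Longrightarrow> smooth_on (\<phi> ` U) (f \<circ> inv_into U \<phi>)"
  by (auto simp: smooth_funs_def)

context smooth_manifold
begin

lemma chart_open: "(U, \<phi>) \<in> A \<Longrightarrow> open U" "(U, \<phi>) \<in> A \<Longrightarrow> open (\<phi> ` U)"
  using chart by auto

lemma chart_inv [simp]:
  "(U, \<phi>) \<in> A \<Longrightarrow> x \<in> U \<Longrightarrow> inv_into U \<phi> (\<phi> x) = x"
  using chart unfolding homeomorphism_def by blast

lemma chart_inv_in: "y \<in> \<phi> ` U \<Longrightarrow> inv_into U \<phi> y \<in> U"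
  by (rule inv_into_into)

lemma chart_continuous: "(U, \<phi>) \<in> A \<Longrightarrow> continuous_on U \<phi>"
  "(U, \<phi>) \<in> A \<Longrightarrow> continuous_on (\<phi> ` U) (inv_into U \<phi>)"
  using chart unfolding homeomorphism_def by blast+

lemma chart_at: obtains U \<phi> where "(U, \<phi>) \<in> A" "x \<in> U"
proof -
  have "x \<in> (\<Union>(U, \<phi>)\<in>A. U)" unfolding cover by (rule UNIV_I)
  then obtain p where "p \<in> A" "x \<in> fst p" unfolding UN_iff case_prod_beta by (elim bexE)
  then show thesis using that[of "fst p" "snd p"] by simp
qed

lemma open_chart_preimage:
  assumes "(U, \<phi>) \<in> A" "open W" shows "open (\<phi> ` U \<inter> inv_into U \<phi> -` W)"
  using continuous_open_preimage[OF chart_continuous(2)[OF assms(1)] chart_open(2)[OF assms(1)] assms(2)] .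

lemma open_chart_domain:
  assumes "(U, \<phi>) \<in> A" "open T" shows "open (U \<inter> \<phi> -` T)"
  using continuous_open_preimage[OF chart_continuous(1)[OF assms(1)] chart_open(1)[OF assms(1)] assms(2)] .

lemma smooth_funs_const: "(\<lambda>x. c) \<in> smooth_funs A"
  by (auto simp: smooth_funs_def o_def intro!: smooth_on_const chart_open)

lemma smooth_funs_add: "f \<in> smooth_funs A \<Longrightarrow> h \<in> smooth_funs A \<Longrightarrow> (\<lambda>x. f x + h x) \<in> smooth_funs A"
  by (auto simp: smooth_funs_def o_def intro!: smooth_on_add chart_open)

lemma smooth_funs_diff: "f \<in> smooth_funs A \<Longrightarrow> h \<in> smooth_funs A \<Longrightarrow> (\<lambda>x. f x - h x) \<in> smooth_funs A"
  by (auto simp: smooth_funs_def o_def intro!: smooth_on_diff chart_open)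

lemma smooth_funs_mult: "f \<in> smooth_funs A \<Longrightarrow> h \<in> smooth_funs A \<Longrightarrow> (\<lambda>x. f x * h x) \<in> smooth_funs A"
  by (auto simp: smooth_funs_def o_def intro!: smooth_on_mult chart_open)

lemma smooth_funs_minus: "f \<in> smooth_funs A \<Longrightarrow> (\<lambda>x. - f x) \<in> smooth_funs A"
  using smooth_funs_mult[OF smooth_funs_const[of "-1"]] by simp

lemma smooth_funs_power: "f \<in> smooth_funs A \<Longrightarrow> (\<lambda>x. (f x)\<^sup>2) \<in> smooth_funs A"
  by (simp add: power2_eq_square smooth_funs_mult)

lemma smooth_funs_sum:
  "(\<And>i. i \<in> I \<Longrightarrow> f i \<in> smooth_funs A) \<Longrightarrow> (\<lambda>x. \<Sum>i\<in>I. f i x) \<in> smooth_funs A"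
  by (auto simp: smooth_funs_def o_def intro!: smooth_on_sum chart_open)

lemma smooth_funs_compose:
  assumes "f \<in> smooth_funs A" "open T" "\<And>x. f x \<in> T" "smooth_on T H"
  shows "(\<lambda>x. H (f x) :: real) \<in> smooth_funs A"
  unfolding smooth_funs_def
proof clarify
  fix U \<phi> assume U: "(U, \<phi>) \<in> A"
  have "smooth_on (\<phi> ` U) (\<lambda>x. H ((f \<circ> inv_into U \<phi>) x))"
    by (rule smooth_on_compose[OF chart_open(2)[OF U] assms(2) _ smooth_funsD[OF assms(1) U] assms(4)])
      (use assms(3) in auto)
  then show "smooth_on (\<phi> ` U) ((\<lambda>x. H (f x)) \<circ> inv_into U \<phi>)" by (simp add: o_def)
qed

lemma smooth_funs_continuous: "f \<in> smooth_funs A \<Longrightarrow> continuous_on UNIV f"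
proof (rule continuous_at_imp_continuous_on, rule ballI)
  fix x assume f: "f \<in> smooth_funs A"
  obtain U \<phi> where U: "(U, \<phi>) \<in> A" "x \<in> U" by (rule chart_at)
  have "continuous_on U (\<lambda>x. (f \<circ> inv_into U \<phi>) (\<phi> x))"
    by (rule continuous_on_compose2[OF smooth_on_imp_continuous[OF smooth_funsD[OF f U(1)]]
          chart_continuous(1)[OF U(1)]]) simp
  then have "continuous_on U f" by (rule continuous_on_eq) (use U in simp)
  then show "isCont f x" using U chart_open(1)[OF U(1)] by (simp add: continuous_on_eq_continuous_at)
qed

text \<open>The Hausdorff property enters here: the compact support is closed in the manifold, so
  that extension by zero does not destroy smoothness at the boundary of the chart.\<close>

lemma chart_cutoff_smooth:
  assumes U: "(U, \<phi>) \<in> A" and T: "open T" "T \<subseteq> \<phi> ` U" and K: "compact K" "K \<subseteq> T"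
    and h: "smooth_on T h" "\<And>y. y \<in> T - K \<Longrightarrow> h y = 0"
  shows "(\<lambda>x. if x \<in> U \<and> \<phi> x \<in> T then h (\<phi> x) else 0 :: real) \<in> smooth_funs A"
    (is "?f \<in> _")
  unfolding smooth_funs_def
proof clarify
  fix V \<psi> assume V: "(V, \<psi>) \<in> A"
  show "smooth_on (\<psi> ` V) (?f \<circ> inv_into V \<psi>)"
  proof (rule smooth_on_local)
    fix z assume z: "z \<in> \<psi> ` V"
    define x where "x = inv_into V \<psi> z"
    have xV: "x \<in> V" "\<psi> x = z" using z unfolding x_def by (simp_all add: chart_inv_in f_inv_into_f)
    show "\<exists>T. open T \<and> z \<in> T \<and> smooth_on T (?f \<circ> inv_into V \<psi>)"
    proof (cases "x \<in> U \<and> \<phi> x \<in> T")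
      case True
      let ?S = "\<psi> ` (V \<inter> U)" and ?\<tau> = "\<phi> \<circ> inv_into V \<psi>"
      have S: "?S = \<psi> ` V \<inter> inv_into V \<psi> -` U"
      proof (intro set_eqI iffI)
        fix y assume "y \<in> ?S"
        then obtain u where "u \<in> V" "u \<in> U" "y = \<psi> u" by blast
        then show "y \<in> \<psi> ` V \<inter> inv_into V \<psi> -` U" using V by simp
      next
        fix y assume y: "y \<in> \<psi> ` V \<inter> inv_into V \<psi> -` U"
        then have "inv_into V \<psi> y \<in> V \<inter> U" "\<psi> (inv_into V \<psi> y) = y"
          by (simp_all add: chart_inv_in f_inv_into_f)
        then show "y \<in> ?S" by (metis imageI)
      qed
      have oS: "open ?S" unfolding S by (rule open_chart_preimage[OF V chart_open(1)[OF U]])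
      have sm: "smooth_on ?S ?\<tau>" by (rule compatible[OF V U])
      let ?T = "?S \<inter> ?\<tau> -` T"
      have oT: "open ?T"
        by (rule continuous_open_preimage[OF smooth_on_imp_continuous[OF sm] oS T(1)])
      have "smooth_on ?T (\<lambda>y. h (?\<tau> y))"
        by (rule smooth_on_compose[OF oT T(1) _ smooth_on_subset[OF sm] h(1)]) auto
      then have "smooth_on ?T (?f \<circ> inv_into V \<psi>)"
      proof (rule smooth_on_cong[OF oT])
        fix y assume "y \<in> ?T"
        then have "inv_into V \<psi> y \<in> U" "\<phi> (inv_into V \<psi> y) \<in> T" unfolding S by simp_all
        then show "h (?\<tau> y) = (?f \<circ> inv_into V \<psi>) y" by simp
      qed
      moreover have "z \<in> ?T" unfolding S using True z by (simp add: x_def)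
      ultimately show ?thesis using oT by blast
    next
      case False
      define C where "C = inv_into U \<phi> ` K"
      have "compact C" unfolding C_def
        by (rule compact_continuous_image[OF
              continuous_on_subset[OF chart_continuous(2)[OF U] order_trans[OF K(2) T(2)]] K(1)])
      then have oC: "open (- C)" by (simp add: compact_imp_closed open_Compl)
      let ?T = "\<psi> ` V \<inter> inv_into V \<psi> -` (- C)"
      have oT: "open ?T" by (rule open_chart_preimage[OF V oC])
      have xC: "x \<notin> C"
      proof
        assume "x \<in> C"
        then obtain k where k: "k \<in> K" "x = inv_into U \<phi> k" by (auto simp: C_def)
        then have "k \<in> \<phi> ` U" using K T by blast
        then have "x \<in> U" "\<phi> x = k" unfolding k(2) by (simp_all add: chart_inv_in f_inv_into_f)
        then show False using False k K by blast
      qed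
      have "?f (inv_into V \<psi> y) = 0" if "y \<in> ?T" for y
      proof (cases "inv_into V \<psi> y \<in> U \<and> \<phi> (inv_into V \<psi> y) \<in> T")
        case True
        have "\<phi> (inv_into V \<psi> y) \<notin> K"
        proof
          assume "\<phi> (inv_into V \<psi> y) \<in> K"
          then have "inv_into U \<phi> (\<phi> (inv_into V \<psi> y)) \<in> C" by (simp add: C_def)
          then show False using that True U by simp
        qed
        then show ?thesis using h(2)[of "\<phi> (inv_into V \<psi> y)"] True by simp
      next
        case False then show ?thesis by (simp only: if_False)
      qed
      then have "smooth_on ?T (?f \<circ> inv_into V \<psi>)"
        by (intro smooth_on_cong[OF oT smooth_on_const[OF oT, of 0]]) (simp only: o_apply)
      moreover have "z \<in> ?T" using xC z by (simp add: x_def)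
      ultimately show ?thesis using oT by blast
    qed
  qed
qed

text \<open>The cut-off \<open>\<eta>\<close> turns any function that is smooth on a piece of a chart into a global smooth
  function that agrees with it on \<open>N\<close>.\<close>

lemma chart_bump:
  assumes U: "(U, \<phi>) \<in> A" "x0 \<in> U" and T: "open T" "\<phi> x0 \<in> T" "T \<subseteq> \<phi> ` U"
  obtains N and \<eta> :: "'e \<Rightarrow> real" where "open N" "x0 \<in> N" "N \<subseteq> U" "\<phi> ` N \<subseteq> T"
    "\<forall>x\<in>N. \<eta> (\<phi> x) = 1"
    "\<forall>h. smooth_on T h \<longrightarrow>
      (\<lambda>x. if x \<in> U \<and> \<phi> x \<in> T then \<eta> (\<phi> x) * h (\<phi> x) else 0) \<in> smooth_funs A"
proof -
  obtain r where r: "r > 0" "cball (\<phi> x0) r \<subseteq> T" using T(1,2) open_contains_cball by blast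
  obtain \<eta> :: "'e \<Rightarrow> real" where \<eta>: "smooth_on UNIV \<eta>"
    "\<And>y. dist y (\<phi> x0) \<le> r / 2 \<Longrightarrow> \<eta> y = 1" "\<And>y. dist y (\<phi> x0) \<ge> r \<Longrightarrow> \<eta> y = 0"
    using bump_function_exists[OF r(1), of "\<phi> x0"] by blast
  show thesis
  proof
    let ?N = "U \<inter> \<phi> -` ball (\<phi> x0) (r / 2)"
    show "open ?N" by (rule open_chart_domain[OF U(1)]) simp
    show "x0 \<in> ?N" using U r by simp
    show "\<phi> ` ?N \<subseteq> T" using r by (auto intro!: subsetD[OF r(2)])
    show "\<forall>x\<in>?N. \<eta> (\<phi> x) = 1" by (intro ballI \<eta>) (auto simp: dist_commute)
    show "\<forall>h. smooth_on T h \<longrightarrow>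
      (\<lambda>x. if x \<in> U \<and> \<phi> x \<in> T then \<eta> (\<phi> x) * h (\<phi> x) else 0) \<in> smooth_funs A"
    proof (intro allI impI)
      fix h :: "'e \<Rightarrow> real" assume that: "smooth_on T h"
      show "(\<lambda>x. if x \<in> U \<and> \<phi> x \<in> T then \<eta> (\<phi> x) * h (\<phi> x) else 0) \<in> smooth_funs A"
      by (rule chart_cutoff_smooth[where K = "cball (\<phi> x0) r"])
        (use that U T r \<eta> in \<open>auto intro!: smooth_on_mult smooth_on_subset[OF \<eta>(1)] simp: dist_commute\<close>)
    qed
  qed auto
qed

lemma bump_on_manifold:
  assumes "open W" "x0 \<in> W"
  obtains N \<eta> where "open N" "x0 \<in> N" "N \<subseteq> W" "\<eta> \<in> smooth_funs A"
    "\<And>x. x \<in> N \<Longrightarrow> \<eta> x = 1" "\<And>x. x \<notin> W \<Longrightarrow> \<eta> x = 0"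
proof -
  obtain U \<phi> where U: "(U, \<phi>) \<in> A" "x0 \<in> U" by (rule chart_at)
  let ?T = "\<phi> ` U \<inter> inv_into U \<phi> -` W"
  have T: "open ?T" by (rule open_chart_preimage[OF U(1) assms(1)])
  obtain N and \<eta> :: "'e \<Rightarrow> real" where N: "open N" "x0 \<in> N" "N \<subseteq> U" "\<phi> ` N \<subseteq> ?T"
    "\<forall>x\<in>N. \<eta> (\<phi> x) = 1"
    "\<forall>h. smooth_on ?T h \<longrightarrow>
      (\<lambda>x. if x \<in> U \<and> \<phi> x \<in> ?T then \<eta> (\<phi> x) * h (\<phi> x) else 0) \<in> smooth_funs A"
    by (rule chart_bump[OF U T]) (use U assms in auto)
  show thesis
  proof
    show "(\<lambda>x. if x \<in> U \<and> \<phi> x \<in> ?T then \<eta> (\<phi> x) * 1 else 0) \<in> smooth_funs A"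
      by (rule N(6)[rule_format, OF smooth_on_const[OF T]])
    show NW: "N \<subseteq> W"
    proof
      fix y assume y: "y \<in> N"
      then have "y \<in> U" "inv_into U \<phi> (\<phi> y) \<in> W" using N(3,4) by blast+
      then show "y \<in> W" using U(1) by simp
    qed
    show "(if x \<in> U \<and> \<phi> x \<in> ?T then \<eta> (\<phi> x) * 1 else 0) = 1" if "x \<in> N" for x
      using N(3,4,5) that by (simp add: subset_iff)
    show "(if x \<in> U \<and> \<phi> x \<in> ?T then \<eta> (\<phi> x) * 1 else 0) = 0" if "x \<notin> W" for x
      using that by (cases "x \<in> U") (simp_all add: U(1))
  qed (use N in auto)
qed

section \<open>Tangent vectors in coordinates\<close>

lemma tangentD:
  assumes "v \<in> tangent_space A x"
  shows "f \<in> smooth_funs A \<Longrightarrow> h \<in> smooth_funs A \<Longrightarrow> v (\<lambda>y. f y + h y) = v f + v h"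
    and "f \<in> smooth_funs A \<Longrightarrow> v (\<lambda>y. c * f y) = c * v f"
    and "f \<in> smooth_funs A \<Longrightarrow> h \<in> smooth_funs A \<Longrightarrow> v (\<lambda>y. f y * h y) = v f * h x + f x * v h"
    and "f \<notin> smooth_funs A \<Longrightarrow> v f = 0"
  using assms unfolding tangent_space_def lin_on_def
  by (auto simp: plus_fun_def times_fun_def scaleR_fun_def)

lemma tangentI:
  assumes "\<And>f h. f \<in> smooth_funs A \<Longrightarrow> h \<in> smooth_funs A \<Longrightarrow> v (\<lambda>y. f y + h y) = v f + v h"
    and "\<And>c f. f \<in> smooth_funs A \<Longrightarrow> v (\<lambda>y. c * f y) = c * v f"
    and "\<And>f h. f \<in> smooth_funs A \<Longrightarrow> h \<in> smooth_funs A \<Longrightarrow> v (\<lambda>y. f y * h y) = v f * h x + f x * v h"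
    and "\<And>f. f \<notin> smooth_funs A \<Longrightarrow> v f = 0"
  shows "v \<in> tangent_space A x"
  using assms unfolding tangent_space_def lin_on_def
  by (auto simp: plus_fun_def times_fun_def scaleR_fun_def)

lemma tangent_const: "v \<in> tangent_space A x \<Longrightarrow> v (\<lambda>y. c) = 0"
proof -
  assume v: "v \<in> tangent_space A x"
  have "v (\<lambda>y. 1 * 1) = v (\<lambda>y. 1) * 1 + 1 * v (\<lambda>y. 1)"
    by (rule tangentD(3)[OF v smooth_funs_const smooth_funs_const])
  then have "v (\<lambda>y. 1) = 0" by simp
  then show "v (\<lambda>y. c) = 0" using tangentD(2)[OF v smooth_funs_const, of c 1] by simp
qed

lemma tangent_diff:
  assumes "v \<in> tangent_space A x" "f \<in> smooth_funs A" "h \<in> smooth_funs A"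
  shows "v (\<lambda>y. f y - h y) = v f - v h"
  using tangentD(1)[OF assms(1,2) smooth_funs_minus[OF assms(3)]] tangentD(2)[OF assms(1,3), of "-1"]
  by simp

lemma tangent_sum:
  assumes "v \<in> tangent_space A x" "\<And>i. i \<in> I \<Longrightarrow> f i \<in> smooth_funs A"
  shows "v (\<lambda>y. \<Sum>i\<in>I. f i y) = (\<Sum>i\<in>I. v (f i))"
proof (cases "finite I")
  case True
  then show ?thesis using assms(2)
    by (induction I rule: finite_induct)
      (simp_all add: tangent_const[OF assms(1)] tangentD(1)[OF assms(1)] smooth_funs_sum)
qed (simp add: tangent_const[OF assms(1)])

text \<open>The product rule kills a product of \<open>f - h\<close> with a bump function supported where \<open>f = h\<close>.\<close>

lemma tangent_local:
  assumes v: "v \<in> tangent_space A x" and fh: "f \<in> smooth_funs A" "h \<in> smooth_funs A"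
    and N: "open N" "x \<in> N" "\<And>y. y \<in> N \<Longrightarrow> f y = h y"
  shows "v f = v h"
proof -
  obtain N' \<eta> where \<eta>: "open N'" "x \<in> N'" "\<eta> \<in> smooth_funs A" "\<And>x. x \<in> N' \<Longrightarrow> \<eta> x = 1" "\<And>x. x \<notin> N \<Longrightarrow> \<eta> x = 0"
    using bump_on_manifold[OF N(1,2)] by metis
  have "(\<lambda>y. (f y - h y) * \<eta> y) = (\<lambda>y. 0)" using N(3) \<eta>(5) by fastforce
  then have "v (\<lambda>y. f y - h y) * \<eta> x + (f x - h x) * v \<eta> = 0"
    using tangentD(3)[OF v smooth_funs_diff[OF fh] \<eta>(3)] tangent_const[OF v] by metis
  then show ?thesis using \<eta> N tangent_diff[OF v fh] by simp
qed

lemma tangent_eqI: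
  assumes "u \<in> tangent_space A x" "v \<in> tangent_space A x" "\<And>h. h \<in> smooth_funs A \<Longrightarrow> u h = v h"
  shows "u = v"
proof
  fix h show "u h = v h" using assms(3) tangentD(4)[OF assms(1)] tangentD(4)[OF assms(2)] by (cases "h \<in> smooth_funs A") auto
qed

lemma subspace_tangent: "subspace (tangent_space A x)"
proof (rule subspaceI)
  show "0 \<in> tangent_space A x" by (rule tangentI) auto
  show "u + v \<in> tangent_space A x" if "u \<in> tangent_space A x" "v \<in> tangent_space A x" for u v
    by (rule tangentI) (auto simp: tangentD[OF that(1)] tangentD[OF that(2)] algebra_simps)
  show "c *\<^sub>R u \<in> tangent_space A x" if "u \<in> tangent_space A x" for c u
    by (rule tangentI) (auto simp: tangentD[OF that] algebra_simps scaleR_fun_def)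
qed

lemmas tangent_closed = subspace_0[OF subspace_tangent] subspace_add[OF subspace_tangent]
  subspace_scale[OF subspace_tangent] subspace_diff[OF subspace_tangent]
  subspace_neg[OF subspace_tangent] subspace_sum[OF subspace_tangent]

lemma sum_tvec_apply: "(\<Sum>b\<in>I. u b) h = (\<Sum>b\<in>I. u b h)" for u :: "'i \<Rightarrow> 'm tvec"
  by (induction I rule: infinite_finite_induct) auto

definition coord_vec :: "'m set \<Rightarrow> ('m \<Rightarrow> 'e) \<Rightarrow> 'm \<Rightarrow> 'e \<Rightarrow> 'm tvec" where
  "coord_vec U \<phi> x b h =
    (if h \<in> smooth_funs A then frechet_derivative (h \<circ> inv_into U \<phi>) (at (\<phi> x)) b else 0)"

lemma coord_has_derivative:
  assumes "(U, \<phi>) \<in> A" "x \<in> U" "h \<in> smooth_funs A"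
  shows "((h \<circ> inv_into U \<phi>) has_derivative frechet_derivative (h \<circ> inv_into U \<phi>) (at (\<phi> x))) (at (\<phi> x))"
  using smooth_on_has_derivative[OF smooth_funsD[OF assms(3,1)]] assms(2) by blast

lemma coord_vec_eqI:
  assumes "(U, \<phi>) \<in> A" "x \<in> U" "h \<in> smooth_funs A"
    "((h \<circ> inv_into U \<phi>) has_derivative D) (at (\<phi> x))"
  shows "coord_vec U \<phi> x b h = D b"
  using assms frechet_derivative_at by (auto simp: coord_vec_def)

lemma coord_vec_tangent:
  assumes U: "(U, \<phi>) \<in> A" "x \<in> U"
  shows "coord_vec U \<phi> x b \<in> tangent_space A x"
proof (rule tangentI)
  note d = coord_has_derivative[OF U]
  fix f h assume f: "f \<in> smooth_funs A" and h: "h \<in> smooth_funs A"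
  have "coord_vec U \<phi> x b (\<lambda>y. f y + h y) = frechet_derivative (f \<circ> inv_into U \<phi>) (at (\<phi> x)) b
      + frechet_derivative (h \<circ> inv_into U \<phi>) (at (\<phi> x)) b"
    by (rule coord_vec_eqI[OF U smooth_funs_add[OF f h]])
      (use has_derivative_add[OF d[OF f] d[OF h]] in \<open>simp add: o_def\<close>)
  then show "coord_vec U \<phi> x b (\<lambda>y. f y + h y) = coord_vec U \<phi> x b f + coord_vec U \<phi> x b h"
    by (simp add: coord_vec_def f h)
  have "coord_vec U \<phi> x b (\<lambda>y. f y * h y) =
      (f \<circ> inv_into U \<phi>) (\<phi> x) * frechet_derivative (h \<circ> inv_into U \<phi>) (at (\<phi> x)) b
      + frechet_derivative (f \<circ> inv_into U \<phi>) (at (\<phi> x)) b * (h \<circ> inv_into U \<phi>) (\<phi> x)"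
    by (rule coord_vec_eqI[OF U smooth_funs_mult[OF f h]])
      (use has_derivative_mult[OF d[OF f] d[OF h]] in \<open>simp add: o_def\<close>)
  then show "coord_vec U \<phi> x b (\<lambda>y. f y * h y) = coord_vec U \<phi> x b f * h x + f x * coord_vec U \<phi> x b h"
    using U by (simp add: coord_vec_def f h)
next
  fix c f assume f: "f \<in> smooth_funs A"
  have "coord_vec U \<phi> x b (\<lambda>y. c * f y) = c * frechet_derivative (f \<circ> inv_into U \<phi>) (at (\<phi> x)) b"
    by (rule coord_vec_eqI[OF U smooth_funs_mult[OF smooth_funs_const f]])
      (use has_derivative_mult_right[OF coord_has_derivative[OF U f], of c] in \<open>simp add: o_def\<close>)
  then show "coord_vec U \<phi> x b (\<lambda>y. c * f y) = c * coord_vec U \<phi> x b f"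
    by (simp add: coord_vec_def f)
qed (simp add: coord_vec_def)

lemma coord_vec_smooth:
  assumes U: "(U, \<phi>) \<in> A" and h: "h \<in> smooth_funs A"
  shows "smooth_on (\<phi> ` U) (\<lambda>y. coord_vec U \<phi> (inv_into U \<phi> y) b h)"
  by (rule smooth_on_cong[OF chart_open(2)[OF U] smooth_on_deriv[OF smooth_funsD[OF h U]]])
    (auto simp: coord_vec_def h U)

text \<open>Hadamard's lemma writes a smooth function near a point as a constant plus a sum of products
  of coordinate functions with smooth functions, so that the product rule determines a derivation
  from its values on the coordinates.\<close>

lemma tangent_coordinates:
  assumes U: "(U, \<phi>) \<in> A" "x0 \<in> U"
  obtains N \<xi> where "open N" "x0 \<in> N" "N \<subseteq> U"
    "\<forall>b\<in>Basis. \<xi> b \<in> smooth_funs A"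
    "\<forall>b\<in>Basis. \<forall>y\<in>N. \<xi> b y = \<phi> y \<bullet> b"
    "\<forall>y\<in>N. \<forall>v\<in>tangent_space A y. v = (\<Sum>b\<in>Basis. v (\<xi> b) *\<^sub>R coord_vec U \<phi> y b)"
proof -
  note oU = chart_open(2)[OF U(1)]
  obtain N and \<eta> :: "'e \<Rightarrow> real" where N: "open N" "x0 \<in> N" "N \<subseteq> U" "\<phi> ` N \<subseteq> \<phi> ` U"
    "\<forall>x\<in>N. \<eta> (\<phi> x) = 1"
    "\<forall>h. smooth_on (\<phi> ` U) h \<longrightarrow>
      (\<lambda>x. if x \<in> U \<and> \<phi> x \<in> \<phi> ` U then \<eta> (\<phi> x) * h (\<phi> x) else 0) \<in> smooth_funs A"
    by (rule chart_bump[OF U oU]) (use U in auto)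
  define \<xi> where "\<xi> b x = (if x \<in> U \<and> \<phi> x \<in> \<phi> ` U then \<eta> (\<phi> x) * (\<phi> x \<bullet> b) else 0)" for b x
  have \<xi>: "\<xi> b \<in> smooth_funs A" for b
    unfolding \<xi>_def[abs_def]
    by (rule N(6)[rule_format, OF smooth_on_bounded_linear[OF oU bounded_linear_inner_left]])
  have \<xi>N: "\<xi> b y = \<phi> y \<bullet> b" if "y \<in> N" for b y using that N(3,5) by (auto simp: \<xi>_def)
  have key: "v h = (\<Sum>b\<in>Basis. v (\<xi> b) * coord_vec U \<phi> y b h)"
    if y: "y \<in> N" and v: "v \<in> tangent_space A y" and h: "h \<in> smooth_funs A" for y v h
  proof -
    have yU: "y \<in> U" using y N by auto
    obtain r where r: "r > 0" "ball (\<phi> y) r \<subseteq> \<phi> ` U" using oU yU openE by blast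
    let ?T = "ball (\<phi> y) r"
    have sm: "smooth_on ?T (h \<circ> inv_into U \<phi>)"
      by (rule smooth_on_subset[OF smooth_funsD[OF h U(1)] r(2)])
    obtain k where k: "\<forall>b\<in>Basis. smooth_on ?T (k b)"
      "\<forall>b\<in>Basis. k b (\<phi> y) = frechet_derivative (h \<circ> inv_into U \<phi>) (at (\<phi> y)) b"
      "\<forall>z\<in>?T. (h \<circ> inv_into U \<phi>) z = (h \<circ> inv_into U \<phi>) (\<phi> y)
          + (\<Sum>b\<in>Basis. ((z - \<phi> y) \<bullet> b) * k b z)"
      by (rule hadamard[OF sm r(1)])
    obtain N' and \<eta>' :: "'e \<Rightarrow> real" where N': "open N'" "y \<in> N'" "N' \<subseteq> U" "\<phi> ` N' \<subseteq> ?T"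
      "\<forall>x\<in>N'. \<eta>' (\<phi> x) = 1"
      "\<forall>h. smooth_on ?T h \<longrightarrow>
        (\<lambda>x. if x \<in> U \<and> \<phi> x \<in> ?T then \<eta>' (\<phi> x) * h (\<phi> x) else 0) \<in> smooth_funs A"
      by (rule chart_bump[OF U(1) yU, of ?T]) (use r in auto)
    define k' where "k' b x = (if x \<in> U \<and> \<phi> x \<in> ?T then \<eta>' (\<phi> x) * k b (\<phi> x) else 0)" for b x
    have k'sm: "k' b \<in> smooth_funs A" if "b \<in> Basis" for b
      unfolding k'_def[abs_def] by (rule N'(6)[rule_format, OF bspec[OF k(1) that]])
    have k'y: "k' b y = coord_vec U \<phi> y b h" if "b \<in> Basis" for b
      using yU r N' bspec[OF k(2) that] by (simp add: k'_def coord_vec_def h)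
    define h' where "h' z = h y + (\<Sum>b\<in>Basis. (\<xi> b z - \<xi> b y) * k' b z)" for z
    have prod: "(\<lambda>z. (\<xi> b z - \<xi> b y) * k' b z) \<in> smooth_funs A" if "b \<in> Basis" for b
      by (intro smooth_funs_mult smooth_funs_diff \<xi> k'sm smooth_funs_const that)
    have "v h = v h'"
    proof (rule tangent_local[OF v h])
      show "h' \<in> smooth_funs A" unfolding h'_def[abs_def]
        by (intro smooth_funs_add smooth_funs_const smooth_funs_sum prod)
      show "open (N \<inter> N')" "y \<in> N \<inter> N'" using N N' y by auto
      fix z assume z: "z \<in> N \<inter> N'"
      then have zU: "z \<in> U" "\<phi> z \<in> ?T" using N'(3,4) by blast+
      have "h z = h y + (\<Sum>b\<in>Basis. ((\<phi> z - \<phi> y) \<bullet> b) * k b (\<phi> z))"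
        using bspec[OF k(3) zU(2)] by (simp only: o_apply chart_inv[OF U(1)] zU(1) yU)
      also have "\<dots> = h' z" unfolding h'_def
      proof (rule arg_cong2[where f = "(+)", OF refl], rule sum.cong[OF refl])
        fix b :: 'e assume "b \<in> Basis"
        have "k' b z = k b (\<phi> z)" using zU bspec[OF N'(5), of z] z by (simp only: k'_def) simp
        then show "((\<phi> z - \<phi> y) \<bullet> b) * k b (\<phi> z) = (\<xi> b z - \<xi> b y) * k' b z"
          using \<xi>N[of z b] \<xi>N[OF y, of b] z by (simp add: inner_diff_left)
      qed
      finally show "h z = h' z" .
    qed
    also have "\<dots> = (\<Sum>b\<in>Basis. v (\<lambda>z. (\<xi> b z - \<xi> b y) * k' b z))"
    proof -
      have "v h' = v (\<lambda>z. h y) + v (\<lambda>z. \<Sum>b\<in>Basis. (\<xi> b z - \<xi> b y) * k' b z)"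
        unfolding h'_def[abs_def]
        by (rule tangentD(1)[OF v smooth_funs_const smooth_funs_sum]) (rule prod)
      also have "v (\<lambda>z. \<Sum>b\<in>Basis. (\<xi> b z - \<xi> b y) * k' b z) = (\<Sum>b\<in>Basis. v (\<lambda>z. (\<xi> b z - \<xi> b y) * k' b z))"
        by (rule tangent_sum[OF v]) (rule prod)
      finally show ?thesis by (simp only: tangent_const[OF v] add_0_left)
    qed
    also have "\<dots> = (\<Sum>b\<in>Basis. v (\<xi> b) * coord_vec U \<phi> y b h)"
    proof (rule sum.cong[OF refl])
      fix b :: 'e assume b: "b \<in> Basis"
      have "v (\<lambda>z. (\<xi> b z - \<xi> b y) * k' b z) = v (\<lambda>z. \<xi> b z - \<xi> b y) * k' b y"
        using tangentD(3)[OF v smooth_funs_diff[OF \<xi> smooth_funs_const] k'sm[OF b]] by simp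
      then show "v (\<lambda>z. (\<xi> b z - \<xi> b y) * k' b z) = v (\<xi> b) * coord_vec U \<phi> y b h"
        using tangent_diff[OF v \<xi> smooth_funs_const] tangent_const[OF v] k'y[OF b] by simp
    qed
    finally show ?thesis .
  qed
  have rep: "v = (\<Sum>b\<in>Basis. v (\<xi> b) *\<^sub>R coord_vec U \<phi> y b)"
    if y: "y \<in> N" and v: "v \<in> tangent_space A y" for y v
  proof -
    show "v = (\<Sum>b\<in>Basis. v (\<xi> b) *\<^sub>R coord_vec U \<phi> y b)"
    proof (rule tangent_eqI[OF v])
      show "(\<Sum>b\<in>Basis. v (\<xi> b) *\<^sub>R coord_vec U \<phi> y b) \<in> tangent_space A y"
        using y N U by (intro tangent_closed coord_vec_tangent) auto
      show "v h = (\<Sum>b\<in>Basis. v (\<xi> b) *\<^sub>R coord_vec U \<phi> y b) h" if "h \<in> smooth_funs A" for h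
        unfolding sum_tvec_apply scaleR_fun_def real_scaleR_def by (rule key[OF y v that])
    qed
  qed
  show thesis
    by (rule that[of N \<xi>]) (use N(1-3) \<xi> \<xi>N rep in \<open>simp_all\<close>)
qed

text \<open>The localised coordinate functions \<open>\<xi> b\<close> are dual to the coordinate vectors.\<close>

lemma dim_tangent_space: "dim (tangent_space A x) = DIM('e)"
proof -
  obtain U \<phi> where U: "(U, \<phi>) \<in> A" "x \<in> U" by (rule chart_at)
  obtain N \<xi> where N: "open N" "x \<in> N" "N \<subseteq> U"
    "\<forall>b\<in>Basis. \<xi> b \<in> smooth_funs A"
    "\<forall>b\<in>Basis. \<forall>y\<in>N. \<xi> b y = \<phi> y \<bullet> b"
    "\<forall>y\<in>N. \<forall>v\<in>tangent_space A y. v = (\<Sum>b\<in>Basis. v (\<xi> b) *\<^sub>R coord_vec U \<phi> y b)"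
    by (rule tangent_coordinates[OF U])
  let ?e = "coord_vec U \<phi> x"
  have dual: "?e b (\<xi> b') = (if b = b' then 1 else 0)" if b: "b \<in> Basis" "b' \<in> Basis" for b b'
  proof -
    have "((\<lambda>z. z \<bullet> b') has_derivative (\<lambda>z. z \<bullet> b')) (at (\<phi> x))"
      by (rule bounded_linear_imp_has_derivative[OF bounded_linear_inner_left])
    then have "((\<xi> b' \<circ> inv_into U \<phi>) has_derivative (\<lambda>z. z \<bullet> b')) (at (\<phi> x))"
      by (rule has_derivative_transform_within_open[OF _ open_chart_preimage[OF U(1) N(1)]])
        (use N U b in \<open>auto simp: f_inv_into_f\<close>)
    from coord_vec_eqI[OF U bspec[OF N(4) b(2)] this] show ?thesis using b by (simp add: inner_Basis)
  qed
  have "span (?e ` Basis) = tangent_space A x"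
  proof
    show "span (?e ` Basis) \<subseteq> tangent_space A x"
      using coord_vec_tangent[OF U] by (intro span_minimal subspace_tangent) auto
    show "tangent_space A x \<subseteq> span (?e ` Basis)"
    proof
      fix v assume "v \<in> tangent_space A x"
      then have "v = (\<Sum>b\<in>Basis. v (\<xi> b) *\<^sub>R ?e b)" by (rule bspec[OF bspec[OF N(6) N(2)]])
      moreover have "(\<Sum>b\<in>Basis. v (\<xi> b) *\<^sub>R ?e b) \<in> span (?e ` Basis)"
        by (intro span_sum span_scale span_base) auto
      ultimately show "v \<in> span (?e ` Basis)" by simp
    qed
  qed
  moreover have "inj_on ?e Basis"
  proof (rule inj_onI)
    fix b b' :: 'e assume "b \<in> Basis" "b' \<in> Basis" "?e b = ?e b'"
    then show "b = b'" using dual[of b b'] dual[of b' b'] by (auto split: if_splits)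
  qed
  moreover have "independent (?e ` Basis)"
    unfolding dependent_def
  proof clarify
    fix b :: 'e assume b: "b \<in> Basis" "?e b \<in> span (?e ` Basis - {?e b})"
    have "subspace {v :: 'm tvec. v (\<xi> b) = 0}" by (auto simp: subspace_def scaleR_fun_def)
    moreover have "?e ` Basis - {?e b} \<subseteq> {v. v (\<xi> b) = 0}" using dual b(1) by auto
    ultimately have "span (?e ` Basis - {?e b}) \<subseteq> {v. v (\<xi> b) = 0}" by (rule span_minimal[rotated])
    then have "?e b (\<xi> b) = 0" using b(2) by (rule subsetD[THEN CollectD])
    then show False using dual[OF b(1) b(1)] by simp
  qed
  ultimately show ?thesis
    using dim_span_eq_card_independent[of "?e ` Basis"] card_image[of ?e Basis] by simp
qed

section \<open>Vector fields\<close>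

lemma vfD: "X \<in> vector_fields A \<Longrightarrow> X x \<in> tangent_space A x"
  "X \<in> vector_fields A \<Longrightarrow> f \<in> smooth_funs A \<Longrightarrow> (\<lambda>x. X x f) \<in> smooth_funs A"
  by (auto simp: vector_fields_def)

lemma vf_add: "X \<in> vector_fields A \<Longrightarrow> Y \<in> vector_fields A \<Longrightarrow> (\<lambda>x. X x + Y x) \<in> vector_fields A"
  unfolding vector_fields_def using smooth_funs_add by (auto intro: tangent_closed)

lemma vf_scale: "X \<in> vector_fields A \<Longrightarrow> h \<in> smooth_funs A \<Longrightarrow> (\<lambda>x. h x *\<^sub>R X x) \<in> vector_fields A"
proof -
  assume X: "X \<in> vector_fields A" and h: "h \<in> smooth_funs A"
  have "(\<lambda>x. (h x *\<^sub>R X x) f) \<in> smooth_funs A" if "f \<in> smooth_funs A" for f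
    unfolding scaleR_fun_def real_scaleR_def by (rule smooth_funs_mult[OF h vfD(2)[OF X that]])
  then show ?thesis by (simp add: vector_fields_def tangent_closed vfD(1)[OF X])
qed

lemma vf_cscale: "X \<in> vector_fields A \<Longrightarrow> (\<lambda>x. c *\<^sub>R X x) \<in> vector_fields A"
  by (rule vf_scale[OF _ smooth_funs_const])

lemma vf_diff: "X \<in> vector_fields A \<Longrightarrow> Y \<in> vector_fields A \<Longrightarrow> (\<lambda>x. X x - Y x) \<in> vector_fields A"
  using vf_add[OF _ vf_cscale[of Y "-1"]] by simp

lemma vf_zero: "(\<lambda>x. 0) \<in> vector_fields A"
  by (auto simp: vector_fields_def tangent_closed smooth_funs_const)

lemma vf_sum: "(\<And>i. i \<in> I \<Longrightarrow> X i \<in> vector_fields A) \<Longrightarrow> (\<lambda>x. \<Sum>i\<in>I. X i x) \<in> vector_fields A"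
  by (induction I rule: infinite_finite_induct) (auto simp: vf_zero vf_add)

lemma lie_bracket_vf:
  assumes X: "X \<in> vector_fields A" and Y: "Y \<in> vector_fields A"
  shows "lie_bracket X Y \<in> vector_fields A"
proof -
  have "lie_bracket X Y x \<in> tangent_space A x" for x
  proof (rule tangentI)
    fix f h assume f: "f \<in> smooth_funs A" and h: "h \<in> smooth_funs A"
    note s = vfD(2)[OF X f] vfD(2)[OF Y f] vfD(2)[OF X h] vfD(2)[OF Y h] f h
    show "lie_bracket X Y x (\<lambda>y. f y + h y) = lie_bracket X Y x f + lie_bracket X Y x h"
      by (simp add: lie_bracket_def tangentD(1)[OF vfD(1)[OF X]] tangentD(1)[OF vfD(1)[OF Y]] s)
    show "lie_bracket X Y x (\<lambda>y. f y * h y) = lie_bracket X Y x f * h x + f x * lie_bracket X Y x h"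
      by (simp add: lie_bracket_def tangentD(1,3)[OF vfD(1)[OF X]] tangentD(1,3)[OF vfD(1)[OF Y]]
          s smooth_funs_mult algebra_simps)
  next
    fix c f assume f: "f \<in> smooth_funs A"
    show "lie_bracket X Y x (\<lambda>y. c * f y) = c * lie_bracket X Y x f"
    proof -
      have "(\<lambda>y. Z y (\<lambda>y. c * f y)) = (\<lambda>y. c * Z y f)" if "Z \<in> vector_fields A" for Z
        by (rule ext) (rule tangentD(2)[OF vfD(1)[OF that] f])
      note Z = this[OF X] this[OF Y]
      show ?thesis
        unfolding lie_bracket_def Z tangentD(2)[OF vfD(1)[OF X] vfD(2)[OF Y f]]
          tangentD(2)[OF vfD(1)[OF Y] vfD(2)[OF X f]]
        by (rule right_diff_distrib[symmetric])
    qed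
  next
    fix f assume "f \<notin> smooth_funs A"
    then show "lie_bracket X Y x f = 0"
      by (simp add: lie_bracket_def tangentD(4)[OF vfD(1)[OF X]] tangentD(4)[OF vfD(1)[OF Y]]
          tangent_const[OF vfD(1)[OF X]] tangent_const[OF vfD(1)[OF Y]])
  qed
  moreover have "(\<lambda>x. lie_bracket X Y x f) \<in> smooth_funs A" if f: "f \<in> smooth_funs A" for f
    unfolding lie_bracket_def
    by (rule smooth_funs_diff[OF vfD(2)[OF X vfD(2)[OF Y f]] vfD(2)[OF Y vfD(2)[OF X f]]])
  ultimately show ?thesis by (simp add: vector_fields_def)
qed

lemma coord_field_exists:
  assumes U: "(U, \<phi>) \<in> A" "x0 \<in> U"
  obtains N E where "open N" "x0 \<in> N" "N \<subseteq> U" "\<forall>b. E b \<in> vector_fields A"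
    "\<forall>x\<in>N. \<forall>b. E b x = coord_vec U \<phi> x b"
proof -
  note oU = chart_open(2)[OF U(1)]
  obtain N and \<eta> :: "'e \<Rightarrow> real" where N: "open N" "x0 \<in> N" "N \<subseteq> U" "\<phi> ` N \<subseteq> \<phi> ` U"
    "\<forall>x\<in>N. \<eta> (\<phi> x) = 1"
    "\<forall>h. smooth_on (\<phi> ` U) h \<longrightarrow>
      (\<lambda>x. if x \<in> U \<and> \<phi> x \<in> \<phi> ` U then \<eta> (\<phi> x) * h (\<phi> x) else 0) \<in> smooth_funs A"
    by (rule chart_bump[OF U oU]) (use U in auto)
  define E where "E b x = (if x \<in> U then \<eta> (\<phi> x) *\<^sub>R coord_vec U \<phi> x b else 0)" for b x
  show thesis
  proof
    show "\<forall>b. E b \<in> vector_fields A"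
      unfolding vector_fields_def
    proof (intro CollectI conjI allI ballI)
      fix b
      show "E b x \<in> tangent_space A x" for x
        using U by (auto simp: E_def intro!: tangent_closed coord_vec_tangent)
      fix f assume f: "f \<in> smooth_funs A"
      have "(\<lambda>x. if x \<in> U \<and> \<phi> x \<in> \<phi> ` U then \<eta> (\<phi> x) * coord_vec U \<phi> (inv_into U \<phi> (\<phi> x)) b f else 0) \<in> smooth_funs A"
        by (rule N(6)[rule_format, OF coord_vec_smooth[OF U(1) f]])
      also have "(\<lambda>x. if x \<in> U \<and> \<phi> x \<in> \<phi> ` U then \<eta> (\<phi> x) * coord_vec U \<phi> (inv_into U \<phi> (\<phi> x)) b f else 0) = (\<lambda>x. E b x f)"
        using U(1) by (auto simp: E_def fun_eq_iff scaleR_fun_def)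
      finally show "(\<lambda>x. E b x f) \<in> smooth_funs A" .
    qed
  qed (use N in \<open>auto simp: E_def\<close>)
qed

section \<open>Derivatives at a maximum\<close>

lemma tangent_at_max:
  assumes f: "f \<in> smooth_funs A" and max: "\<And>y. f y \<le> f x" and v: "v \<in> tangent_space A x"
  shows "v f = 0"
proof -
  obtain U \<phi> where U: "(U, \<phi>) \<in> A" "x \<in> U" by (rule chart_at)
  obtain N \<xi> where N: "open N" "x \<in> N" "N \<subseteq> U"
    "\<forall>b\<in>Basis. \<xi> b \<in> smooth_funs A"
    "\<forall>b\<in>Basis. \<forall>y\<in>N. \<xi> b y = \<phi> y \<bullet> b"
    "\<forall>y\<in>N. \<forall>v\<in>tangent_space A y. v = (\<Sum>b\<in>Basis. v (\<xi> b) *\<^sub>R coord_vec U \<phi> y b)"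
    by (rule tangent_coordinates[OF U])
  have "frechet_derivative (f \<circ> inv_into U \<phi>) (at (\<phi> x)) = (\<lambda>v. 0)"
    by (rule differential_zero_maxmin[OF _ chart_open(2)[OF U(1)] coord_has_derivative[OF U f]])
      (use U max in auto)
  then have "coord_vec U \<phi> x b f = 0" for b by (simp add: coord_vec_def)
  moreover have "v f = (\<Sum>b\<in>Basis. v (\<xi> b) *\<^sub>R coord_vec U \<phi> x b) f" using bspec[OF bspec[OF N(6) N(2)] v] by simp
  ultimately show ?thesis by (simp add: sum_tvec_apply scaleR_fun_def)
qed

lemma second_derivative_at_max:
  fixes g :: "real \<Rightarrow> real"
  assumes d: "d > 0" and g: "\<And>s. \<bar>s\<bar> < d \<Longrightarrow> (g has_real_derivative g' s) (at s)"
    and g': "(g' has_real_derivative c) (at 0)" and max: "\<And>s. \<bar>s\<bar> < d \<Longrightarrow> g s \<le> g 0"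
  shows "c \<le> 0"
proof (rule ccontr)
  assume "\<not> c \<le> 0"
  then have "c > 0" by simp
  have "g' 0 = 0" by (rule DERIV_local_max[OF g d]) (use d max in auto)
  then obtain e where e: "e > 0" "\<And>h. 0 < h \<Longrightarrow> h < e \<Longrightarrow> 0 < g' h"
    using DERIV_pos_inc_right[OF g' \<open>c > 0\<close>] by auto
  define s where "s = min d e / 2"
  have s: "0 < s" "s < d" "s < e" using d e by (auto simp: s_def)
  have "\<exists>z>0. z < s \<and> g s - g 0 = (s - 0) * g' z" by (rule MVT2[OF s(1)]) (use g s in auto)
  then obtain z where z: "0 < z" "z < s" "g s - g 0 = s * g' z" by auto
  have "0 < s * g' z" by (rule mult_pos_pos[OF s(1) e(2)]) (use z s in auto)
  then show False using z max[of s] s by simp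
qed

text \<open>At a maximum the second derivative of \<open>f\<close> along \<open>X\<close> depends only on the value of \<open>X\<close> there,
  because Lie brackets annihilate \<open>f\<close>. So \<open>X\<close> may be replaced by a field that is constant in
  coordinates, which reduces the claim to the second derivative test on a line.\<close>

lemma second_order_at_max:
  assumes f: "f \<in> smooth_funs A" and max: "\<And>y. f y \<le> f x" and X: "X \<in> vector_fields A"
  shows "X x (\<lambda>y. X y f) \<le> 0"
proof -
  obtain U \<phi> where U: "(U, \<phi>) \<in> A" "x \<in> U" by (rule chart_at)
  obtain N \<xi> where N: "open N" "x \<in> N" "N \<subseteq> U"
    "\<forall>b\<in>Basis. \<xi> b \<in> smooth_funs A"
    "\<forall>b\<in>Basis. \<forall>y\<in>N. \<xi> b y = \<phi> y \<bullet> b"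
    "\<forall>y\<in>N. \<forall>v\<in>tangent_space A y. v = (\<Sum>b\<in>Basis. v (\<xi> b) *\<^sub>R coord_vec U \<phi> y b)"
    by (rule tangent_coordinates[OF U])
  obtain N' E where N': "open N'" "x \<in> N'" "N' \<subseteq> U" "\<forall>b. E b \<in> vector_fields A"
    "\<forall>y\<in>N'. \<forall>b. E b y = coord_vec U \<phi> y b"
    by (rule coord_field_exists[OF U])
  define c where "c = (\<Sum>b\<in>Basis. X x (\<xi> b) *\<^sub>R b)"
  define Y where "Y = E c"
  have Y: "Y \<in> vector_fields A" by (simp add: Y_def N')
  have Yh: "Y y h = frechet_derivative (h \<circ> inv_into U \<phi>) (at (\<phi> y)) c"
    if "y \<in> N'" "h \<in> smooth_funs A" for y h
    using that N' by (simp add: Y_def coord_vec_def)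
  have "X x = Y x"
  proof (rule tangent_eqI[OF vfD(1)[OF X] vfD(1)[OF Y]])
    fix h assume h: "h \<in> smooth_funs A"
    interpret linear "frechet_derivative (h \<circ> inv_into U \<phi>) (at (\<phi> x))"
      by (rule has_derivative_linear[OF coord_has_derivative[OF U h]])
    have "X x h = (\<Sum>b\<in>Basis. X x (\<xi> b) *\<^sub>R coord_vec U \<phi> x b) h"
      using bspec[OF bspec[OF N(6) N(2)] vfD(1)[OF X]] by simp
    also have "\<dots> = (\<Sum>b\<in>Basis. X x (\<xi> b) * frechet_derivative (h \<circ> inv_into U \<phi>) (at (\<phi> x)) b)"
      by (simp add: sum_tvec_apply scaleR_fun_def coord_vec_def h)
    also have "\<dots> = Y x h" unfolding Yh[OF N'(2) h] c_def by (simp add: sum scale)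
    finally show "X x h = Y x h" .
  qed
  define W where "W = (\<lambda>y. X y - Y y)"
  have W: "W \<in> vector_fields A" unfolding W_def by (rule vf_diff[OF X Y])
  have W0: "W x = 0" by (simp add: W_def \<open>X x = Y x\<close>)
  have Wf: "(\<lambda>y. W y f) \<in> smooth_funs A" "(\<lambda>y. Y y f) \<in> smooth_funs A"
    using f W Y by (auto intro: vfD)
  have "lie_bracket X W x f = 0"
    by (rule tangent_at_max[OF f max vfD(1)[OF lie_bracket_vf[OF X W]]])
  then have "X x (\<lambda>y. W y f) = 0" by (simp add: lie_bracket_def W0)
  moreover have "X x (\<lambda>y. X y f) = X x (\<lambda>y. Y y f) + X x (\<lambda>y. W y f)"
    using tangentD(1)[OF vfD(1)[OF X, of x] Wf(2,1)] by (simp add: W_def)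
  ultimately have XY: "X x (\<lambda>y. X y f) = Y x (\<lambda>y. Y y f)" by (simp add: \<open>X x = Y x\<close>)
  let ?F = "f \<circ> inv_into U \<phi>" and ?D = "\<lambda>z. frechet_derivative (f \<circ> inv_into U \<phi>) (at z) c"
  let ?T = "\<phi> ` U \<inter> inv_into U \<phi> -` N'"
  have T: "open ?T" by (rule open_chart_preimage[OF U(1) N'(1)])
  have xT: "\<phi> x \<in> ?T" using U N' by simp
  have smF: "smooth_on ?T ?F" by (rule smooth_on_subset[OF smooth_funsD[OF f U(1)]]) auto
  have "Y x (\<lambda>y. Y y f) = frechet_derivative ?D (at (\<phi> x)) c"
    unfolding Yh[OF N'(2) vfD(2)[OF Y f]]
    by (rule fun_cong[where x = c], rule frechet_derivative_cong_open[OF T xT])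
      (use N' U in \<open>auto simp: Yh[OF _ f] f_inv_into_f o_def\<close>)
  also have "\<dots> \<le> 0"
  proof -
    obtain r where r: "r > 0" "ball (\<phi> x) r \<subseteq> ?T" using T xT openE by blast
    define d where "d = r / (norm c + 1)"
    have d: "d > 0" using r(1) norm_ge_zero[of c] by (auto simp: d_def intro!: divide_pos_pos add_nonneg_pos)
    have inT: "\<phi> x + s *\<^sub>R c \<in> ?T" if "\<bar>s\<bar> < d" for s
    proof (rule subsetD[OF r(2)])
      have "\<bar>s\<bar> * norm c \<le> \<bar>s\<bar> * (norm c + 1)" by (intro mult_left_mono) auto
      also have "\<dots> < d * (norm c + 1)" using that norm_ge_zero[of c]
        by (intro mult_strict_right_mono) linarith+
      also have "\<dots> = r" using norm_ge_zero[of c] by (simp add: d_def add_nonneg_eq_0_iff)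
      finally show "\<phi> x + s *\<^sub>R c \<in> ball (\<phi> x) r" by (simp add: dist_norm)
    qed
    show ?thesis
    proof (rule second_derivative_at_max[OF d])
      show "((\<lambda>s. ?F (\<phi> x + s *\<^sub>R c)) has_real_derivative ?D (\<phi> x + s *\<^sub>R c)) (at s)" if "\<bar>s\<bar> < d" for s
        by (rule has_real_derivative_along_line[OF smF inT[OF that]])
      show "((\<lambda>s. ?D (\<phi> x + s *\<^sub>R c)) has_real_derivative frechet_derivative ?D (at (\<phi> x)) c) (at 0)"
        using has_real_derivative_along_line[OF smooth_on_deriv[OF smF, of c] inT[of 0]] d by simp
      show "?F (\<phi> x + s *\<^sub>R c) \<le> ?F (\<phi> x + 0 *\<^sub>R c)" for s using U max by simp
    qed
  qed
  finally show ?thesis using XY by simp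
qed

end


section \<open>Smooth functions of positive time and position\<close>

text \<open>Only positive times are considered, so that the coordinate domains are open and all derivatives are
  two-sided.\<close>

definition spacetime_smooth ::
  "('m, 'e::euclidean_space) atlas \<Rightarrow> (real \<Rightarrow> 'm \<Rightarrow> real) \<Rightarrow> bool" where
  "spacetime_smooth A r \<longleftrightarrow>
     (\<forall>(U, \<phi>)\<in>A. smooth_on ({0<..} \<times> \<phi> ` U) (\<lambda>p. r (fst p) (inv_into U \<phi> (snd p))))"

definition time_deriv :: "(real \<Rightarrow> 'm \<Rightarrow> real) \<Rightarrow> real \<Rightarrow> 'm \<Rightarrow> real" where
  "time_deriv r t x = deriv (\<lambda>s. r s x) t"

lemma smooth_on_affine:
  assumes "open S" "bounded_linear L" shows "smooth_on S (\<lambda>y. c + L y)"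
  by (rule smooth_on_add[OF assms(1) smooth_on_const[OF assms(1)] smooth_on_bounded_linear[OF assms]])

context smooth_manifold
begin

lemma spacetimeD:
  "spacetime_smooth A r \<Longrightarrow> (U, \<phi>) \<in> A \<Longrightarrow>
    smooth_on ({0<..} \<times> \<phi> ` U) (\<lambda>p. r (fst p) (inv_into U \<phi> (snd p)))"
  by (auto simp: spacetime_smooth_def)

lemma open_time_chart: "(U, \<phi>) \<in> A \<Longrightarrow> open ({0::real<..} \<times> \<phi> ` U)"
  using chart_open by (intro open_Times) auto

lemma spacetime_const_time:
  assumes "h \<in> smooth_funs A" shows "spacetime_smooth A (\<lambda>t. h)"
  unfolding spacetime_smooth_def
proof clarify
  fix U \<phi> assume U: "(U, \<phi>) \<in> A"
  have "smooth_on ({0::real<..} \<times> \<phi> ` U) (\<lambda>p. (h \<circ> inv_into U \<phi>) (snd p))"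
    by (rule smooth_on_compose[OF open_time_chart[OF U] chart_open(2)[OF U] _
          smooth_on_bounded_linear[OF open_time_chart[OF U] bounded_linear_snd] smooth_funsD[OF assms U]]) auto
  then show "smooth_on ({0::real<..} \<times> \<phi> ` U) (\<lambda>p. h (inv_into U \<phi> (snd p)))" by (simp add: o_def)
qed

lemma spacetime_mult: "spacetime_smooth A r \<Longrightarrow> spacetime_smooth A s \<Longrightarrow> spacetime_smooth A (\<lambda>t x. r t x * s t x)"
  unfolding spacetime_smooth_def by (auto intro!: smooth_on_mult open_time_chart)

lemma spacetime_diff: "spacetime_smooth A r \<Longrightarrow> spacetime_smooth A s \<Longrightarrow> spacetime_smooth A (\<lambda>t x. r t x - s t x)"
  unfolding spacetime_smooth_def by (auto intro!: smooth_on_diff open_time_chart)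

lemma spacetime_sum:
  "(\<And>i. i \<in> I \<Longrightarrow> spacetime_smooth A (r i)) \<Longrightarrow> spacetime_smooth A (\<lambda>t x. \<Sum>i\<in>I. r i t x)"
  unfolding spacetime_smooth_def by (auto intro!: smooth_on_sum open_time_chart)

lemma spacetime_ln:
  assumes r: "spacetime_smooth A r" and pos: "\<And>t x. t > 0 \<Longrightarrow> r t x > 0"
  shows "spacetime_smooth A (\<lambda>t x. ln (r t x))"
  unfolding spacetime_smooth_def
proof clarify
  fix U \<phi> assume U: "(U, \<phi>) \<in> A"
  show "smooth_on ({0::real<..} \<times> \<phi> ` U) (\<lambda>p. ln (r (fst p) (inv_into U \<phi> (snd p))))"
    by (rule smooth_on_compose[OF open_time_chart[OF U] _ _ spacetimeD[OF r U] smooth_on_ln])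
      (use pos in auto)
qed

lemma smooth_family_imp_spacetime:
  assumes "smooth_family_from_0 A r" shows "spacetime_smooth A r"
  unfolding spacetime_smooth_def
proof clarify
  fix U \<phi> assume U: "(U, \<phi>) \<in> A"
  show "smooth_on ({0::real<..} \<times> \<phi> ` U) (\<lambda>p. r (fst p) (inv_into U \<phi> (snd p)))"
  proof (rule smooth_on_local)
    fix p assume p: "p \<in> {0::real<..} \<times> \<phi> ` U"
    then have "0 \<le> fst p" "snd p \<in> \<phi> ` U" by auto
    note ex = bspec[OF assms[unfolded smooth_family_from_0_def] U, unfolded split_conv, rule_format, OF this]
    obtain W F where W: "open W" "(fst p, snd p) \<in> W" "smooth_on W F"
      "\<forall>(s, z)\<in>W. 0 \<le> s \<and> z \<in> \<phi> ` U \<longrightarrow> F (s, z) = r s (inv_into U \<phi> z)"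
      using ex by (elim exE conjE)
    let ?T = "W \<inter> ({0<..} \<times> \<phi> ` U)"
    have T: "open ?T" using W(1) open_time_chart[OF U] by (rule open_Int)
    have "smooth_on ?T (\<lambda>p. r (fst p) (inv_into U \<phi> (snd p)))"
      by (rule smooth_on_cong[OF T smooth_on_subset[OF W(3)]]) (use W(4) in fastforce)+
    then show "\<exists>T. open T \<and> p \<in> T \<and> smooth_on T (\<lambda>p. r (fst p) (inv_into U \<phi> (snd p)))"
      using T W(2) p by (intro exI[of _ ?T]) simp
  qed
qed

lemma spacetime_slice:
  assumes "spacetime_smooth A r" "t > 0" shows "r t \<in> smooth_funs A"
  unfolding smooth_funs_def
proof clarify
  fix U \<phi> assume U: "(U, \<phi>) \<in> A"
  have lin: "bounded_linear (\<lambda>y. (0::real, y :: 'e))" by (intro bounded_linear_Pair bounded_linear_zero bounded_linear_ident)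
  have "smooth_on (\<phi> ` U) (\<lambda>y. (t, 0) + (0::real, y))"
    by (rule smooth_on_affine[OF chart_open(2)[OF U] lin])
  from smooth_on_compose[OF chart_open(2)[OF U] open_time_chart[OF U] _ this spacetimeD[OF assms(1) U]]
  show "smooth_on (\<phi> ` U) (r t \<circ> inv_into U \<phi>)" using assms(2) by (simp add: o_def image_subset_iff)
qed

lemma spacetime_time_has_derivative:
  assumes r: "spacetime_smooth A r" and U: "(U, \<phi>) \<in> A" "x \<in> U" and t: "t > 0"
  shows "((\<lambda>s. r s x) has_real_derivative
    frechet_derivative (\<lambda>p. r (fst p) (inv_into U \<phi> (snd p))) (at (t, \<phi> x)) (1, 0)) (at t)"
  using has_real_derivative_along_line[OF spacetimeD[OF r U(1)], of "(0, \<phi> x)" t "(1, 0)"] U t by simp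

lemma time_deriv:
  assumes "spacetime_smooth A r" "t > 0"
  shows "((\<lambda>s. r s x) has_real_derivative time_deriv r t x) (at t)"
proof -
  obtain U \<phi> where U: "(U, \<phi>) \<in> A" "x \<in> U" by (rule chart_at)
  show ?thesis
    using spacetime_time_has_derivative[OF assms(1) U assms(2)] DERIV_imp_deriv unfolding time_deriv_def by metis
qed

lemma time_deriv_coord:
  assumes "spacetime_smooth A r" "(U, \<phi>) \<in> A" "x \<in> U" "t > 0"
  shows "time_deriv r t x =
    frechet_derivative (\<lambda>p. r (fst p) (inv_into U \<phi> (snd p))) (at (t, \<phi> x)) (1, 0)"
  unfolding time_deriv_def by (rule DERIV_imp_deriv[OF spacetime_time_has_derivative[OF assms]])

lemma spacetime_time_deriv:
  assumes r: "spacetime_smooth A r" shows "spacetime_smooth A (time_deriv r)"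
  unfolding spacetime_smooth_def
proof clarify
  fix U \<phi> assume U: "(U, \<phi>) \<in> A"
  show "smooth_on ({0::real<..} \<times> \<phi> ` U) (\<lambda>p. time_deriv r (fst p) (inv_into U \<phi> (snd p)))"
  proof (rule smooth_on_cong[OF open_time_chart[OF U] smooth_on_deriv[OF spacetimeD[OF r U], where v = "(1, 0)"]])
    fix p assume p: "p \<in> {0::real<..} \<times> \<phi> ` U"
    then have "inv_into U \<phi> (snd p) \<in> U" "\<phi> (inv_into U \<phi> (snd p)) = snd p" "fst p > 0"
      by (auto simp: chart_inv_in f_inv_into_f)
    then show "frechet_derivative (\<lambda>p. r (fst p) (inv_into U \<phi> (snd p))) (at p) (1, 0)
        = time_deriv r (fst p) (inv_into U \<phi> (snd p))"
      using time_deriv_coord[OF r U, of "inv_into U \<phi> (snd p)" "fst p"] by simp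
  qed
qed

lemma coord_vec_slice:
  assumes r: "spacetime_smooth A r" and U: "(U, \<phi>) \<in> A" "x \<in> U" and t: "t > 0"
  shows "coord_vec U \<phi> x b (r t) =
    frechet_derivative (\<lambda>p. r (fst p) (inv_into U \<phi> (snd p))) (at (t, \<phi> x)) (0, b)"
proof (rule coord_vec_eqI[OF U spacetime_slice[OF r t]])
  let ?r = "\<lambda>p. r (fst p) (inv_into U \<phi> (snd p))"
  have d: "(?r has_derivative frechet_derivative ?r (at (t, \<phi> x))) (at (t, \<phi> x))"
    by (rule smooth_on_has_derivative[OF spacetimeD[OF r U(1)]]) (use U t in auto)
  have "((\<lambda>y. (t, y)) has_derivative (\<lambda>y. (0, y))) (at (\<phi> x))"
    by (auto intro!: derivative_eq_intros)
  from has_derivative_compose[OF this d]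
  show "((r t \<circ> inv_into U \<phi>) has_derivative (\<lambda>b. frechet_derivative ?r (at (t, \<phi> x)) (0, b))) (at (\<phi> x))"
    by (simp add: o_def)
qed

lemma spacetime_vector_field:
  assumes r: "spacetime_smooth A r" and X: "X \<in> vector_fields A"
  shows "spacetime_smooth A (\<lambda>t x. X x (r t))"
  unfolding spacetime_smooth_def
proof clarify
  fix U \<phi> assume U: "(U, \<phi>) \<in> A"
  let ?r = "\<lambda>p. r (fst p) (inv_into U \<phi> (snd p))"
  show "smooth_on ({0::real<..} \<times> \<phi> ` U) (\<lambda>p. X (inv_into U \<phi> (snd p)) (r (fst p)))"
  proof (rule smooth_on_local)
    fix p assume p: "p \<in> {0::real<..} \<times> \<phi> ` U"
    define x0 where "x0 = inv_into U \<phi> (snd p)"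
    have x0: "x0 \<in> U" using p by (auto simp: x0_def chart_inv_in)
    obtain N \<xi> where N: "open N" "x0 \<in> N" "N \<subseteq> U"
      "\<forall>b\<in>Basis. \<xi> b \<in> smooth_funs A"
      "\<forall>b\<in>Basis. \<forall>y\<in>N. \<xi> b y = \<phi> y \<bullet> b"
      "\<forall>y\<in>N. \<forall>v\<in>tangent_space A y. v = (\<Sum>b\<in>Basis. v (\<xi> b) *\<^sub>R coord_vec U \<phi> y b)"
      by (rule tangent_coordinates[OF U x0])
    let ?T = "{0::real<..} \<times> (\<phi> ` U \<inter> inv_into U \<phi> -` N)"
    have T: "open ?T" by (intro open_Times open_chart_preimage[OF U N(1)]) simp
    have "smooth_on ?T (\<lambda>p. \<Sum>b\<in>Basis. X (inv_into U \<phi> (snd p)) (\<xi> b) * frechet_derivative ?r (at p) (0, b))"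
    proof (rule smooth_on_sum[OF T])
      fix b :: 'e assume b: "b \<in> Basis"
      have 1: "smooth_on ?T (\<lambda>p. X (inv_into U \<phi> (snd p)) (\<xi> b))"
        by (rule smooth_on_subset[OF spacetimeD[OF spacetime_const_time[OF vfD(2)[OF X bspec[OF N(4) b]]] U]]) auto
      have 2: "smooth_on ?T (\<lambda>p. frechet_derivative ?r (at p) (0, b))"
        by (rule smooth_on_subset[OF smooth_on_deriv[OF spacetimeD[OF r U]]]) auto
      show "smooth_on ?T (\<lambda>p. X (inv_into U \<phi> (snd p)) (\<xi> b) * frechet_derivative ?r (at p) (0, b))"
        by (rule smooth_on_mult[OF T 1 2])
    qed
    then have "smooth_on ?T (\<lambda>p. X (inv_into U \<phi> (snd p)) (r (fst p)))"
    proof (rule smooth_on_cong[OF T])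
      fix p assume p: "p \<in> ?T"
      let ?x = "inv_into U \<phi> (snd p)"
      have x: "?x \<in> U" "?x \<in> N" "\<phi> ?x = snd p" "fst p > 0" using p by (auto simp: chart_inv_in f_inv_into_f)
      have "X ?x (r (fst p)) = (\<Sum>b\<in>Basis. X ?x (\<xi> b) *\<^sub>R coord_vec U \<phi> ?x b) (r (fst p))"
        by (rule fun_cong[OF bspec[OF bspec[OF N(6) x(2)] vfD(1)[OF X]]])
      also have "\<dots> = (\<Sum>b\<in>Basis. X ?x (\<xi> b) * frechet_derivative ?r (at p) (0, b))"
        unfolding sum_tvec_apply scaleR_fun_def real_scaleR_def coord_vec_slice[OF r U x(1,4)] x(3)
        by (simp only: prod.collapse)
      finally show "(\<Sum>b\<in>Basis. X ?x (\<xi> b) * frechet_derivative ?r (at p) (0, b)) = X ?x (r (fst p))"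
        by (rule sym)
    qed
    moreover have "p \<in> ?T" using p N(2) by (auto simp: x0_def)
    ultimately show "\<exists>T. open T \<and> p \<in> T \<and> smooth_on T (\<lambda>p. X (inv_into U \<phi> (snd p)) (r (fst p)))"
      using T by blast
  qed
qed

text \<open>In coordinates this is the symmetry of the mixed second derivatives in time and space.\<close>

lemma tangent_time_commute:
  assumes r: "spacetime_smooth A r" and v: "v \<in> tangent_space A x" and t: "t > 0"
  shows "((\<lambda>s. v (r s)) has_real_derivative v (time_deriv r t)) (at t)"
proof -
  obtain U \<phi> where U: "(U, \<phi>) \<in> A" "x \<in> U" by (rule chart_at)
  obtain N \<xi> where N: "open N" "x \<in> N" "N \<subseteq> U"
    "\<forall>b\<in>Basis. \<xi> b \<in> smooth_funs A"
    "\<forall>b\<in>Basis. \<forall>y\<in>N. \<xi> b y = \<phi> y \<bullet> b"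
    "\<forall>y\<in>N. \<forall>v\<in>tangent_space A y. v = (\<Sum>b\<in>Basis. v (\<xi> b) *\<^sub>R coord_vec U \<phi> y b)"
    by (rule tangent_coordinates[OF U])
  let ?r = "\<lambda>p. r (fst p) (inv_into U \<phi> (snd p))"
  let ?D = "\<lambda>u p. frechet_derivative ?r (at p) u"
  let ?S = "{0::real<..} \<times> \<phi> ` U"
  note sm = spacetimeD[OF r U(1)]
  have rep: "v h = (\<Sum>b\<in>Basis. v (\<xi> b) * coord_vec U \<phi> x b h)" for h
    using fun_cong[OF bspec[OF bspec[OF N(6) N(2)] v], of h]
    unfolding sum_tvec_apply scaleR_fun_def real_scaleR_def .
  have p: "(t, \<phi> x) \<in> ?S" using U t by auto
  have "((\<lambda>s. \<Sum>b\<in>Basis. v (\<xi> b) * ?D (0, b) (s, \<phi> x)) has_real_derivative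
      (\<Sum>b\<in>Basis. v (\<xi> b) * frechet_derivative (?D (0, b)) (at (t, \<phi> x)) (1, 0))) (at t)"
  proof (intro DERIV_sum DERIV_cmult)
    fix b :: 'e
    show "((\<lambda>s. ?D (0, b) (s, \<phi> x)) has_real_derivative
        frechet_derivative (?D (0, b)) (at (t, \<phi> x)) (1, 0)) (at t)"
      using has_real_derivative_along_line[OF smooth_on_deriv[OF sm], of "(0, \<phi> x)" t "(1, 0)"] p by simp
  qed
  moreover have "frechet_derivative (?D (0, b)) (at (t, \<phi> x)) (1, 0) = coord_vec U \<phi> x b (time_deriv r t)" for b
  proof -
    have "frechet_derivative (?D (0, b)) (at (t, \<phi> x)) (1, 0) = frechet_derivative (?D (1, 0)) (at (t, \<phi> x)) (0, b)"
      by (rule second_derivative_symmetric[OF open_time_chart[OF U(1)] sm p])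
    also have "frechet_derivative (?D (1, 0)) (at (t, \<phi> x))
        = frechet_derivative (\<lambda>p. time_deriv r (fst p) (inv_into U \<phi> (snd p))) (at (t, \<phi> x))"
    proof (rule frechet_derivative_cong_open[OF open_time_chart[OF U(1)] p])
      fix q assume q: "q \<in> ?S"
      then have "inv_into U \<phi> (snd q) \<in> U" "\<phi> (inv_into U \<phi> (snd q)) = snd q" "fst q > 0"
        by (auto simp: chart_inv_in f_inv_into_f)
      then show "?D (1, 0) q = time_deriv r (fst q) (inv_into U \<phi> (snd q))"
        using time_deriv_coord[OF r U(1), of "inv_into U \<phi> (snd q)" "fst q"] by simp
    qed
    finally show ?thesis unfolding coord_vec_slice[OF spacetime_time_deriv[OF r] U t] .
  qed
  ultimately have "((\<lambda>s. \<Sum>b\<in>Basis. v (\<xi> b) * ?D (0, b) (s, \<phi> x)) has_real_derivative v (time_deriv r t)) (at t)"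
    unfolding rep[of "time_deriv r t"] by (simp only:)
  then show ?thesis
  proof (rule has_field_derivative_transform_within_open[of _ _ _ "{0<..}"])
    fix s :: real assume "s \<in> {0<..}"
    then have "s > 0" by simp
    then show "(\<Sum>b\<in>Basis. v (\<xi> b) * ?D (0, b) (s, \<phi> x)) = v (r s)"
      unfolding rep[of "r s"] by (simp only: coord_vec_slice[OF r U])
  qed (use t in auto)
qed

lemma spacetime_continuous:
  assumes r: "spacetime_smooth A r" shows "continuous_on ({0<..} \<times> UNIV) (\<lambda>(t, x). r t x)"
proof (rule continuous_at_imp_continuous_on, rule ballI)
  fix p :: "real \<times> 'm" assume p: "p \<in> {0<..} \<times> UNIV"
  obtain U \<phi> where U: "(U, \<phi>) \<in> A" "snd p \<in> U" by (rule chart_at)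
  have o: "open ({0::real<..} \<times> U)" using chart_open(1)[OF U(1)] by (intro open_Times) auto
  have "continuous_on ({0<..} \<times> U) (\<lambda>p. r (fst (fst p, \<phi> (snd p))) (inv_into U \<phi> (snd (fst p, \<phi> (snd p)))))"
    by (rule continuous_on_compose2[OF smooth_on_imp_continuous[OF spacetimeD[OF r U(1)]]])
      (auto intro!: continuous_intros continuous_on_compose2[OF chart_continuous(1)[OF U(1)]])
  then have "continuous_on ({0<..} \<times> U) (\<lambda>(t, x). r t x)"
    by (rule continuous_on_eq) (use U in auto)
  moreover have "p \<in> {0<..} \<times> U" using p U by (cases p) auto
  ultimately show "isCont (\<lambda>(t, x). r t x) p" unfolding continuous_on_eq_continuous_at[OF o] by (rule bspec)
qed

lemma tangent_chain:
  assumes v: "v \<in> tangent_space A x" and h: "h \<in> smooth_funs A" "\<And>y. h y \<in> T"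
    and H: "open T" "smooth_on T H" "(H has_real_derivative d) (at (h x))"
  shows "v (\<lambda>y. H (h y)) = d * v h"
proof -
  obtain U \<phi> where U: "(U, \<phi>) \<in> A" "x \<in> U" by (rule chart_at)
  obtain N \<xi> where N: "open N" "x \<in> N" "N \<subseteq> U"
    "\<forall>b\<in>Basis. \<xi> b \<in> smooth_funs A"
    "\<forall>b\<in>Basis. \<forall>y\<in>N. \<xi> b y = \<phi> y \<bullet> b"
    "\<forall>y\<in>N. \<forall>v\<in>tangent_space A y. v = (\<Sum>b\<in>Basis. v (\<xi> b) *\<^sub>R coord_vec U \<phi> y b)"
    by (rule tangent_coordinates[OF U])
  have rep: "v h = (\<Sum>b\<in>Basis. v (\<xi> b) * coord_vec U \<phi> x b h)" for h
    using fun_cong[OF bspec[OF bspec[OF N(6) N(2)] v], of h]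
    unfolding sum_tvec_apply scaleR_fun_def real_scaleR_def .
  have "coord_vec U \<phi> x b (\<lambda>y. H (h y)) = d * frechet_derivative (h \<circ> inv_into U \<phi>) (at (\<phi> x)) b" for b
  proof (rule coord_vec_eqI[OF U smooth_funs_compose[OF h(1) H(1) h(2) H(2)]])
    have "(H has_derivative (*) d) (at ((h \<circ> inv_into U \<phi>) (\<phi> x)))"
      using H(3) U by (simp add: has_field_derivative_def)
    from has_derivative_compose[OF coord_has_derivative[OF U h(1)] this]
    show "((\<lambda>y. H (h y)) \<circ> inv_into U \<phi> has_derivative
        (\<lambda>b. d * frechet_derivative (h \<circ> inv_into U \<phi>) (at (\<phi> x)) b)) (at (\<phi> x))"
      by (simp add: o_def)
  qed
  then have "coord_vec U \<phi> x b (\<lambda>y. H (h y)) = d * coord_vec U \<phi> x b h" for b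
    by (simp add: coord_vec_def h(1))
  then have "(\<Sum>b\<in>Basis. v (\<xi> b) * coord_vec U \<phi> x b (\<lambda>y. H (h y)))
      = d * (\<Sum>b\<in>Basis. v (\<xi> b) * coord_vec U \<phi> x b h)"
    by (simp add: sum_distrib_left mult_ac)
  then show ?thesis unfolding rep[of h, symmetric] rep[of "\<lambda>y. H (h y)", symmetric] .
qed

end


section \<open>Inner products on tangent spaces and tight frames\<close>

lemma lin_onD:
  "lin_on S L \<Longrightarrow> u \<in> S \<Longrightarrow> v \<in> S \<Longrightarrow> L (u + v) = L u + L v"
  "lin_on S L \<Longrightarrow> u \<in> S \<Longrightarrow> L (c *\<^sub>R u) = c *\<^sub>R L u"
  by (auto simp: lin_on_def)

lemma lin_on_sum:
  assumes L: "lin_on S L" and S: "subspace S" and u: "\<And>i. i \<in> I \<Longrightarrow> u i \<in> S"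
  shows "L (\<Sum>i\<in>I. c i *\<^sub>R u i) = (\<Sum>i\<in>I. c i *\<^sub>R L (u i))"
proof -
  have L0: "L 0 = 0" using lin_onD(2)[OF L subspace_0[OF S], of 0] by simp
  show ?thesis using u
    by (induction I rule: infinite_finite_induct)
      (simp_all add: L0 lin_onD[OF L] subspace_sum[OF S] subspace_scale[OF S])
qed

text \<open>The vectors need not be independent. This redundancy is what allows such frames to exist globally
  on the manifold, while orthonormal frames exist only locally.\<close>

definition tight_frame ::
  "('a::real_vector \<Rightarrow> 'a \<Rightarrow> real) \<Rightarrow> 'a set \<Rightarrow> 'i set \<Rightarrow> ('i \<Rightarrow> 'a) \<Rightarrow> bool" where
  "tight_frame ip S I e \<longleftrightarrow>
     finite I \<and> (\<forall>a\<in>I. e a \<in> S) \<and> (\<forall>u\<in>S. u = (\<Sum>a\<in>I. ip u (e a) *\<^sub>R e a))"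

text \<open>Expand the first slot in the frame \<open>e'\<close> and collect the second slot with \<open>e\<close>.\<close>

lemma tight_frame_trace_unique:
  fixes \<beta> :: "'a::real_vector \<Rightarrow> 'a \<Rightarrow> real"
  assumes S: "subspace S" and e: "tight_frame ip S I e" and e': "tight_frame ip S I' e'"
    and sym: "\<And>u v. u \<in> S \<Longrightarrow> v \<in> S \<Longrightarrow> ip u v = ip v u"
    and lin1: "\<And>v. v \<in> S \<Longrightarrow> lin_on S (\<lambda>u. \<beta> u v)" and lin2: "\<And>u. u \<in> S \<Longrightarrow> lin_on S (\<beta> u)"
  shows "(\<Sum>a\<in>I. \<beta> (e a) (e a)) = (\<Sum>b\<in>I'. \<beta> (e' b) (e' b))"
proof -
  have eS: "e a \<in> S" if "a \<in> I" for a using e that by (auto simp: tight_frame_def)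
  have e'S: "e' b \<in> S" if "b \<in> I'" for b using e' that by (auto simp: tight_frame_def)
  have "(\<Sum>a\<in>I. \<beta> (e a) (e a)) = (\<Sum>a\<in>I. \<Sum>b\<in>I'. ip (e a) (e' b) * \<beta> (e' b) (e a))"
  proof (rule sum.cong[OF refl])
    fix a assume a: "a \<in> I"
    have "\<beta> (e a) (e a) = \<beta> (\<Sum>b\<in>I'. ip (e a) (e' b) *\<^sub>R e' b) (e a)"
      using e' eS[OF a] by (simp add: tight_frame_def)
    also have "\<dots> = (\<Sum>b\<in>I'. ip (e a) (e' b) * \<beta> (e' b) (e a))"
      using lin_on_sum[OF lin1[OF eS[OF a]] S, of I' e'] e'S by simp
    finally show "\<beta> (e a) (e a) = (\<Sum>b\<in>I'. ip (e a) (e' b) * \<beta> (e' b) (e a))" .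
  qed
  also have "\<dots> = (\<Sum>b\<in>I'. \<Sum>a\<in>I. ip (e a) (e' b) * \<beta> (e' b) (e a))" by (rule sum.swap)
  also have "\<dots> = (\<Sum>b\<in>I'. \<beta> (e' b) (e' b))"
  proof (rule sum.cong[OF refl])
    fix b assume b: "b \<in> I'"
    have "\<beta> (e' b) (e' b) = \<beta> (e' b) (\<Sum>a\<in>I. ip (e' b) (e a) *\<^sub>R e a)"
      using e e'S[OF b] by (simp add: tight_frame_def)
    also have "\<dots> = (\<Sum>a\<in>I. ip (e' b) (e a) * \<beta> (e' b) (e a))"
      using lin_on_sum[OF lin2[OF e'S[OF b]] S, of I e] eS by simp
    also have "\<dots> = (\<Sum>a\<in>I. ip (e a) (e' b) * \<beta> (e' b) (e a))"
      using sym eS e'S[OF b] by (intro sum.cong) auto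
    finally show "(\<Sum>a\<in>I. ip (e a) (e' b) * \<beta> (e' b) (e a)) = \<beta> (e' b) (e' b)" by simp
  qed
  finally show ?thesis .
qed

context riemannian_manifold
begin

abbreviation "T x \<equiv> tangent_space A x"

lemma g_lin:
  assumes "v \<in> T x"
  shows "u \<in> T x \<Longrightarrow> u' \<in> T x \<Longrightarrow> g x (u + u') v = g x u v + g x u' v"
    and "u \<in> T x \<Longrightarrow> g x (c *\<^sub>R u) v = c * g x u v"
    and "u \<in> T x \<Longrightarrow> u' \<in> T x \<Longrightarrow> g x (u - u') v = g x u v - g x u' v"
    and "u \<in> T x \<Longrightarrow> g x (- u) v = - g x u v"
    and "g x 0 v = 0"
proof -
  note L = metric_lin[OF assms]
  show a: "g x (u + u') v = g x u v + g x u' v" if "u \<in> T x" "u' \<in> T x" for u u'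
    using lin_onD(1)[OF L] that by blast
  show s: "g x (c *\<^sub>R u) v = c * g x u v" if "u \<in> T x" for c u
    using lin_onD(2)[OF L] that by simp
  show n: "g x (- u) v = - g x u v" if "u \<in> T x" for u using s[OF that, of "-1"] by simp
  show "g x (u - u') v = g x u v - g x u' v" if "u \<in> T x" "u' \<in> T x" for u u'
    using a[OF that(1), of "- u'"] n[OF that(2)] that by (simp add: tangent_closed)
  show "g x 0 v = 0" using s[of 0 0] by (simp add: tangent_closed)
qed

lemma g_lin':
  assumes "v \<in> T x"
  shows "u \<in> T x \<Longrightarrow> u' \<in> T x \<Longrightarrow> g x v (u + u') = g x v u + g x v u'"
    and "u \<in> T x \<Longrightarrow> g x v (c *\<^sub>R u) = c * g x v u"
    and "u \<in> T x \<Longrightarrow> u' \<in> T x \<Longrightarrow> g x v (u - u') = g x v u - g x v u'"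
    and "u \<in> T x \<Longrightarrow> g x v (- u) = - g x v u"
    and "g x v 0 = 0"
  using g_lin[OF assms] metric_sym[OF assms] by (simp_all add: tangent_closed)

lemma lin_on_g: "v \<in> T x \<Longrightarrow> lin_on (T x) (\<lambda>u. g x u v)" "v \<in> T x \<Longrightarrow> lin_on (T x) (g x v)"
  by (auto simp: lin_on_def g_lin g_lin')

lemma g_sum:
  assumes "v \<in> T x" "\<And>i. i \<in> I \<Longrightarrow> u i \<in> T x"
  shows "g x (\<Sum>i\<in>I. c i *\<^sub>R u i) v = (\<Sum>i\<in>I. c i * g x (u i) v)"
    and "g x v (\<Sum>i\<in>I. c i *\<^sub>R u i) = (\<Sum>i\<in>I. c i * g x v (u i))"
  using lin_on_sum[OF lin_on_g(1)[OF assms(1)] subspace_tangent, of I u c]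
    lin_on_sum[OF lin_on_g(2)[OF assms(1)] subspace_tangent, of I u c] assms(2) by simp_all

lemma g_nonneg: "v \<in> T x \<Longrightarrow> g x v v \<ge> 0"
  using metric_pos[of v x] g_lin(5)[of v x] by (cases "v = 0") auto

lemma g_eq_0: "v \<in> T x \<Longrightarrow> g x v v = 0 \<Longrightarrow> v = 0"
  using metric_pos[of v x] by force

lemma g_eqI:
  assumes "u \<in> T x" "v \<in> T x" "\<And>z. z \<in> T x \<Longrightarrow> g x u z = g x v z" shows "u = v"
proof -
  have "g x (u - v) (u - v) = 0"
    using assms by (simp add: g_lin tangent_closed)
  then have "u - v = 0" by (rule g_eq_0[rotated]) (use assms in \<open>simp add: tangent_closed\<close>)
  then show ?thesis by simp
qed

lemma orthonormal_basis_exists: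
  assumes "finite F" "F \<subseteq> T x"
  obtains B where "orthonormal_basis (g x) (span F) B"
proof -
  have "\<exists>B. orthonormal_basis (g x) (span F) B" using assms
  proof (induction F rule: finite_induct)
    case empty
    show ?case by (rule exI[of _ "{}"]) (simp add: orthonormal_basis_def)
  next
    case (insert v F)
    then obtain B where B: "finite B" "span B = span F" "\<forall>u\<in>B. \<forall>v\<in>B. g x u v = (if u = v then 1 else 0)"
      by (auto simp: orthonormal_basis_def)
    have v: "v \<in> T x" and FT: "F \<subseteq> T x" using insert.prems by auto
    have BT: "b \<in> T x" if "b \<in> B" for b
      using span_base[OF that] B(2) span_minimal[OF FT subspace_tangent] by auto
    define w where "w = v - (\<Sum>b\<in>B. g x v b *\<^sub>R b)"
    have sT: "(\<Sum>b\<in>B. g x v b *\<^sub>R b) \<in> T x" by (intro tangent_closed BT)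
    have wT: "w \<in> T x" unfolding w_def by (intro tangent_closed v BT)
    have wB: "g x w b = 0" if b: "b \<in> B" for b
    proof -
      have "(\<Sum>c\<in>B. g x v c * g x c b) = (\<Sum>c\<in>B. if c = b then g x v c else 0)"
        using B(3) b by (intro sum.cong) auto
      moreover have "g x (\<Sum>c\<in>B. g x v c *\<^sub>R c) b = (\<Sum>c\<in>B. g x v c * g x c b)"
        by (rule g_sum(1)[OF BT[OF b] BT])
      ultimately show ?thesis unfolding w_def g_lin(3)[OF BT[OF b] v sT] using b B(1) by simp
    qed
    have sB: "(\<Sum>b\<in>B. g x v b *\<^sub>R b) \<in> span B" by (intro span_sum span_scale span_base)
    have vw: "v = w + (\<Sum>b\<in>B. g x v b *\<^sub>R b)" by (simp add: w_def)
    show ?case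
    proof (cases "w = 0")
      case True
      then have "v \<in> span F" using sB B(2) by (simp add: w_def)
      then have "span (insert v F) = span F" by (rule span_redundant)
      then show ?thesis using B by (auto simp: orthonormal_basis_def)
    next
      case False
      define c where "c = inverse (sqrt (g x w w))"
      define e where "e = c *\<^sub>R w"
      have pos: "g x w w > 0" by (rule metric_pos[OF wT False])
      have c: "c > 0" using pos by (simp add: c_def)
      have eT: "e \<in> T x" by (simp add: e_def tangent_closed wT)
      have ee: "g x e e = 1"
        using pos by (simp add: e_def g_lin g_lin' wT tangent_closed c_def field_simps flip: power2_eq_square)
      have eB: "g x e b = 0" "g x b e = 0" if "b \<in> B" for b
        using wB[OF that] BT[OF that] metric_sym[OF eT BT[OF that]] by (simp_all add: e_def g_lin wT)
      have "e \<notin> B" using eB ee by force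
      moreover have "span (insert e B) = span (insert v F)"
      proof (rule antisym)
        have "e \<in> span (insert v B)" unfolding e_def w_def
          using span_mono[of B "insert v B"] sB by (intro span_scale span_diff) (auto intro: span_base)
        also have "span (insert v B) = span (insert v F)" using B(2) by (simp add: span_insert)
        finally have e: "e \<in> span (insert v F)" .
        have "B \<subseteq> span (insert v F)" using B(2) span_superset[of B] span_mono[of F "insert v F"] by auto
        then show "span (insert e B) \<subseteq> span (insert v F)" using e by (intro span_minimal subspace_span) auto
        have "w = inverse c *\<^sub>R e" using c by (simp add: e_def)
        then have "w \<in> span (insert e B)" by (simp add: span_scale span_base)
        moreover have "(\<Sum>b\<in>B. g x v b *\<^sub>R b) \<in> span (insert e B)"
          by (rule subsetD[OF span_mono sB]) auto
        ultimately have "w + (\<Sum>b\<in>B. g x v b *\<^sub>R b) \<in> span (insert e B)" by (rule span_add)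
        then have "v \<in> span (insert e B)" by (simp only: w_def diff_add_cancel)
        moreover have "F \<subseteq> span (insert e B)"
          using B(2) span_superset[of F] span_mono[of B "insert e B"] by auto
        ultimately show "span (insert v F) \<subseteq> span (insert e B)" by (intro span_minimal subspace_span) auto
      qed
      ultimately show ?thesis
        using B ee eB by (intro exI[of _ "insert e B"]) (auto simp: orthonormal_basis_def)
    qed
  qed
  then show thesis using that by blast
qed

lemma orthonormal_basis_tight:
  assumes B: "orthonormal_basis (g x) S B" and S: "S \<subseteq> T x"
  shows "tight_frame (g x) S B (\<lambda>b. b)"
proof -
  have f: "finite B" and sp: "span B = S" and on: "\<forall>u\<in>B. \<forall>v\<in>B. g x u v = (if u = v then 1 else 0)"
    using B by (auto simp: orthonormal_basis_def)
  have BT: "b \<in> T x" if "b \<in> B" for b using that sp S span_base by blast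
  have "u = (\<Sum>b\<in>B. g x u b *\<^sub>R b)" if "u \<in> S" for u
  proof -
    have "u \<in> range (\<lambda>c. \<Sum>b\<in>B. c b *\<^sub>R b)" using that sp span_finite[OF f] by simp
    then obtain c where u: "u = (\<Sum>b\<in>B. c b *\<^sub>R b)" by (rule rangeE)
    have "g x u b = c b" if b: "b \<in> B" for b
    proof -
      have "g x u b = (\<Sum>a\<in>B. c a * g x a b)" unfolding u by (rule g_sum(1)[OF BT[OF b] BT])
      also have "\<dots> = (\<Sum>a\<in>B. if a = b then c a else 0)" using on b by (intro sum.cong) auto
      finally show ?thesis using b f by simp
    qed
    then show ?thesis using u by (metis (no_types, lifting) sum.cong)
  qed
  then show ?thesis using f sp span_base by (auto simp: tight_frame_def)
qed

lemma tight_frame_span: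
  assumes "tight_frame (g x) S I e" "subspace S" shows "span (e ` I) = S"
proof
  show "span (e ` I) \<subseteq> S" using assms by (intro span_minimal) (auto simp: tight_frame_def)
  show "S \<subseteq> span (e ` I)"
  proof
    fix u assume "u \<in> S"
    then have "u = (\<Sum>a\<in>I. g x u (e a) *\<^sub>R e a)" using assms(1) by (simp add: tight_frame_def)
    moreover have "(\<Sum>a\<in>I. g x u (e a) *\<^sub>R e a) \<in> span (e ` I)" by (intro span_sum span_scale span_base) auto
    ultimately show "u \<in> span (e ` I)" by simp
  qed
qed

text \<open>Orthonormal bases are tight frames, so the trace over the basis that was chosen agrees with the sum
  over any tight frame.\<close>

lemma form_trace_tight:
  assumes fr: "tight_frame (g x) S I e" and S: "subspace S" "S \<subseteq> T x"
    and lin1: "\<And>v. v \<in> S \<Longrightarrow> lin_on S (\<lambda>u. \<beta> u v)" and lin2: "\<And>u. u \<in> S \<Longrightarrow> lin_on S (\<beta> u)"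
  shows "form_trace (g x) S \<beta> = (\<Sum>a\<in>I. \<beta> (e a) (e a))"
proof -
  have "finite (e ` I)" "e ` I \<subseteq> T x" using fr S by (auto simp: tight_frame_def)
  then obtain B where "orthonormal_basis (g x) (span (e ` I)) B" by (rule orthonormal_basis_exists)
  then have "orthonormal_basis (g x) S (SOME B. orthonormal_basis (g x) S B)"
    unfolding tight_frame_span[OF fr S(1)] by (rule someI)
  from orthonormal_basis_tight[OF this S(2)] show ?thesis
    unfolding form_trace_def
    by (rule tight_frame_trace_unique[OF S(1) _ fr _ lin1 lin2]) (use metric_sym S(2) in blast)
qed

lemma orthogonal_independent:
  assumes Q: "Q \<subseteq> T x" "0 \<notin> Q" "\<forall>u\<in>Q. \<forall>v\<in>Q. u \<noteq> v \<longrightarrow> g x u v = 0"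
  shows "independent Q"
  unfolding dependent_def
proof clarify
  fix b assume b: "b \<in> Q" "b \<in> span (Q - {b})"
  have bT: "b \<in> T x" using b Q by auto
  have "subspace {v \<in> T x. g x v b = 0}"
    using bT by (auto simp: subspace_def tangent_closed g_lin)
  moreover have "Q - {b} \<subseteq> {v \<in> T x. g x v b = 0}" using Q b(1) by auto
  ultimately have "span (Q - {b}) \<subseteq> {v \<in> T x. g x v b = 0}" by (rule span_minimal[rotated])
  then have "g x b b = 0" using b(2) by auto
  then show False using g_eq_0[OF bT] Q(2) b(1) by auto
qed

lemma tight_frame_norm_sum:
  assumes fr: "tight_frame (g x) S I e" and S: "subspace S" "S \<subseteq> T x"
  shows "(\<Sum>a\<in>I. g x (e a) (e a)) = dim S"
proof -
  have "finite (e ` I)" "e ` I \<subseteq> T x" using fr S by (auto simp: tight_frame_def)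
  then obtain B where "orthonormal_basis (g x) (span (e ` I)) B" by (rule orthonormal_basis_exists)
  then have B: "orthonormal_basis (g x) S B" unfolding tight_frame_span[OF fr S(1)] .
  have lin: "lin_on S (\<lambda>u. g x u v)" "lin_on S (g x v)" if "v \<in> S" for v
    using lin_on_g[of v x] that S(2) by (auto simp: lin_on_def subset_iff)
  have on: "finite B" "span B = S" "\<forall>u\<in>B. \<forall>v\<in>B. g x u v = (if u = v then 1 else 0)"
    using B by (auto simp: orthonormal_basis_def)
  have BT: "b \<in> T x" if "b \<in> B" for b using that on(2) S span_base by blast
  have "(\<Sum>a\<in>I. g x (e a) (e a)) = (\<Sum>b\<in>B. g x b b)"
    by (rule tight_frame_trace_unique[OF S(1) fr orthonormal_basis_tight[OF B S(2)] _ lin])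
      (use metric_sym S(2) in auto)
  also have "\<dots> = card B" using on by simp
  also have "card B = dim S"
  proof -
    have "independent B"
      by (rule orthogonal_independent[of _ x]) (use BT on(3) g_lin(5)[OF tangent_closed(1), of x] in auto)
    from dim_span_eq_card_independent[OF this] show ?thesis using on(2) by simp
  qed
  finally show ?thesis .
qed

lemma orth_proj_eqI:
  assumes S: "S \<subseteq> T x" "subspace S" and "u \<in> S" "v \<in> T x" "\<And>s. s \<in> S \<Longrightarrow> g x (v - u) s = 0"
  shows "orth_proj (g x) S v = u"
  unfolding orth_proj_def
proof (rule the_equality)
  show "u \<in> S \<and> (\<forall>s\<in>S. g x (v - u) s = 0)" using assms by blast
  fix u' assume u': "u' \<in> S \<and> (\<forall>s\<in>S. g x (v - u') s = 0)"
  have d: "u - u' \<in> S" using assms u' by (auto intro: subspace_diff)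
  have T: "u \<in> T x" "u' \<in> T x" "u - u' \<in> T x" using d assms(1,3) u' by auto
  have "g x (u - u') (u - u') = g x (v - u') (u - u') - g x (v - u) (u - u')"
    using T assms(4) by (simp add: g_lin tangent_closed)
  then have "g x (u - u') (u - u') = 0" using assms(5)[OF d] u' d by simp
  then have "u - u' = 0" by (rule g_eq_0[OF T(3)])
  then show "u' = u" by simp
qed

lemma grad_eqI:
  assumes "u \<in> T x" "\<And>v. v \<in> T x \<Longrightarrow> g x u v = v f" shows "grad A g f x = u"
  unfolding grad_def
proof (rule the_equality)
  show "u \<in> T x \<and> (\<forall>v\<in>T x. g x u v = v f)" using assms by blast
  show "u' = u" if "u' \<in> T x \<and> (\<forall>v\<in>T x. g x u' v = v f)" for u'
    by (rule g_eqI[of _ x]) (use that assms in auto)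
qed

section \<open>A global tight frame orthogonal to a unit field\<close>

lemma vector_field_extension:
  assumes "v \<in> T x" obtains X where "X \<in> vector_fields A" "X x = v"
proof -
  obtain U \<phi> where U: "(U, \<phi>) \<in> A" "x \<in> U" by (rule chart_at)
  obtain N \<xi> where N: "open N" "x \<in> N" "N \<subseteq> U"
    "\<forall>b\<in>Basis. \<xi> b \<in> smooth_funs A"
    "\<forall>b\<in>Basis. \<forall>y\<in>N. \<xi> b y = \<phi> y \<bullet> b"
    "\<forall>y\<in>N. \<forall>v\<in>tangent_space A y. v = (\<Sum>b\<in>Basis. v (\<xi> b) *\<^sub>R coord_vec U \<phi> y b)"
    by (rule tangent_coordinates[OF U])
  obtain N' E where N': "open N'" "x \<in> N'" "N' \<subseteq> U" "\<forall>b. E b \<in> vector_fields A"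
    "\<forall>y\<in>N'. \<forall>b. E b y = coord_vec U \<phi> y b"
    by (rule coord_field_exists[OF U])
  show thesis
  proof
    show "(\<lambda>y. \<Sum>b\<in>Basis. v (\<xi> b) *\<^sub>R E b y) \<in> vector_fields A"
      by (intro vf_sum vf_cscale) (use N'(4) in simp)
    have "(\<Sum>b\<in>Basis. v (\<xi> b) *\<^sub>R E b x) = (\<Sum>b\<in>Basis. v (\<xi> b) *\<^sub>R coord_vec U \<phi> x b)"
      by (rule sum.cong[OF refl]) (simp only: N'(5)[rule_format, OF N'(2)])
    also have "\<dots> = v" by (rule bspec[OF bspec[OF N(6) N(2)] assms, symmetric])
    finally show "(\<Sum>b\<in>Basis. v (\<xi> b) *\<^sub>R E b x) = v" .
  qed
qed

lemma smooth_inverse_sqrt_on: "smooth_on {0<..} (\<lambda>s. inverse (sqrt s))"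
  by (rule smooth_on_compose[where T = "- {0}" and f = sqrt])
    (use smooth_on_sqrt smooth_on_inverse in auto)

lemma local_normalisation:
  assumes h: "h \<in> smooth_funs A" and pos: "h x0 > 0"
  obtains N s where "open N" "x0 \<in> N" "s \<in> smooth_funs A" "\<forall>x\<in>N. h x > 0 \<and> (s x)\<^sup>2 * h x = 1"
proof -
  have W: "open {x. h x > 0}"
    using open_Collect_less[OF continuous_on_const smooth_funs_continuous[OF h], of 0] by simp
  obtain N \<eta> where N: "open N" "x0 \<in> N" "N \<subseteq> {x. h x > 0}" "\<eta> \<in> smooth_funs A"
    "\<And>x. x \<in> N \<Longrightarrow> \<eta> x = 1" "\<And>x. x \<notin> {x. h x > 0} \<Longrightarrow> \<eta> x = 0"
    using bump_on_manifold[OF W, of x0] pos by auto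
  \<comment> \<open>a positive smooth function that agrees with \<open>h\<close> near \<open>x0\<close>\<close>
  define k where "k x = (\<eta> x)\<^sup>2 * h x + (1 - \<eta> x)\<^sup>2" for x
  have ks: "k \<in> smooth_funs A" unfolding k_def[abs_def]
    by (intro smooth_funs_add smooth_funs_mult smooth_funs_power smooth_funs_diff smooth_funs_const N h)
  have kpos: "k x > 0" for x
  proof (cases "\<eta> x = 0")
    case False
    then have "h x > 0" using N(6)[of x] by auto
    then have "(\<eta> x)\<^sup>2 * h x > 0" using False by simp
    then show ?thesis by (simp add: k_def add_pos_nonneg)
  qed (simp add: k_def)
  show thesis
  proof
    show "(\<lambda>x. inverse (sqrt (k x))) \<in> smooth_funs A"
      by (rule smooth_funs_compose[OF ks _ _ smooth_inverse_sqrt_on]) (use kpos in auto)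
    show "\<forall>x\<in>N. h x > 0 \<and> (inverse (sqrt (k x)))\<^sup>2 * h x = 1"
    proof
      fix x assume x: "x \<in> N"
      then have "k x = h x" "h x > 0" using N by (auto simp: k_def)
      then show "h x > 0 \<and> (inverse (sqrt (k x)))\<^sup>2 * h x = 1" by (simp add: power_inverse)
    qed
  qed (use N in auto)
qed

text \<open>The Gram--Schmidt process for fields that extend the vectors in \<open>B\<close>. The statement about spans at
  \<open>x0\<close> keeps the next residual nonzero at \<open>x0\<close>, hence in a neighbourhood, where it can be normalised.\<close>

lemma gram_schmidt_fields:
  assumes w: "w \<in> vector_fields A" "\<And>x. g x (w x) (w x) = 1"
    and B: "finite B" "B \<subseteq> T x0" "w x0 \<notin> B" "independent (insert (w x0) B)"
  shows "\<exists>N e. open N \<and> x0 \<in> N \<and> (\<forall>b\<in>B. e b \<in> vector_fields A) \<and>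
    (\<forall>x\<in>N. \<forall>b\<in>B. g x (e b x) (w x) = 0 \<and> (\<forall>b'\<in>B. g x (e b x) (e b' x) = (if b = b' then 1 else 0))) \<and>
    (\<forall>b\<in>B. e b x0 \<in> span (insert (w x0) B))"
  using B
proof (induction B rule: finite_induct)
  case empty
  show ?case by (intro exI[of _ UNIV]) simp
next
  case (insert v B)
  have "independent (insert (w x0) B)" by (rule independent_mono[OF insert.prems(3)]) auto
  then obtain N e where N: "open N" "x0 \<in> N" and e: "\<forall>b\<in>B. e b \<in> vector_fields A"
    and on: "\<forall>x\<in>N. \<forall>b\<in>B. g x (e b x) (w x) = 0 \<and> (\<forall>b'\<in>B. g x (e b x) (e b' x) = (if b = b' then 1 else 0))"
    and sp: "\<forall>b\<in>B. e b x0 \<in> span (insert (w x0) B)"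
    using insert.IH insert.prems by auto
  have vT: "v \<in> T x0" using insert.prems by simp
  obtain X where X: "X \<in> vector_fields A" "X x0 = v" by (rule vector_field_extension[OF vT])
  define Y where "Y x = X x - (g x (X x) (w x) *\<^sub>R w x + (\<Sum>b\<in>B. g x (X x) (e b x) *\<^sub>R e b x))" for x
  have Y: "Y \<in> vector_fields A" unfolding Y_def[abs_def]
    by (intro vf_diff vf_add vf_sum vf_scale metric_smooth X w(1)) (use e in auto)
  have eT: "e b x \<in> T x" if "b \<in> B" for b x using bspec[OF e that] by (rule vfD(1))
  note XT = vfD(1)[OF X(1)] and wT = vfD(1)[OF w(1)] and YT = vfD(1)[OF Y]
  have Yw: "g x (Y x) (w x) = 0" if x: "x \<in> N" for x
  proof -
    have "(\<Sum>b\<in>B. g x (X x) (e b x) * g x (e b x) (w x)) = 0" using on x by (intro sum.neutral) auto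
    then show ?thesis unfolding Y_def
      by (simp add: g_lin XT wT eT tangent_closed g_sum w(2))
  qed
  have Ye: "g x (Y x) (e b x) = 0" if x: "x \<in> N" and b: "b \<in> B" for x b
  proof -
    have "(\<Sum>c\<in>B. g x (X x) (e c x) * g x (e c x) (e b x)) = (\<Sum>c\<in>B. if c = b then g x (X x) (e c x) else 0)"
      using on x b by (intro sum.cong) auto
    then have "(\<Sum>c\<in>B. g x (X x) (e c x) * g x (e c x) (e b x)) = g x (X x) (e b x)"
      using b insert.hyps(1) by simp
    moreover have "g x (w x) (e b x) = 0" using on x b metric_sym[OF wT eT[OF b]] by auto
    ultimately show ?thesis unfolding Y_def using b
      by (simp add: g_lin XT wT eT tangent_closed g_sum)
  qed
  have spv: "X x0 - Y x0 \<in> span (insert (w x0) B)"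
    unfolding Y_def using sp by (auto intro!: span_add span_scale span_sum intro: span_base)
  have "Y x0 \<noteq> 0"
  proof
    assume "Y x0 = 0"
    then have "v \<in> span (insert (w x0) B)" using spv X(2) by simp
    moreover have "v \<notin> insert (w x0) B" using insert.hyps insert.prems by auto
    moreover have "independent (insert v (insert (w x0) B))" using insert.prems(3) by (simp add: insert_commute)
    ultimately show False by (simp add: independent_insert)
  qed
  then have "g x0 (Y x0) (Y x0) > 0" by (rule metric_pos[OF YT])
  then obtain N' s where N': "open N'" "x0 \<in> N'" "s \<in> smooth_funs A"
    "\<forall>x\<in>N'. g x (Y x) (Y x) > 0 \<and> (s x)\<^sup>2 * g x (Y x) (Y x) = 1"
    using local_normalisation[OF metric_smooth[OF Y Y]] by blast
  define e' where "e' = e(v := \<lambda>x. s x *\<^sub>R Y x)"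
  have e'b: "e' b = e b" if "b \<in> B" for b using that insert.hyps by (auto simp: e'_def)
  have e'v: "e' v x = s x *\<^sub>R Y x" for x by (simp add: e'_def)
  show ?case
  proof (intro exI[of _ "N \<inter> N'"] exI[of _ e'] conjI ballI)
    show "open (N \<inter> N')" "x0 \<in> N \<inter> N'" using N N' by auto
    show "e' b \<in> vector_fields A" if "b \<in> insert v B" for b
      using that e e'b vf_scale[OF Y N'(3)] by (auto simp: e'_def)
    have spY: "Y x0 \<in> span (insert (w x0) (insert v B))"
    proof -
      have "X x0 \<in> span (insert (w x0) (insert v B))" unfolding X(2) by (rule span_base) simp
      moreover have "X x0 - Y x0 \<in> span (insert (w x0) (insert v B))"
        by (rule subsetD[OF span_mono spv]) auto
      ultimately have "X x0 - (X x0 - Y x0) \<in> span (insert (w x0) (insert v B))" by (rule span_diff)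
      then show ?thesis by simp
    qed
    show "e' b x0 \<in> span (insert (w x0) (insert v B))" if "b \<in> insert v B" for b
    proof (cases "b = v")
      case True then show ?thesis using spY by (simp add: e'v span_scale)
    next
      case False
      then have "b \<in> B" using that by simp
      then show ?thesis using sp e'b span_mono[of "insert (w x0) B" "insert (w x0) (insert v B)"] by auto
    qed
    fix x b assume x: "x \<in> N \<inter> N'" and b: "b \<in> insert v B"
    then have xN: "x \<in> N" and xN': "x \<in> N'" by auto
    have vv: "g x (e' v x) (e' v x) = 1"
      using bspec[OF N'(4) xN'] by (simp add: e'v g_lin g_lin' YT tangent_closed power2_eq_square mult.assoc)
    have vw: "g x (e' v x) (w x) = 0" by (simp add: e'v g_lin YT wT Yw[OF xN])
    have ve: "g x (e' v x) (e c x) = 0" "g x (e c x) (e' v x) = 0" if "c \<in> B" for c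
      using Ye[OF xN that] metric_sym[OF YT eT[OF that], of x]
      by (simp_all add: e'v g_lin g_lin' YT eT[OF that])
    show "g x (e' b x) (w x) = 0"
      using b vw bspec[OF bspec[OF on xN]] e'b by auto
    fix b' assume b': "b' \<in> insert v B"
    show "g x (e' b x) (e' b' x) = (if b = b' then 1 else 0)"
      using b b' vv ve e'b bspec[OF bspec[OF on xN]] insert.hyps(2) by auto
  qed
qed

lemma independent_card_le_dim_tangent:
  assumes "finite Q" "Q \<subseteq> T x" "independent Q" shows "card Q \<le> DIM('e)"
proof -
  obtain B where B: "B \<subseteq> T x" "independent B" "T x \<subseteq> span B" "card B = dim (T x)"
    by (rule basis_exists)
  have "finite B" using B(4) dim_tangent_space[of x] by (metis DIM_positive card.infinite less_numeral_extra(3))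
  then show ?thesis using independent_span_bound[of B Q] assms B dim_tangent_space[of x] by auto
qed

text \<open>A residue \<open>r\<close> of the expansion would be orthogonal to \<open>w x\<close> and to all frame vectors, and together
  they would be more independent vectors than the dimension admits.\<close>

lemma local_orthonormal_frame:
  assumes w: "w \<in> vector_fields A" "\<And>x. g x (w x) (w x) = 1"
  shows "\<exists>N (B :: 'm tvec set) e. open N \<and> x0 \<in> N \<and> finite B \<and> (\<forall>b\<in>B. e b \<in> vector_fields A) \<and>
    (\<forall>x\<in>N. (\<forall>b\<in>B. g x (e b x) (w x) = 0) \<and>
      (\<forall>u\<in>T x. u = g x u (w x) *\<^sub>R w x + (\<Sum>b\<in>B. g x u (e b x) *\<^sub>R e b x)))"
proof -
  note wT = vfD(1)[OF w(1)]
  have w0: "w x \<noteq> 0" for x using w(2)[of x] g_lin(5)[OF wT, of x] by auto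
  have "independent {w x0}" using w0 by simp
  then obtain B0 where B0: "{w x0} \<subseteq> B0" "B0 \<subseteq> T x0" "independent B0" "T x0 \<subseteq> span B0"
    using maximal_independent_subset_extend[of "{w x0}" "T x0"] wT by auto
  have cB0: "card B0 = DIM('e)"
    using basis_card_eq_dim[OF B0(2,4,3)] dim_tangent_space[of x0] by simp
  then have fB0: "finite B0" by (metis DIM_positive card.infinite less_numeral_extra(3))
  define B where "B = B0 - {w x0}"
  have iB: "insert (w x0) B = B0" using B0 by (auto simp: B_def)
  have B: "finite B" "B \<subseteq> T x0" "w x0 \<notin> B" "independent (insert (w x0) B)"
    using fB0 B0 iB by (auto simp: B_def)
  have cB: "Suc (card B) = DIM('e)" using cB0 iB B(1,3) by (metis card_insert_disjoint)
  obtain N e where N: "open N" "x0 \<in> N" and e: "\<forall>b\<in>B. e b \<in> vector_fields A"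
    and on: "\<forall>x\<in>N. \<forall>b\<in>B. g x (e b x) (w x) = 0 \<and> (\<forall>b'\<in>B. g x (e b x) (e b' x) = (if b = b' then 1 else 0))"
    using gram_schmidt_fields[OF w B] by auto
  have eT: "e b x \<in> T x" if "b \<in> B" for b x using bspec[OF e that] by (rule vfD(1))
  have "u = g x u (w x) *\<^sub>R w x + (\<Sum>b\<in>B. g x u (e b x) *\<^sub>R e b x)" if x: "x \<in> N" and u: "u \<in> T x" for x u
  proof (rule ccontr)
    define r where "r = u - (g x u (w x) *\<^sub>R w x + (\<Sum>b\<in>B. g x u (e b x) *\<^sub>R e b x))"
    assume "u \<noteq> g x u (w x) *\<^sub>R w x + (\<Sum>b\<in>B. g x u (e b x) *\<^sub>R e b x)"
    then have r0: "r \<noteq> 0" by (simp add: r_def)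
    have rT: "r \<in> T x" unfolding r_def by (intro tangent_closed u wT eT)
    have ew: "g x (e b x) (w x) = 0" "g x (w x) (e b x) = 0" if "b \<in> B" for b
      using on x that metric_sym[OF wT eT[OF that]] by auto
    have ee: "g x (e b x) (e c x) = (if b = c then 1 else 0)" if "b \<in> B" "c \<in> B" for b c
      using on x that by auto
    have "(\<Sum>b\<in>B. g x u (e b x) * g x (e b x) (w x)) = 0" using ew by (intro sum.neutral) auto
    then have rw: "g x r (w x) = 0" unfolding r_def
      by (simp add: g_lin u wT eT tangent_closed g_sum w(2))
    have re: "g x r (e b x) = 0" if b: "b \<in> B" for b
    proof -
      have "(\<Sum>c\<in>B. g x u (e c x) * g x (e c x) (e b x)) = (\<Sum>c\<in>B. if c = b then g x u (e c x) else 0)"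
        using ee b by (intro sum.cong) auto
      then show ?thesis unfolding r_def using b ew(2)[OF b] B(1)
        by (simp add: g_lin u wT eT tangent_closed g_sum)
    qed
    have eb0: "e b x \<noteq> 0" if "b \<in> B" for b using ee[OF that that] g_lin(5)[OF tangent_closed(1), of x] by auto
    have inj: "inj_on (\<lambda>b. e b x) B"
    proof (rule inj_onI)
      fix b c assume bc: "b \<in> B" "c \<in> B" "e b x = e c x"
      then show "b = c" using ee[OF bc(1) bc(2)] ee[OF bc(2) bc(2)] by (auto split: if_splits)
    qed
    have wn: "w x \<notin> (\<lambda>b. e b x) ` B"
    proof
      assume "w x \<in> (\<lambda>b. e b x) ` B"
      then obtain b where "b \<in> B" "w x = e b x" by auto
      then show False using ew(1)[of b] w(2)[of x] by simp
    qed
    define Q where "Q = insert r (insert (w x) ((\<lambda>b. e b x) ` B))"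
    have rn: "r \<notin> insert (w x) ((\<lambda>b. e b x) ` B)"
    proof
      assume "r \<in> insert (w x) ((\<lambda>b. e b x) ` B)"
      then have "g x r r = 0" using rw re by auto
      then show False using g_eq_0[OF rT] r0 by simp
    qed
    have QT: "Q \<subseteq> T x" using rT wT eT by (auto simp: Q_def)
    have "independent Q"
      by (rule orthogonal_independent[OF QT])
        (use r0 w0 eb0 rw re ew ee metric_sym[OF rT wT] metric_sym[OF rT eT] in \<open>auto simp: Q_def\<close>)
    then have "card Q \<le> DIM('e)" using QT B(1) by (intro independent_card_le_dim_tangent) (auto simp: Q_def)
    moreover have "card Q = Suc (Suc (card B))" using rn wn inj B(1) by (simp add: Q_def card_image)
    ultimately show False using cB by simp
  qed
  then show ?thesis using N B(1) e on by (intro exI[of _ N] exI[of _ B] exI[of _ e]) simp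
qed

text \<open>Local frames are cut off by functions \<open>\<zeta> x0\<close> whose squares sum to one. The frame identity is quadratic
  in the frame, so it survives this gluing.\<close>

lemma global_frame_exists:
  assumes w: "w \<in> vector_fields A" "\<And>x. g x (w x) (w x) = 1" and cpt: "compact (UNIV :: 'm set)"
  shows "\<exists>(I :: ('m \<times> 'm tvec) set) E. finite I \<and> (\<forall>a\<in>I. E a \<in> vector_fields A) \<and>
    (\<forall>x. \<forall>a\<in>I. g x (E a x) (w x) = 0) \<and>
    (\<forall>x. \<forall>u\<in>T x. u = g x u (w x) *\<^sub>R w x + (\<Sum>a\<in>I. g x u (E a x) *\<^sub>R E a x))"
proof -
  note wT = vfD(1)[OF w(1)]
  let ?P = "\<lambda>x0 N (B :: 'm tvec set) e. open N \<and> x0 \<in> N \<and> finite B \<and> (\<forall>b\<in>B. e b \<in> vector_fields A) \<and>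
    (\<forall>x\<in>N. (\<forall>b\<in>B. g x (e b x) (w x) = 0) \<and>
      (\<forall>u\<in>T x. u = g x u (w x) *\<^sub>R w x + (\<Sum>b\<in>B. g x u (e b x) *\<^sub>R e b x)))"
  have "\<forall>x0. \<exists>N B e. ?P x0 N B e" using local_orthonormal_frame[OF w] by simp
  then obtain N where "\<forall>x0. \<exists>B e. ?P x0 (N x0) B e" by (rule choice[THEN exE])
  then obtain B where "\<forall>x0. \<exists>e. ?P x0 (N x0) (B x0) e" by (rule choice[THEN exE])
  then obtain e where e: "\<forall>x0. ?P x0 (N x0) (B x0) (e x0)" by (rule choice[THEN exE])
  have "\<forall>x0. \<exists>\<eta>. \<eta> \<in> smooth_funs A \<and> \<eta> x0 = 1 \<and> (\<forall>x. x \<notin> N x0 \<longrightarrow> \<eta> x = 0)"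
  proof
    fix x0
    have "open (N x0)" "x0 \<in> N x0" using e by auto
    then obtain N' \<eta> where "x0 \<in> N'" "\<eta> \<in> smooth_funs A" "\<And>x. x \<in> N' \<Longrightarrow> \<eta> x = 1" "\<And>x. x \<notin> N x0 \<Longrightarrow> \<eta> x = 0"
      using bump_on_manifold by metis
    then show "\<exists>\<eta>. \<eta> \<in> smooth_funs A \<and> \<eta> x0 = 1 \<and> (\<forall>x. x \<notin> N x0 \<longrightarrow> \<eta> x = 0)" by auto
  qed
  then obtain \<eta> where \<eta>: "\<forall>x0. \<eta> x0 \<in> smooth_funs A \<and> \<eta> x0 x0 = 1 \<and> (\<forall>x. x \<notin> N x0 \<longrightarrow> \<eta> x0 x = 0)"
    by (rule choice[THEN exE])
  define O' where "O' x0 = {x. \<eta> x0 x > 0}" for x0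
  have "open (O' x0)" for x0 unfolding O'_def
    using \<eta> by (intro open_Collect_less continuous_on_const smooth_funs_continuous) auto
  moreover have "UNIV \<subseteq> (\<Union>x0. O' x0)" using \<eta> by (auto simp: O'_def intro!: exI)
  ultimately obtain C where C: "finite C" "UNIV \<subseteq> (\<Union>x0\<in>C. O' x0)"
    using compactE_image[OF cpt, of UNIV O'] by auto
  define S where "S x = (\<Sum>x0\<in>C. (\<eta> x0 x)\<^sup>2)" for x
  have Ssm: "S \<in> smooth_funs A" unfolding S_def[abs_def]
    by (intro smooth_funs_sum smooth_funs_power) (use \<eta> in auto)
  have Spos: "S x > 0" for x
  proof -
    obtain x0 where "x0 \<in> C" "\<eta> x0 x > 0" using C(2) by (auto simp: O'_def)
    then show ?thesis unfolding S_def using C(1) by (intro sum_pos2[of C x0]) auto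
  qed
  define \<zeta> where "\<zeta> x0 x = \<eta> x0 x * inverse (sqrt (S x))" for x0 x
  have \<zeta>: "\<zeta> x0 \<in> smooth_funs A" for x0 unfolding \<zeta>_def[abs_def]
    using \<eta> Spos by (intro smooth_funs_mult smooth_funs_compose[OF Ssm _ _ smooth_inverse_sqrt_on]) auto
  have \<zeta>1: "(\<Sum>x0\<in>C. (\<zeta> x0 x)\<^sup>2) = 1" for x
  proof -
    have "(\<Sum>x0\<in>C. (\<zeta> x0 x)\<^sup>2) = S x * (inverse (sqrt (S x)))\<^sup>2"
      unfolding S_def[of x] by (simp add: \<zeta>_def power_mult_distrib S_def sum_distrib_right)
    also have "\<dots> = 1" using Spos[of x] by (simp add: power_inverse)
    finally show ?thesis .
  qed
  have \<zeta>0: "\<zeta> x0 x = 0" if "x \<notin> N x0" for x0 x using \<eta> that by (simp add: \<zeta>_def)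
  define I where "I = Sigma C B"
  define E where "E a x = \<zeta> (fst a) x *\<^sub>R e (fst a) (snd a) x" for a x
  have fI: "finite I" using C e by (auto simp: I_def)
  have eV: "e x0 b \<in> vector_fields A" if "b \<in> B x0" for x0 b using e that by auto
  have E: "E a \<in> vector_fields A" if "a \<in> I" for a
    unfolding E_def[abs_def] by (rule vf_scale[OF eV \<zeta>]) (use that in \<open>auto simp: I_def\<close>)
  have Ew: "g x (E a x) (w x) = 0" if "a \<in> I" for a x
  proof (cases "x \<in> N (fst a)")
    case True
    then have "g x (e (fst a) (snd a) x) (w x) = 0" using e that by (auto simp: I_def)
    moreover have "e (fst a) (snd a) x \<in> T x" by (rule vfD(1)[OF eV]) (use that in \<open>auto simp: I_def\<close>)
    ultimately show ?thesis by (simp add: E_def g_lin wT)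
  next
    case False
    then show ?thesis by (simp add: E_def \<zeta>0 g_lin(5)[OF wT])
  qed
  have "u = g x u (w x) *\<^sub>R w x + (\<Sum>a\<in>I. g x u (E a x) *\<^sub>R E a x)" if u: "u \<in> T x" for x u
  proof -
    define R where "R = u - g x u (w x) *\<^sub>R w x"
    have "(\<Sum>a\<in>I. g x u (E a x) *\<^sub>R E a x) = (\<Sum>x0\<in>C. \<Sum>b\<in>B x0. g x u (E (x0, b) x) *\<^sub>R E (x0, b) x)"
      unfolding I_def by (subst sum.Sigma) (use C e in \<open>auto simp: split_beta\<close>)
    also have "\<dots> = (\<Sum>x0\<in>C. (\<zeta> x0 x)\<^sup>2 *\<^sub>R R)"
    proof (rule sum.cong[OF refl])
      fix x0 assume x0: "x0 \<in> C"
      have 1: "g x u (E (x0, b) x) *\<^sub>R E (x0, b) x = (\<zeta> x0 x)\<^sup>2 *\<^sub>R (g x u (e x0 b x) *\<^sub>R e x0 b x)" if "b \<in> B x0" for b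
        using vfD(1)[OF eV[OF that]] u by (simp add: E_def g_lin' power2_eq_square mult_ac)
      have "(\<Sum>b\<in>B x0. g x u (E (x0, b) x) *\<^sub>R E (x0, b) x) = (\<zeta> x0 x)\<^sup>2 *\<^sub>R (\<Sum>b\<in>B x0. g x u (e x0 b x) *\<^sub>R e x0 b x)"
        unfolding scaleR_sum_right by (rule sum.cong[OF refl 1])
      also have "\<dots> = (\<zeta> x0 x)\<^sup>2 *\<^sub>R R"
      proof (cases "x \<in> N x0")
        case True
        then have "u = g x u (w x) *\<^sub>R w x + (\<Sum>b\<in>B x0. g x u (e x0 b x) *\<^sub>R e x0 b x)" using e u by blast
        then have "(\<Sum>b\<in>B x0. g x u (e x0 b x) *\<^sub>R e x0 b x) = R" unfolding R_def by (simp add: algebra_simps)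
        then show ?thesis by simp
      qed (simp add: \<zeta>0)
      finally show "(\<Sum>b\<in>B x0. g x u (E (x0, b) x) *\<^sub>R E (x0, b) x) = (\<zeta> x0 x)\<^sup>2 *\<^sub>R R" .
    qed
    also have "\<dots> = R" by (simp add: \<zeta>1 flip: scaleR_sum_left)
    finally show ?thesis by (simp add: R_def)
  qed
  then show ?thesis using fI E Ew by (intro exI[of _ I] exI[of _ E]) simp
qed

end


section \<open>Sasakian geometry\<close>

context smooth_manifold
begin

lemma lie_bracket_swap: "lie_bracket Y X x = - lie_bracket X Y x"
  by (simp add: lie_bracket_def fun_eq_iff)

lemma lie_bracket_zero_right: "X \<in> vector_fields A \<Longrightarrow> lie_bracket X (\<lambda>y. 0) x = 0"
  by (simp add: lie_bracket_def fun_eq_iff tangent_const[OF vfD(1)])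

lemma jacobi_identity:
  assumes X: "X \<in> vector_fields A" and Y: "Y \<in> vector_fields A" and Z: "Z \<in> vector_fields A"
  shows "lie_bracket X (lie_bracket Y Z) x =
    lie_bracket (lie_bracket X Y) Z x + lie_bracket Y (lie_bracket X Z) x"
proof -
  have "lie_bracket X (lie_bracket Y Z) x f =
    lie_bracket (lie_bracket X Y) Z x f + lie_bracket Y (lie_bracket X Z) x f" for f
  proof (cases "f \<in> smooth_funs A")
    case True
    have dd: "P x (\<lambda>y. Q y (\<lambda>z. R z f) - R y (\<lambda>z. Q z f)) = P x (\<lambda>y. Q y (\<lambda>z. R z f)) - P x (\<lambda>y. R y (\<lambda>z. Q z f))"
      if "P \<in> vector_fields A" "Q \<in> vector_fields A" "R \<in> vector_fields A" for P Q R
      by (rule tangent_diff[OF vfD(1)[OF that(1)] vfD(2)[OF that(2) vfD(2)[OF that(3) True]]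
            vfD(2)[OF that(3) vfD(2)[OF that(2) True]]])
    show ?thesis unfolding lie_bracket_def plus_fun_def
      by (simp only: dd[OF X Y Z] dd[OF Y X Z] dd[OF Z X Y])
  next
    case False
    note V = vfD(1)[OF lie_bracket_vf]
    show ?thesis
      using tangentD(4)[OF V[OF X lie_bracket_vf[OF Y Z]] False] tangentD(4)[OF V[OF lie_bracket_vf[OF X Y] Z] False]
        tangentD(4)[OF V[OF Y lie_bracket_vf[OF X Z]] False] by simp
  qed
  then show ?thesis by (simp add: fun_eq_iff)
qed

end

locale sasakian_levi_civita = sasakian_manifold A g n J w \<alpha>
  for A :: "('m::{t2_space, second_countable_topology}, 'e::euclidean_space) atlas"
    and g n J w \<alpha> +
  fixes nabla :: "'m connection"
  assumes lc: "levi_civita A g nabla"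
begin

lemma wT: "w x \<in> T x" by (rule vfD(1)[OF reeb_field])

lemma JT: "v \<in> T x \<Longrightarrow> J x v \<in> T x"
  using J_tensor by (auto simp: tensor11_def)

lemma J_lin_on: "lin_on (T x) (J x)"
  using J_tensor by (auto simp: tensor11_def)

lemma J_lin:
  shows "u \<in> T x \<Longrightarrow> v \<in> T x \<Longrightarrow> J x (u + v) = J x u + J x v"
    and "u \<in> T x \<Longrightarrow> J x (c *\<^sub>R u) = c *\<^sub>R J x u"
    and "u \<in> T x \<Longrightarrow> v \<in> T x \<Longrightarrow> J x (u - v) = J x u - J x v"
    and "u \<in> T x \<Longrightarrow> J x (- u) = - J x u" and "J x 0 = 0"
proof -
  show a: "J x (u + v) = J x u + J x v" if "u \<in> T x" "v \<in> T x" for u v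
    using lin_onD(1)[OF J_lin_on] that by blast
  show s: "J x (c *\<^sub>R u) = c *\<^sub>R J x u" if "u \<in> T x" for c u
    using lin_onD(2)[OF J_lin_on] that by blast
  show n: "J x (- u) = - J x u" if "u \<in> T x" for u using s[OF that, of "-1"] by simp
  show "J x (u - v) = J x u - J x v" if "u \<in> T x" "v \<in> T x" for u v
    using a[OF that(1), of "- v"] n[OF that(2)] that by (simp add: tangent_closed)
  show "J x 0 = 0" using s[of 0 0] by (simp add: tangent_closed)
qed

lemma J_vf: "X \<in> vector_fields A \<Longrightarrow> (\<lambda>x. J x (X x)) \<in> vector_fields A"
  using J_tensor by (auto simp: tensor11_def)

lemma alpha_lin_on: "lin_on (T x) (\<alpha> x)"
  using contact by (auto simp: contact_form_def one_form_def)

lemma ext_deriv_swap: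
  assumes X: "X \<in> vector_fields A" and Y: "Y \<in> vector_fields A"
  shows "ext_deriv \<alpha> Y X x = - ext_deriv \<alpha> X Y x"
proof -
  have "\<alpha> x (- 1 *\<^sub>R lie_bracket X Y x) = - 1 *\<^sub>R \<alpha> x (lie_bracket X Y x)"
    by (rule lin_onD(2)[OF alpha_lin_on vfD(1)[OF lie_bracket_vf[OF X Y]]])
  then show ?thesis unfolding ext_deriv_def lie_bracket_swap[of Y X] by simp
qed

lemma J_skew:
  assumes "u \<in> T x" "v \<in> T x" shows "g x (J x u) v = - g x u (J x v)"
proof -
  obtain X where X: "X \<in> vector_fields A" "X x = u" by (rule vector_field_extension[OF assms(1)])
  obtain Y where Y: "Y \<in> vector_fields A" "Y x = v" by (rule vector_field_extension[OF assms(2)])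
  have "g x u (J x v) = - g x v (J x u)"
    using compat[OF X(1) Y(1), of x] compat[OF Y(1) X(1), of x] ext_deriv_swap[OF X(1) Y(1), of x] X(2) Y(2) by simp
  then show ?thesis using metric_sym[OF JT[OF assms(1)] assms(2)] by simp
qed

lemma g_w_J: "v \<in> T x \<Longrightarrow> g x (w x) (J x v) = 0"
  using J_skew[OF wT, of v x] J_reeb[of x] g_lin(5)[of v x] by simp

lemma alpha_eq: assumes u: "u \<in> T x" shows "\<alpha> x u = g x (w x) u"
proof -
  define v where "v = u - \<alpha> x u *\<^sub>R w x"
  have vT: "v \<in> T x" unfolding v_def by (intro tangent_closed u wT)
  have "\<alpha> x (u + (- \<alpha> x u) *\<^sub>R w x) = \<alpha> x u + \<alpha> x ((- \<alpha> x u) *\<^sub>R w x)"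
    by (rule lin_onD(1)[OF alpha_lin_on u]) (intro tangent_closed wT)
  also have "\<alpha> x ((- \<alpha> x u) *\<^sub>R w x) = (- \<alpha> x u) *\<^sub>R \<alpha> x (w x)"
    by (rule lin_onD(2)[OF alpha_lin_on wT])
  finally have z: "\<alpha> x (u + (- \<alpha> x u) *\<^sub>R w x) = 0"
    by (simp only: alpha_reeb real_scaleR_def mult_1_right add.right_inverse)
  have "v = u + (- \<alpha> x u) *\<^sub>R w x" by (simp add: v_def)
  then have "\<alpha> x v = 0" using z by (simp only:)
  then have "v \<in> contact_dist A \<alpha> x" using vT by (simp add: contact_dist_def)
  then have "J x (J x v) = - v" by (rule J_squared)
  then have "g x (w x) (- v) = 0" using g_w_J[OF JT[OF vT]] by simp
  then have "g x (w x) v = 0" using vT wT by (simp add: g_lin')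
  then show ?thesis using u wT reeb_unit[of x] by (simp add: v_def g_lin' tangent_closed)
qed

lemma contact_dist_eq: "contact_dist A \<alpha> x = {v \<in> T x. g x (w x) v = 0}"
  by (auto simp: contact_dist_def alpha_eq)

lemma J_J: assumes v: "v \<in> T x" shows "J x (J x v) = g x (w x) v *\<^sub>R w x - v"
proof -
  define u where "u = v - g x (w x) v *\<^sub>R w x"
  have uT: "u \<in> T x" unfolding u_def by (intro tangent_closed v wT)
  have "g x (w x) u = 0" using v wT reeb_unit[of x] by (simp add: u_def g_lin' tangent_closed)
  then have "J x (J x u) = - u" using uT by (intro J_squared) (simp add: contact_dist_eq)
  moreover have "J x u = J x v" using v wT by (simp add: u_def J_lin tangent_closed J_reeb)
  ultimately show ?thesis by (simp add: u_def)
qed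

lemma ext_deriv_eq:
  assumes X: "X \<in> vector_fields A" and Y: "Y \<in> vector_fields A"
  shows "g x (X x) (J x (Y x)) = X x (\<lambda>y. g y (w y) (Y y)) - Y x (\<lambda>y. g y (w y) (X y))
    - g x (w x) (lie_bracket X Y x)"
  unfolding compat[OF X Y] ext_deriv_def
  by (simp add: alpha_eq vfD(1)[OF X] vfD(1)[OF Y] vfD(1)[OF lie_bracket_vf[OF X Y]])

lemma aX_smooth: "X \<in> vector_fields A \<Longrightarrow> (\<lambda>y. g y (w y) (X y)) \<in> smooth_funs A"
  by (rule metric_smooth[OF reeb_field])

lemma reeb_bracket_alpha:
  assumes X: "X \<in> vector_fields A"
  shows "g x (w x) (lie_bracket w X x) = w x (\<lambda>y. g y (w y) (X y))"
proof -
  have "X x (\<lambda>y. g y (w y) (w y)) = 0" unfolding reeb_unit by (rule tangent_const[OF vfD(1)[OF X]])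
  then show ?thesis using ext_deriv_eq[OF reeb_field X, of x] g_w_J[OF vfD(1)[OF X]] by simp
qed

text \<open>This is normality for the pair \<open>X\<close>, \<open>w\<close>, in which all terms with \<open>J w\<close> drop out. The Reeb component
  is settled by the previous lemma.\<close>

lemma J_commutes_reeb_bracket:
  assumes X: "X \<in> vector_fields A"
  shows "J x (lie_bracket w X x) = lie_bracket w (\<lambda>y. J y (X y)) x"
proof -
  let ?JX = "\<lambda>y. J y (X y)"
  note JX = J_vf[OF X]
  note b1 = vfD(1)[OF lie_bracket_vf[OF X reeb_field]] and b2 = vfD(1)[OF lie_bracket_vf[OF JX reeb_field]]
  define u where "u = J x (lie_bracket X w x) - lie_bracket ?JX w x"
  have uT: "u \<in> T x" unfolding u_def by (intro tangent_closed JT b1 b2)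
  have e: "ext_deriv \<alpha> X w x = 0"
    unfolding compat[OF X reeb_field, symmetric] J_reeb by (rule g_lin'(5)[OF vfD(1)[OF X]])
  have Jw: "(\<lambda>y. J y (w y)) = (\<lambda>y. 0)" by (simp add: J_reeb)
  have "J x (J x (lie_bracket X w x)) - J x (lie_bracket ?JX w x) = 0"
    using normality[OF X reeb_field, of x]
    by (simp add: nijenhuis_def e Jw lie_bracket_zero_right[OF JX] lie_bracket_zero_right[OF X] J_lin(5))
  then have Ju: "J x u = 0" unfolding u_def J_lin(3)[OF JT[OF b1] b2] .
  have "g x (w x) (lie_bracket w ?JX x) = 0"
    unfolding reeb_bracket_alpha[OF JX] using tangent_const[OF wT, of x 0] g_w_J[OF vfD(1)[OF X]] by simp
  then have "g x (w x) (lie_bracket ?JX w x) = 0"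
    unfolding lie_bracket_swap[of ?JX w] using vfD(1)[OF lie_bracket_vf[OF reeb_field JX]] wT by (simp add: g_lin')
  then have "g x (w x) u = 0"
    unfolding u_def g_lin'(3)[OF wT JT[OF b1] b2] using g_w_J[OF b1] by simp
  then have "u = 0" using J_J[OF uT] Ju J_lin(5)[of x] by simp
  then have "J x (lie_bracket X w x) = lie_bracket ?JX w x" by (simp add: u_def)
  then show ?thesis
    unfolding lie_bracket_swap[of X w] lie_bracket_swap[of ?JX w]
    using vfD(1)[OF lie_bracket_vf[OF reeb_field X]] by (simp add: J_lin)
qed

text \<open>The Lie derivative along \<open>w\<close> annihilates \<open>\<alpha>\<close>, and it commutes with the exterior derivative by the
  Jacobi identity.\<close>

lemma reeb_preserves_ext_deriv:
  assumes X: "X \<in> vector_fields A" and Y: "Y \<in> vector_fields A"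
  shows "w x (\<lambda>y. g y (X y) (J y (Y y))) =
    g x (lie_bracket w X x) (J x (Y x)) + g x (X x) (J x (lie_bracket w Y x))"
proof -
  note W = reeb_field
  let ?a = "\<lambda>Z y. g y (w y) (Z y)"
  note wX = lie_bracket_vf[OF W X] and wY = lie_bracket_vf[OF W Y] and XY = lie_bracket_vf[OF X Y]
  note aX = aX_smooth[OF X] and aY = aX_smooth[OF Y]
  have awX: "?a (lie_bracket w X) = (\<lambda>y. w y (?a X))" and awY: "?a (lie_bracket w Y) = (\<lambda>y. w y (?a Y))"
    using reeb_bracket_alpha[OF X] reeb_bracket_alpha[OF Y] by (simp_all add: fun_eq_iff)
  have "w x (\<lambda>y. g y (X y) (J y (Y y))) = w x (\<lambda>y. X y (?a Y) - Y y (?a X) - ?a (lie_bracket X Y) y)"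
    by (simp only: ext_deriv_eq[OF X Y])
  also have "\<dots> = w x (\<lambda>y. X y (?a Y)) - w x (\<lambda>y. Y y (?a X)) - w x (?a (lie_bracket X Y))"
    unfolding tangent_diff[OF wT smooth_funs_diff[OF vfD(2)[OF X aY] vfD(2)[OF Y aX]] aX_smooth[OF XY]]
      tangent_diff[OF wT vfD(2)[OF X aY] vfD(2)[OF Y aX]] ..
  finally have 1: "w x (\<lambda>y. g y (X y) (J y (Y y))) =
    w x (\<lambda>y. X y (?a Y)) - w x (\<lambda>y. Y y (?a X)) - w x (?a (lie_bracket X Y))" .
  have 2: "g x (lie_bracket w X x) (J x (Y x)) =
      w x (\<lambda>y. X y (?a Y)) - X x (\<lambda>y. w y (?a Y)) - Y x (\<lambda>y. w y (?a X)) - ?a (lie_bracket (lie_bracket w X) Y) x"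
    unfolding ext_deriv_eq[OF wX Y] awX by (simp only: lie_bracket_def)
  have 3: "g x (X x) (J x (lie_bracket w Y x)) =
      X x (\<lambda>y. w y (?a Y)) - (w x (\<lambda>y. Y y (?a X)) - Y x (\<lambda>y. w y (?a X))) - ?a (lie_bracket X (lie_bracket w Y)) x"
    unfolding ext_deriv_eq[OF X wY] awY by (simp only: lie_bracket_def)
  have 4: "w x (?a (lie_bracket X Y)) = ?a (lie_bracket (lie_bracket w X) Y) x + ?a (lie_bracket X (lie_bracket w Y)) x"
    unfolding reeb_bracket_alpha[OF XY, symmetric] jacobi_identity[OF W X Y]
    by (rule g_lin'(1)[OF wT vfD(1)[OF lie_bracket_vf[OF wX Y]] vfD(1)[OF lie_bracket_vf[OF X wY]]])
  show ?thesis unfolding 1 2 3 4 by simp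
qed

subsection \<open>The Levi-Civita connection and the Reeb field\<close>

lemma nabla_conn: "affine_connection A nabla"
  using lc by (simp add: levi_civita_def)

lemma nabla_T: "v \<in> T x \<Longrightarrow> Y \<in> vector_fields A \<Longrightarrow> nabla x v Y \<in> T x"
  using nabla_conn unfolding affine_connection_def by blast

lemma nabla_torsion:
  "X \<in> vector_fields A \<Longrightarrow> Y \<in> vector_fields A \<Longrightarrow> nabla x (X x) Y - nabla x (Y x) X = lie_bracket X Y x"
  using lc unfolding levi_civita_def by blast

lemma nabla_metric:
  "Y \<in> vector_fields A \<Longrightarrow> Z \<in> vector_fields A \<Longrightarrow> v \<in> T x \<Longrightarrow>
    v (\<lambda>y. g y (Y y) (Z y)) = g x (nabla x v Y) (Z x) + g x (Y x) (nabla x v Z)"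
  using lc unfolding levi_civita_def by blast

lemma nabla_lin_on: "Y \<in> vector_fields A \<Longrightarrow> lin_on (T x) (\<lambda>v. nabla x v Y)"
  using nabla_conn unfolding affine_connection_def by blast

text \<open>The left-hand side is the Lie derivative of the metric along \<open>w\<close>. It vanishes on \<open>J v\<close>
  because the flow of \<open>w\<close> preserves both \<open>d \<alpha>\<close> and \<open>J\<close>, and on \<open>w\<close> itself, hence everywhere.\<close>

lemma reeb_killing:
  assumes u: "u \<in> T x" and v: "v \<in> T x"
  shows "g x (nabla x u w) v + g x u (nabla x v w) = 0"
proof -
  obtain X where X: "X \<in> vector_fields A" "X x = u" by (rule vector_field_extension[OF u])
  have lie: "w x (\<lambda>y. g y (X y) (Y y)) - g x (lie_bracket w X x) (Y x) - g x (X x) (lie_bracket w Y x)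
      = g x (nabla x u w) (Y x) + g x u (nabla x (Y x) w)" if Y: "Y \<in> vector_fields A" for Y
    unfolding nabla_metric[OF X(1) Y wT] nabla_torsion[OF reeb_field X(1), symmetric]
      nabla_torsion[OF reeb_field Y, symmetric]
    by (simp add: g_lin g_lin' vfD(1)[OF X(1)] vfD(1)[OF Y] nabla_T wT X(1) Y reeb_field X(2)[symmetric])
  have K: "g x (nabla x u w) (J x z) + g x u (nabla x (J x z) w) = 0" if z: "z \<in> T x" for z
  proof -
    obtain Z where Z: "Z \<in> vector_fields A" "Z x = z" by (rule vector_field_extension[OF z])
    show ?thesis
      using lie[OF J_vf[OF Z(1)]] reeb_preserves_ext_deriv[OF X(1) Z(1), of x]
      unfolding J_commutes_reeb_bracket[OF Z(1)] Z(2) by simp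
  qed
  have Kw: "g x (nabla x u w) (w x) + g x u (nabla x (w x) w) = 0"
  proof -
    have "g x u (lie_bracket w w x) = 0"
      using g_lin'(5)[OF u] by (simp add: lie_bracket_def zero_fun_def)
    moreover have "w x (\<lambda>y. g y (X y) (w y)) = g x (lie_bracket w X x) (w x)"
      using reeb_bracket_alpha[OF X(1), of x] metric_sym[OF wT vfD(1)[OF lie_bracket_vf[OF reeb_field X(1)]], of x]
        metric_sym[OF wT vfD(1)[OF X(1)]] by simp
    ultimately show ?thesis using lie[OF reeb_field] X(2) by simp
  qed
  let ?c = "g x (w x) v"
  have vv: "v = ?c *\<^sub>R w x + (- 1) *\<^sub>R J x (J x v)" using J_J[OF v] by simp
  have JJT: "J x (J x v) \<in> T x" by (intro JT v)
  note L = nabla_lin_on[OF reeb_field, of x]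
  have "nabla x v w = ?c *\<^sub>R nabla x (w x) w + (- 1) *\<^sub>R nabla x (J x (J x v)) w"
    by (subst vv, subst lin_onD(1)[OF L], (intro tangent_closed wT JJT)+,
        subst lin_onD(2)[OF L wT], subst lin_onD(2)[OF L JJT], rule refl)
  then have 1: "g x u (nabla x v w) = ?c * g x u (nabla x (w x) w) - g x u (nabla x (J x (J x v)) w)"
    using u by (simp add: g_lin' tangent_closed nabla_T wT JJT reeb_field)
  have "g x (nabla x u w) v = g x (nabla x u w) (?c *\<^sub>R w x + (- 1) *\<^sub>R J x (J x v))"
    using vv by simp
  also have "\<dots> = ?c * g x (nabla x u w) (w x) - g x (nabla x u w) (J x (J x v))"
    using nabla_T[OF u reeb_field] by (simp add: g_lin' tangent_closed wT JJT)
  finally have 2: "g x (nabla x u w) v = ?c * g x (nabla x u w) (w x) - g x (nabla x u w) (J x (J x v))" .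
  have "g x (nabla x u w) v + g x u (nabla x v w) =
      ?c * (g x (nabla x u w) (w x) + g x u (nabla x (w x) w))
      - (g x (nabla x u w) (J x (J x v)) + g x u (nabla x (J x (J x v)) w))"
    unfolding 1 2 by (simp add: algebra_simps)
  then show ?thesis using K[OF JT[OF v]] Kw by simp
qed

text \<open>The skew part of \<open>\<nabla>w\<close> is half of \<open>d\<alpha>\<close>, and its symmetric part vanishes because \<open>w\<close> is a Killing
  field.\<close>

lemma nabla_reeb:
  assumes u: "u \<in> T x" shows "nabla x u w = - (1/2) *\<^sub>R J x u"
proof (rule g_eqI[of _ x])
  show "nabla x u w \<in> T x" by (rule nabla_T[OF u reeb_field])
  show "- (1/2) *\<^sub>R J x u \<in> T x" by (intro tangent_closed JT u)
  fix v assume v: "v \<in> T x"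
  obtain X where X: "X \<in> vector_fields A" "X x = u" by (rule vector_field_extension[OF u])
  obtain Y where Y: "Y \<in> vector_fields A" "Y x = v" by (rule vector_field_extension[OF v])
  have "g x u (J x v) = X x (\<lambda>y. g y (w y) (Y y)) - Y x (\<lambda>y. g y (w y) (X y)) - g x (w x) (lie_bracket X Y x)"
    using ext_deriv_eq[OF X(1) Y(1), of x] X(2) Y(2) by simp
  also have "X x (\<lambda>y. g y (w y) (Y y)) - Y x (\<lambda>y. g y (w y) (X y)) - g x (w x) (lie_bracket X Y x)
      = g x (nabla x u w) v - g x (nabla x v w) u"
    unfolding nabla_metric[OF reeb_field Y(1) vfD(1)[OF X(1)]] nabla_metric[OF reeb_field X(1) vfD(1)[OF Y(1)]]
      nabla_torsion[OF X(1) Y(1), symmetric]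
    unfolding X(2) Y(2)
    by (simp add: g_lin' wT nabla_T u v X(1) Y(1))
  also have "g x (nabla x v w) u = g x u (nabla x v w)" by (rule metric_sym[OF nabla_T[OF v reeb_field] u])
  finally have "2 * g x (nabla x u w) v = - g x (J x u) v"
    using reeb_killing[OF u v] J_skew[OF u v] by simp
  then show "g x (nabla x u w) v = g x (- (1/2) *\<^sub>R J x u) v"
    using v u by (simp add: g_lin JT tangent_closed)
qed

subsection \<open>The Tanaka connection\<close>

abbreviation "D \<equiv> tanaka g J w nabla"

lemma D_T: "v \<in> T x \<Longrightarrow> Y \<in> vector_fields A \<Longrightarrow> D x v Y \<in> T x"
  unfolding tanaka_def by (intro tangent_closed nabla_T JT wT) (auto intro: vfD(1))

lemma D_vf:
  assumes X: "X \<in> vector_fields A" and Y: "Y \<in> vector_fields A"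
  shows "(\<lambda>x. D x (X x) Y) \<in> vector_fields A"
proof -
  have n: "(\<lambda>x. nabla x (X x) Y) \<in> vector_fields A"
    using nabla_conn X Y unfolding affine_connection_def by blast
  have s: "(\<lambda>x. 1/2 * g x (P x) (Q x)) \<in> smooth_funs A" if "P \<in> vector_fields A" "Q \<in> vector_fields A" for P Q
    by (rule smooth_funs_mult[OF smooth_funs_const metric_smooth[OF that]])
  show ?thesis unfolding tanaka_def
    by (rule vf_diff[OF vf_add[OF vf_add[OF n vf_scale[OF J_vf[OF Y] s[OF reeb_field X]]]
            vf_scale[OF J_vf[OF X] s[OF reeb_field Y]]] vf_scale[OF reeb_field s[OF J_vf[OF X] Y]]])
qed

lemma D_lin_on:
  assumes Y: "Y \<in> vector_fields A" shows "lin_on (T x) (\<lambda>v. D x v Y)"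
  unfolding lin_on_def
proof (intro conjI ballI allI)
  note L = nabla_lin_on[OF Y, of x] and YT = vfD(1)[OF Y, of x]
  fix u assume u: "u \<in> T x"
  show "D x (u + v) Y = D x u Y + D x v Y" if v: "v \<in> T x" for v
    unfolding tanaka_def lin_onD(1)[OF L u v] J_lin(1)[OF u v] g_lin'(1)[OF wT u v]
      g_lin(1)[OF YT JT[OF u] JT[OF v]]
    by (simp add: algebra_simps)
  show "D x (c *\<^sub>R u) Y = c *\<^sub>R D x u Y" for c
    unfolding tanaka_def lin_onD(2)[OF L u] J_lin(2)[OF u] g_lin'(2)[OF wT u] g_lin(2)[OF YT JT[OF u]]
    by (simp add: algebra_simps)
qed

lemma nabla_add:
  assumes "v \<in> T x" "Y \<in> vector_fields A" "Z \<in> vector_fields A"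
  shows "nabla x v (\<lambda>y. Y y + Z y) = nabla x v Y + nabla x v Z"
proof -
  have "nabla x v (Y + Z) = nabla x v Y + nabla x v Z"
    using nabla_conn assms unfolding affine_connection_def by blast
  then show ?thesis by (simp add: plus_fun_def)
qed

lemma nabla_scale:
  assumes "v \<in> T x" "Y \<in> vector_fields A" "f \<in> smooth_funs A"
  shows "nabla x v (\<lambda>y. f y *\<^sub>R Y y) = v f *\<^sub>R Y x + f x *\<^sub>R nabla x v Y"
  using nabla_conn assms unfolding affine_connection_def by blast

lemma D_add:
  assumes v: "v \<in> T x" and Y: "Y \<in> vector_fields A" and Z: "Z \<in> vector_fields A"
  shows "D x v (\<lambda>y. Y y + Z y) = D x v Y + D x v Z"
  unfolding tanaka_def nabla_add[OF assms] J_lin(1)[OF vfD(1)[OF Y] vfD(1)[OF Z]]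
    g_lin'(1)[OF wT vfD(1)[OF Y] vfD(1)[OF Z]] g_lin'(1)[OF JT[OF v] vfD(1)[OF Y] vfD(1)[OF Z]]
  by (simp add: algebra_simps)

lemma D_scale:
  assumes v: "v \<in> T x" and Y: "Y \<in> vector_fields A" and f: "f \<in> smooth_funs A"
  shows "D x v (\<lambda>y. f y *\<^sub>R Y y) = v f *\<^sub>R Y x + f x *\<^sub>R D x v Y"
  unfolding tanaka_def nabla_scale[OF assms] J_lin(2)[OF vfD(1)[OF Y]]
    g_lin'(2)[OF wT vfD(1)[OF Y]] g_lin'(2)[OF JT[OF v] vfD(1)[OF Y]]
  by (simp add: algebra_simps)

lemma D_minus:
  assumes v: "v \<in> T x" and Y: "Y \<in> vector_fields A"
  shows "D x v (\<lambda>y. - Y y) = - D x v Y"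
  using D_scale[OF v Y smooth_funs_const[of "-1"]] tangent_const[OF v] by simp

lemma D_metric:
  assumes Y: "Y \<in> vector_fields A" and Z: "Z \<in> vector_fields A" and v: "v \<in> T x"
  shows "v (\<lambda>y. g y (Y y) (Z y)) = g x (D x v Y) (Z x) + g x (Y x) (D x v Z)"
proof -
  have YT: "Y x \<in> T x" and ZT: "Z x \<in> T x" by (rule vfD(1)[OF Y], rule vfD(1)[OF Z])
  note t = JT[OF YT] JT[OF ZT] JT[OF v] YT ZT v wT[of x] nabla_T[OF v Y] nabla_T[OF v Z]
  show ?thesis
    unfolding nabla_metric[OF Y Z v] tanaka_def
    using J_skew[OF YT ZT] metric_sym[OF wT YT] metric_sym[OF YT JT[OF v]]
    by (simp add: g_lin g_lin' t tangent_closed algebra_simps)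
qed

lemma D_reeb: assumes v: "v \<in> T x" shows "D x v w = 0"
proof -
  have "g x (J x v) (w x) = 0" using g_w_J[OF v] metric_sym[OF JT[OF v] wT] by simp
  then show ?thesis unfolding tanaka_def nabla_reeb[OF v] J_reeb reeb_unit by simp
qed

lemma D_torsion:
  assumes X: "X \<in> vector_fields A" and Y: "Y \<in> vector_fields A"
  shows "D x (X x) Y - D x (Y x) X = lie_bracket X Y x + g x (X x) (J x (Y x)) *\<^sub>R w x"
proof -
  have XT: "X x \<in> T x" and YT: "Y x \<in> T x" by (rule vfD(1)[OF X], rule vfD(1)[OF Y])
  have e: "g x (J x (X x)) (Y x) = - g x (X x) (J x (Y x))" "g x (J x (Y x)) (X x) = g x (X x) (J x (Y x))"
    using J_skew[OF XT YT] metric_sym[OF JT[OF YT] XT] by auto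
  have "D x (X x) Y - D x (Y x) X = (nabla x (X x) Y - nabla x (Y x) X) + g x (X x) (J x (Y x)) *\<^sub>R w x"
    unfolding tanaka_def e by (simp add: algebra_simps flip: scaleR_add_left)
  then show ?thesis unfolding nabla_torsion[OF X Y] .
qed

definition horizontal_fields :: "'m vfield set" where
  "horizontal_fields = {X \<in> vector_fields A. \<forall>x. g x (w x) (X x) = 0}"

lemma horD: "X \<in> horizontal_fields \<Longrightarrow> X \<in> vector_fields A" "X \<in> horizontal_fields \<Longrightarrow> g x (w x) (X x) = 0" "X \<in> horizontal_fields \<Longrightarrow> X x \<in> T x"
  "X \<in> horizontal_fields \<Longrightarrow> g x (X x) (w x) = 0"
  using metric_sym[OF wT vfD(1), of X x] by (auto simp: horizontal_fields_def intro: vfD(1))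

lemma horI: "X \<in> vector_fields A \<Longrightarrow> (\<And>x. g x (w x) (X x) = 0) \<Longrightarrow> X \<in> horizontal_fields"
  by (simp add: horizontal_fields_def)

lemma J_hor: "X \<in> horizontal_fields \<Longrightarrow> (\<lambda>x. J x (X x)) \<in> horizontal_fields"
  by (rule horI[OF J_vf[OF horD(1)] g_w_J[OF horD(3)]])

lemma D_hor:
  assumes Y: "Y \<in> horizontal_fields" and v: "v \<in> T x" shows "g x (w x) (D x v Y) = 0"
  using D_metric[OF reeb_field horD(1)[OF Y] v] horD(2)[OF Y] tangent_const[OF v, of 0]
    D_reeb[OF v] g_lin(5)[OF horD(3)[OF Y]] by simp

lemma D_hor_field:
  assumes X: "X \<in> vector_fields A" and Y: "Y \<in> horizontal_fields" shows "(\<lambda>x. D x (X x) Y) \<in> horizontal_fields"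
  by (rule horI[OF D_vf[OF X horD(1)[OF Y]] D_hor[OF Y vfD(1)[OF X]]])

lemma JJ_hor: "X \<in> horizontal_fields \<Longrightarrow> J x (J x (X x)) = - X x"
  using J_J[OF horD(3)] horD(2) by simp

lemma J_iso_hor: "u \<in> T x \<Longrightarrow> X \<in> horizontal_fields \<Longrightarrow> g x (J x u) (J x (X x)) = g x u (X x)"
  using J_skew[of u x "J x (X x)"] JT[OF horD(3)] JJ_hor g_lin'(4)[OF _ horD(3)] by simp

lemma bracket_pairing:
  assumes X: "X \<in> horizontal_fields" and Y: "Y \<in> horizontal_fields" and Z: "Z \<in> horizontal_fields"
  shows "g x (lie_bracket X Y x) (Z x) = g x (D x (X x) Y) (Z x) - g x (D x (Y x) X) (Z x)"
proof -
  have "lie_bracket X Y x = D x (X x) Y - D x (Y x) X - g x (X x) (J x (Y x)) *\<^sub>R w x"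
    using D_torsion[OF horD(1)[OF X] horD(1)[OF Y], of x] by (simp add: algebra_simps)
  then show ?thesis
    using horD(3)[OF Z] D_T[OF horD(3)[OF X] horD(1)[OF Y]] D_T[OF horD(3)[OF Y] horD(1)[OF X]] horD(2)[OF Z] wT
    by (simp add: g_lin tangent_closed)
qed

text \<open>This is \<open>\<langle>(D\<^sub>X J) Y, Z\<rangle>\<close>, with \<open>J\<close> moved to \<open>Z\<close> in the second term by skewness.\<close>

definition dJ :: "'m vfield \<Rightarrow> 'm vfield \<Rightarrow> 'm vfield \<Rightarrow> 'm \<Rightarrow> real" where
  "dJ X Y Z x = g x (D x (X x) (\<lambda>y. J y (Y y))) (Z x) + g x (D x (X x) Y) (J x (Z x))"

lemma dJ_skew:
  assumes X: "X \<in> horizontal_fields" and Y: "Y \<in> horizontal_fields" and Z: "Z \<in> horizontal_fields"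
  shows "dJ X Z Y x = - dJ X Y Z x"
proof -
  note XT = horD(3)[OF X] and YT = horD(3)[OF Y] and ZT = horD(3)[OF Z]
  note DY = D_T[OF XT horD(1)[OF Y]] and DZ = D_T[OF XT horD(1)[OF Z]]
  have a: "(\<lambda>y. g y (J y (Y y)) (Z y)) = (\<lambda>y. (-1) * g y (Y y) (J y (Z y)))"
    using J_skew[OF YT ZT] by (simp add: fun_eq_iff)
  have "X x (\<lambda>y. g y (J y (Y y)) (Z y)) = (-1) * X x (\<lambda>y. g y (Y y) (J y (Z y)))"
    unfolding a by (rule tangentD(2)[OF XT metric_smooth[OF horD(1)[OF Y] J_vf[OF horD(1)[OF Z]]]])
  then show ?thesis
    unfolding D_metric[OF J_vf[OF horD(1)[OF Y]] horD(1)[OF Z] XT] D_metric[OF horD(1)[OF Y] J_vf[OF horD(1)[OF Z]] XT]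
      dJ_def
    using metric_sym[OF YT D_T[OF XT J_vf[OF horD(1)[OF Z]]], of x] metric_sym[OF JT[OF YT] DZ] by simp
qed

lemma dJ_J:
  assumes X: "X \<in> horizontal_fields" and Y: "Y \<in> horizontal_fields" and Z: "Z \<in> horizontal_fields"
  shows "dJ X (\<lambda>y. J y (Y y)) Z x = dJ X Y (\<lambda>y. J y (Z y)) x"
proof -
  note XT = horD(3)[OF X] and YT = horD(3)[OF Y] and ZT = horD(3)[OF Z]
  note DY = D_T[OF XT horD(1)[OF Y]]
  have "(\<lambda>y. J y (J y (Y y))) = (\<lambda>y. - Y y)" by (simp add: JJ_hor[OF Y])
  then show ?thesis unfolding dJ_def JJ_hor[OF Z]
    using DY ZT by (simp add: D_minus[OF XT horD(1)[OF Y]] g_lin g_lin')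
qed

text \<open>This is \<open>d (d\<alpha>) = 0\<close>. On horizontal fields \<open>d\<alpha>\<close> reduces to minus the Reeb component of the bracket,
  and the identity becomes the Jacobi identity.\<close>

lemma ext_deriv_closed:
  assumes X: "X \<in> horizontal_fields" and Y: "Y \<in> horizontal_fields" and Z: "Z \<in> horizontal_fields"
  shows "X x (\<lambda>y. g y (Y y) (J y (Z y))) + Y x (\<lambda>y. g y (Z y) (J y (X y))) + Z x (\<lambda>y. g y (X y) (J y (Y y)))
    = g x (lie_bracket X Y x) (J x (Z x)) + g x (lie_bracket Y Z x) (J x (X x)) + g x (lie_bracket Z X x) (J x (Y x))"
proof -
  let ?a = "\<lambda>V y. g y (w y) (V y)"
  have 0: "?a V = (\<lambda>y. 0)" if "V \<in> horizontal_fields" for V using horD(2)[OF that] by simp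
  have z: "V x (\<lambda>y. 0) = 0" if "V \<in> vector_fields A" for V by (rule tangent_const[OF vfD(1)[OF that]])
  have om: "g y (V y) (J y (W y)) = (-1) * ?a (lie_bracket V W) y" if V: "V \<in> horizontal_fields" and W: "W \<in> horizontal_fields" for V W y
    unfolding ext_deriv_eq[OF horD(1)[OF V] horD(1)[OF W]] 0[OF V] 0[OF W]
    using tangent_const[OF horD(3)[OF V]] tangent_const[OF horD(3)[OF W]] by simp
  have d: "U x (\<lambda>y. g y (V y) (J y (W y))) = - U x (?a (lie_bracket V W))"
    if U: "U \<in> horizontal_fields" and V: "V \<in> horizontal_fields" and W: "W \<in> horizontal_fields" for U V W
    unfolding om[OF V W]
    using tangentD(2)[OF horD(3)[OF U] aX_smooth[OF lie_bracket_vf[OF horD(1)[OF V] horD(1)[OF W]]], where c = "-1"] by simp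
  have b: "g x (lie_bracket U V x) (J x (W x)) = - W x (?a (lie_bracket U V)) - ?a (lie_bracket (lie_bracket U V) W) x"
    if U: "U \<in> horizontal_fields" and V: "V \<in> horizontal_fields" and W: "W \<in> horizontal_fields" for U V W
    unfolding ext_deriv_eq[OF lie_bracket_vf[OF horD(1)[OF U] horD(1)[OF V]] horD(1)[OF W]] 0[OF W]
    using z[OF lie_bracket_vf[OF horD(1)[OF U] horD(1)[OF V]]] by simp
  note X' = horD(1)[OF X] and Y' = horD(1)[OF Y] and Z' = horD(1)[OF Z]
  have "lie_bracket (lie_bracket X Y) Z x + lie_bracket (lie_bracket Y Z) X x + lie_bracket (lie_bracket Z X) Y x = 0"
  proof -
    have 1: "lie_bracket (lie_bracket Y Z) X x = - lie_bracket X (lie_bracket Y Z) x"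
      by (rule lie_bracket_swap)
    have "lie_bracket Y (lie_bracket X Z) x = - lie_bracket (lie_bracket X Z) Y x" by (rule lie_bracket_swap)
    moreover have "lie_bracket X Z = (\<lambda>y. - lie_bracket Z X y)" using lie_bracket_swap[of X Z] by blast
    moreover have "lie_bracket (\<lambda>y. - lie_bracket Z X y) Y x = - lie_bracket (lie_bracket Z X) Y x"
    proof
      fix f
      have "Y x (\<lambda>y. (-1) * lie_bracket Z X y f) = (-1) * Y x (\<lambda>y. lie_bracket Z X y f)" if "f \<in> smooth_funs A"
        by (rule tangentD(2)[OF vfD(1)[OF Y'] vfD(2)[OF lie_bracket_vf[OF Z' X'] that]])
      moreover have "lie_bracket Z X y f = 0" if "f \<notin> smooth_funs A" for y
        by (rule tangentD(4)[OF vfD(1)[OF lie_bracket_vf[OF Z' X']] that])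
      ultimately show "lie_bracket (\<lambda>y. - lie_bracket Z X y) Y x f = (- lie_bracket (lie_bracket Z X) Y x) f"
        unfolding lie_bracket_def[of _ Y] using tangent_const[OF vfD(1)[OF Y'], of x 0]
        by (cases "f \<in> smooth_funs A") (simp_all del: minus_apply)
    qed
    ultimately show ?thesis using jacobi_identity[OF X' Y' Z', of x] 1 by simp
  qed
  then have "g x (w x) (lie_bracket (lie_bracket X Y) Z x + lie_bracket (lie_bracket Y Z) X x + lie_bracket (lie_bracket Z X) Y x) = 0"
    using g_lin'(5)[OF wT] by simp
  then have "?a (lie_bracket (lie_bracket X Y) Z) x + ?a (lie_bracket (lie_bracket Y Z) X) x + ?a (lie_bracket (lie_bracket Z X) Y) x = 0"
    by (simp add: g_lin' wT tangent_closed vfD(1)[OF lie_bracket_vf] lie_bracket_vf X' Y' Z')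
  then show ?thesis
    unfolding d[OF X Y Z] d[OF Y Z X] d[OF Z X Y] b[OF X Y Z] b[OF Y Z X] b[OF Z X Y] by simp
qed

lemma dJ_cyclic:
  assumes X: "X \<in> horizontal_fields" and Y: "Y \<in> horizontal_fields" and Z: "Z \<in> horizontal_fields"
  shows "dJ X Y Z x + dJ Y Z X x + dJ Z X Y x = 0"
proof -
  have m: "U x (\<lambda>y. g y (V y) (J y (W y))) = g x (D x (U x) V) (J x (W x)) + g x (V x) (D x (U x) (\<lambda>y. J y (W y)))"
    if "U \<in> horizontal_fields" "V \<in> horizontal_fields" "W \<in> horizontal_fields" for U V W
    by (rule D_metric[OF horD(1)[OF that(2)] J_vf[OF horD(1)[OF that(3)]] horD(3)[OF that(1)]])
  have s: "g x (V x) (D x (U x) (\<lambda>y. J y (W y))) = g x (D x (U x) (\<lambda>y. J y (W y))) (V x)"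
    if "U \<in> horizontal_fields" "V \<in> horizontal_fields" "W \<in> horizontal_fields" for U V W
    by (rule metric_sym[OF horD(3)[OF that(2)] D_T[OF horD(3)[OF that(1)] J_vf[OF horD(1)[OF that(3)]]]])
  have "dJ X Z Y x + dJ Y X Z x + dJ Z Y X x = 0"
    using ext_deriv_closed[OF X Y Z, of x]
    unfolding m[OF X Y Z] m[OF Y Z X] m[OF Z X Y] s[OF X Y Z] s[OF Y Z X] s[OF Z X Y]
      bracket_pairing[OF X Y J_hor[OF Z]] bracket_pairing[OF Y Z J_hor[OF X]] bracket_pairing[OF Z X J_hor[OF Y]]
      dJ_def by simp
  then show ?thesis
    using dJ_skew[OF X Y Z, of x] dJ_skew[OF Y Z X, of x] dJ_skew[OF Z X Y, of x] by simp
qed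

lemma dJ_normal:
  assumes X: "X \<in> horizontal_fields" and Y: "Y \<in> horizontal_fields" and Z: "Z \<in> horizontal_fields"
  shows "dJ (\<lambda>y. J y (X y)) Y Z x - dJ (\<lambda>y. J y (Y y)) X Z x
    + dJ X Y (\<lambda>y. J y (Z y)) x - dJ Y X (\<lambda>y. J y (Z y)) x = 0"
proof -
  let ?JX = "\<lambda>y. J y (X y)" and ?JY = "\<lambda>y. J y (Y y)"
  note X' = horD(1)[OF X] and Y' = horD(1)[OF Y] and JX = J_hor[OF X] and JY = J_hor[OF Y]
  note ZT = horD(3)[OF Z, of x]
  note b = vfD(1)[OF lie_bracket_vf[OF X' Y'], of x] vfD(1)[OF lie_bracket_vf[OF horD(1)[OF JX] horD(1)[OF JY]], of x]
    vfD(1)[OF lie_bracket_vf[OF horD(1)[OF JX] Y'], of x] vfD(1)[OF lie_bracket_vf[OF X' horD(1)[OF JY]], of x]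
  have "g x (nijenhuis J X Y x + ext_deriv \<alpha> X Y x *\<^sub>R w x) (Z x) = 0"
    unfolding normality[OF X' Y'] by (rule g_lin(5)[OF ZT])
  then have "g x (J x (J x (lie_bracket X Y x))) (Z x) + g x (lie_bracket ?JX ?JY x) (Z x)
      - g x (J x (lie_bracket ?JX Y x)) (Z x) - g x (J x (lie_bracket X ?JY x)) (Z x) = 0"
    unfolding nijenhuis_def
    by (simp add: g_lin ZT b JT wT tangent_closed horD(2)[OF Z])
  moreover have "g x (J x (J x (lie_bracket X Y x))) (Z x) = - g x (lie_bracket X Y x) (Z x)"
    using J_skew[OF JT[OF b(1)] ZT] J_iso_hor[OF b(1) Z] by simp
  moreover have "g x (J x (lie_bracket ?JX Y x)) (Z x) = - g x (lie_bracket ?JX Y x) (J x (Z x))"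
    by (rule J_skew[OF b(3) ZT])
  moreover have "g x (J x (lie_bracket X ?JY x)) (Z x) = - g x (lie_bracket X ?JY x) (J x (Z x))"
    by (rule J_skew[OF b(4) ZT])
  ultimately have "- g x (lie_bracket X Y x) (Z x) + g x (lie_bracket ?JX ?JY x) (Z x)
      + g x (lie_bracket ?JX Y x) (J x (Z x)) + g x (lie_bracket X ?JY x) (J x (Z x)) = 0" by simp
  then have "- (g x (D x (X x) Y) (Z x) - g x (D x (Y x) X) (Z x))
      + (g x (D x (J x (X x)) ?JY) (Z x) - g x (D x (J x (Y x)) ?JX) (Z x))
      + (g x (D x (J x (X x)) Y) (J x (Z x)) - g x (D x (Y x) ?JX) (J x (Z x)))
      + (g x (D x (X x) ?JY) (J x (Z x)) - g x (D x (J x (Y x)) X) (J x (Z x))) = 0"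
    unfolding bracket_pairing[OF X Y Z] bracket_pairing[OF JX JY Z]
      bracket_pairing[OF JX Y J_hor[OF Z]] bracket_pairing[OF X JY J_hor[OF Z]] .
  then show ?thesis
    unfolding dJ_def JJ_hor[OF Z]
    by (simp add: g_lin' D_T[OF horD(3)[OF X] Y'] D_T[OF horD(3)[OF Y] X'] ZT)
qed

text \<open>As on a Kaehler manifold: the cyclic identity is used for \<open>X, Y, Z\<close> and for \<open>X, J Y, J Z\<close>, and
  normality turns the second instance into a second copy of \<open>- dJ X Y Z\<close>.\<close>

lemma J_parallel:
  assumes X: "X \<in> horizontal_fields" and Y: "Y \<in> horizontal_fields" and Z: "Z \<in> horizontal_fields"
  shows "dJ X Y Z x = 0"
proof -
  note JX = J_hor[OF X] and JY = J_hor[OF Y] and JZ = J_hor[OF Z]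
  have neg: "dJ U V (\<lambda>y. J y (J y (Q y))) x = - dJ U V Q x" if "U \<in> horizontal_fields" "V \<in> horizontal_fields" "Q \<in> horizontal_fields" for U V Q
    unfolding dJ_def JJ_hor[OF that(3)]
    by (simp add: g_lin' J_lin JT horD(3)[OF that(3)] D_T[OF horD(3)[OF that(1)] horD(1)[OF that(2)]]
        D_T[OF horD(3)[OF that(1)] J_vf[OF horD(1)[OF that(2)]]])
  have c1: "dJ X Y Z x + dJ Y Z X x + dJ Z X Y x = 0" by (rule dJ_cyclic[OF X Y Z])
  have c2: "dJ X (\<lambda>y. J y (Y y)) (\<lambda>y. J y (Z y)) x + dJ (\<lambda>y. J y (Y y)) (\<lambda>y. J y (Z y)) X x
      + dJ (\<lambda>y. J y (Z y)) X (\<lambda>y. J y (Y y)) x = 0"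
    by (rule dJ_cyclic[OF X JY JZ])
  have "dJ X (\<lambda>y. J y (Y y)) (\<lambda>y. J y (Z y)) x = - dJ X Y Z x"
    unfolding dJ_J[OF X Y JZ] by (rule neg[OF X Y Z])
  moreover have "dJ (\<lambda>y. J y (Y y)) (\<lambda>y. J y (Z y)) X x = dJ (\<lambda>y. J y (Y y)) Z (\<lambda>y. J y (X y)) x"
    by (rule dJ_J[OF JY Z X])
  moreover have "dJ (\<lambda>y. J y (Z y)) X (\<lambda>y. J y (Y y)) x = - dJ (\<lambda>y. J y (Z y)) Y (\<lambda>y. J y (X y)) x"
    unfolding dJ_J[OF JZ X Y, symmetric] by (rule dJ_skew[OF JZ Y JX])
  moreover have "dJ (\<lambda>y. J y (Y y)) Z (\<lambda>y. J y (X y)) x - dJ (\<lambda>y. J y (Z y)) Y (\<lambda>y. J y (X y)) x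
      - dJ Y Z X x + dJ Z Y X x = 0"
    using dJ_normal[OF Y Z JX, of x] unfolding neg[OF Y Z X] neg[OF Z Y X] by simp
  moreover have "dJ Z Y X x = - dJ Z X Y x" by (rule dJ_skew[OF Z X Y])
  ultimately show ?thesis using c1 c2 by linarith
qed

end


section \<open>Global frames of the contact distribution\<close>

locale framed_sasakian = sasakian_levi_civita A g n J w \<alpha> nabla
  for A :: "('m::{t2_space, second_countable_topology}, 'e::euclidean_space) atlas"
    and g n J w \<alpha> nabla +
  fixes I :: "'i set" and E :: "'i \<Rightarrow> 'm vfield"
  assumes fin: "finite I"
    and E_hor: "a \<in> I \<Longrightarrow> E a \<in> horizontal_fields"
    and frame: "u \<in> T x \<Longrightarrow> u = g x (w x) u *\<^sub>R w x + (\<Sum>a\<in>I. g x u (E a x) *\<^sub>R E a x)"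
begin

lemma E_vf: "a \<in> I \<Longrightarrow> E a \<in> vector_fields A" and ET: "a \<in> I \<Longrightarrow> E a x \<in> T x"
  and wE: "a \<in> I \<Longrightarrow> g x (w x) (E a x) = 0"
  using E_hor horD by blast+

lemma frame_hor: "u \<in> T x \<Longrightarrow> g x (w x) u = 0 \<Longrightarrow> u = (\<Sum>a\<in>I. g x u (E a x) *\<^sub>R E a x)"
  using frame[of u x] by simp

lemma g_frame_sum:
  assumes "v \<in> T x"
  shows "g x (\<Sum>a\<in>I. c a *\<^sub>R E a x) v = (\<Sum>a\<in>I. c a * g x (E a x) v)"
    and "g x v (\<Sum>a\<in>I. c a *\<^sub>R E a x) = (\<Sum>a\<in>I. c a * g x v (E a x))"
  by (rule g_sum(1)[OF assms] g_sum(2)[OF assms], rule ET, assumption)+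

lemma expand_hor:
  fixes \<beta> :: "'m tvec \<Rightarrow> real"
  assumes "u \<in> T x" "g x (w x) u = 0" and L: "lin_on (T x) \<beta>"
  shows "\<beta> u = (\<Sum>a\<in>I. g x u (E a x) * \<beta> (E a x))"
proof -
  have "\<beta> u = \<beta> (\<Sum>a\<in>I. g x u (E a x) *\<^sub>R E a x)" using frame_hor[OF assms(1,2)] by (rule arg_cong)
  then show ?thesis using lin_on_sum[OF L subspace_tangent, of I "\<lambda>a. E a x"] ET by simp
qed

lemma contact_dist_subspace: "subspace (contact_dist A \<alpha> x)" "contact_dist A \<alpha> x \<subseteq> T x"
  unfolding contact_dist_eq by (auto simp: subspace_def tangent_closed g_lin' wT)

lemma contact_tight: "tight_frame (g x) (contact_dist A \<alpha> x) I (\<lambda>a. E a x)"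
  unfolding tight_frame_def contact_dist_eq using fin ET wE frame_hor by blast

text \<open>The index \<open>None\<close> stands for the Reeb field, which completes the frame to one of the whole tangent
  space.\<close>

definition full_index :: "'i option set" where "full_index = insert None (Some ` I)"

definition full_frame :: "'i option \<Rightarrow> 'm vfield" where "full_frame k = (case k of None \<Rightarrow> w | Some a \<Rightarrow> E a)"

lemma full_frame_simps [simp]: "full_frame None = w" "full_frame (Some a) = E a" by (simp_all add: full_frame_def)

lemma full_index_sum: "(\<Sum>k\<in>full_index. h k) = h None + (\<Sum>a\<in>I. h (Some a))"
  unfolding full_index_def using fin by (simp add: sum.reindex)

lemma finite_full_index: "finite full_index" using fin by (simp add: full_index_def)

lemma full_frame_vf: "k \<in> full_index \<Longrightarrow> full_frame k \<in> vector_fields A"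
  using E_vf reeb_field by (auto simp: full_index_def)

lemma full_frame_tangent: "k \<in> full_index \<Longrightarrow> full_frame k x \<in> T x" by (rule vfD(1)[OF full_frame_vf])

lemma full_frame_expand: "u \<in> T x \<Longrightarrow> u = (\<Sum>k\<in>full_index. g x u (full_frame k x) *\<^sub>R full_frame k x)"
  using frame[of u x] metric_sym[OF wT, of u x] by (simp add: full_index_sum)

lemma tangent_tight: "tight_frame (g x) (T x) full_index (\<lambda>k. full_frame k x)"
  unfolding tight_frame_def using finite_full_index full_frame_tangent full_frame_expand by blast

text \<open>The sum of the squared lengths of a tight frame is the dimension of the space, here \<open>2 n + 1\<close>
  together with the Reeb field.\<close>

lemma frame_norm_sum: "(\<Sum>a\<in>I. g x (E a x) (E a x)) = 2 * real n"
  using tight_frame_norm_sum[OF tangent_tight subspace_tangent order_refl, of x] dim_tangent_space[of x] dim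
  by (simp add: full_index_sum reeb_unit)

lemma tangent_expand:
  fixes \<beta> :: "'m tvec \<Rightarrow> 'm tvec"
  assumes "u \<in> T x" and L: "lin_on (T x) \<beta>"
  shows "\<beta> u = (\<Sum>k\<in>full_index. g x u (full_frame k x) *\<^sub>R \<beta> (full_frame k x))"
proof -
  have "\<beta> u = \<beta> (\<Sum>k\<in>full_index. g x u (full_frame k x) *\<^sub>R full_frame k x)" using full_frame_expand[OF assms(1)] by (rule arg_cong)
  then show ?thesis using lin_on_sum[OF L subspace_tangent, of full_index "\<lambda>k. full_frame k x"] full_frame_tangent by simp
qed

subsection \<open>The curvature of the Tanaka connection is a tensor\<close>

lemma D_zero: "Y \<in> vector_fields A \<Longrightarrow> D x 0 Y = 0"
  using lin_onD(2)[OF D_lin_on[of Y x] tangent_closed(1), of 0] by simp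

lemma D_zero_field: "v \<in> T x \<Longrightarrow> D x v (\<lambda>y. 0) = 0"
proof -
  assume v: "v \<in> T x"
  have "D x v (\<lambda>y. 0 *\<^sub>R w y) = v (\<lambda>y. 0) *\<^sub>R w x + 0 *\<^sub>R D x v w"
    by (rule D_scale[OF v reeb_field smooth_funs_const])
  moreover have "(\<lambda>y. 0 *\<^sub>R w y) = (\<lambda>y. 0)" by (rule ext) (rule scaleR_zero_left)
  ultimately have "D x v (\<lambda>y. 0) = v (\<lambda>y. 0) *\<^sub>R w x + 0 *\<^sub>R D x v w" by (rule subst[rotated])
  also have "\<dots> = 0" unfolding tangent_const[OF v] scaleR_zero_left by (rule add_0_left)
  finally show ?thesis .
qed

lemma D_sum:
  assumes v: "v \<in> T x" and "finite S" "\<And>k. k \<in> S \<Longrightarrow> c k \<in> smooth_funs A" "\<And>k. k \<in> S \<Longrightarrow> G k \<in> vector_fields A"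
  shows "D x v (\<lambda>y. \<Sum>k\<in>S. c k y *\<^sub>R G k y) = (\<Sum>k\<in>S. v (c k) *\<^sub>R G k x + c k x *\<^sub>R D x v (G k))"
  using assms(2-)
proof (induction S rule: finite_induct)
  case empty show ?case unfolding sum.empty by (rule D_zero_field[OF v])
next
  case (insert k S)
  have 1: "(\<lambda>y. c k y *\<^sub>R G k y) \<in> vector_fields A" using insert.prems by (intro vf_scale) auto
  have 2: "(\<lambda>y. \<Sum>k\<in>S. c k y *\<^sub>R G k y) \<in> vector_fields A" using insert.prems by (intro vf_sum vf_scale) auto
  have "D x v (\<lambda>y. \<Sum>k\<in>insert k S. c k y *\<^sub>R G k y) = D x v (\<lambda>y. c k y *\<^sub>R G k y + (\<Sum>k\<in>S. c k y *\<^sub>R G k y))"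
    using insert.hyps by simp
  also have "\<dots> = D x v (\<lambda>y. c k y *\<^sub>R G k y) + D x v (\<lambda>y. \<Sum>k\<in>S. c k y *\<^sub>R G k y)"
    by (rule D_add[OF v 1 2])
  also have "D x v (\<lambda>y. c k y *\<^sub>R G k y) = v (c k) *\<^sub>R G k x + c k x *\<^sub>R D x v (G k)"
    by (rule D_scale[OF v]) (use insert.prems in auto)
  finally show ?case using insert by simp
qed

definition R :: "'m vfield \<Rightarrow> 'm vfield \<Rightarrow> 'm vfield \<Rightarrow> 'm \<Rightarrow> 'm tvec" where
  "R X Y Z x = curvature D X Y Z x"

lemma R_eq: "R X Y Z x = D x (X x) (\<lambda>y. D y (Y y) Z) - D x (Y x) (\<lambda>y. D y (X y) Z) - D x (lie_bracket X Y x) Z"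
  by (simp add: R_def curvature_def)

lemma R_T: "X \<in> vector_fields A \<Longrightarrow> Y \<in> vector_fields A \<Longrightarrow> Z \<in> vector_fields A \<Longrightarrow> R X Y Z x \<in> T x"
  unfolding R_eq by (intro tangent_closed D_T D_vf) (auto intro: vfD(1) lie_bracket_vf)

lemma R_swap:
  assumes X: "X \<in> vector_fields A" and Y: "Y \<in> vector_fields A" and Z: "Z \<in> vector_fields A"
  shows "R Y X Z x = - R X Y Z x"
proof -
  have "D x (- 1 *\<^sub>R lie_bracket X Y x) Z = - 1 *\<^sub>R D x (lie_bracket X Y x) Z"
    by (rule lin_onD(2)[OF D_lin_on[OF Z] vfD(1)[OF lie_bracket_vf[OF X Y]]])
  then show ?thesis unfolding R_eq lie_bracket_swap[of Y X] by simp
qed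

lemma lie_bracket_add:
  assumes X: "X \<in> vector_fields A" and X': "X' \<in> vector_fields A" and Y: "Y \<in> vector_fields A"
  shows "lie_bracket (\<lambda>y. X y + X' y) Y x = lie_bracket X Y x + lie_bracket X' Y x"
proof (rule tangent_eqI[of _ x])
  show "lie_bracket (\<lambda>y. X y + X' y) Y x \<in> T x" by (rule vfD(1)[OF lie_bracket_vf[OF vf_add[OF X X'] Y]])
  show "lie_bracket X Y x + lie_bracket X' Y x \<in> T x"
    by (intro tangent_closed vfD(1)[OF lie_bracket_vf[OF X Y]] vfD(1)[OF lie_bracket_vf[OF X' Y]])
  fix h assume h: "h \<in> smooth_funs A"
  have "Y x (\<lambda>y. (X y + X' y) h) = Y x (\<lambda>y. X y h) + Y x (\<lambda>y. X' y h)"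
    unfolding plus_fun_def by (rule tangentD(1)[OF vfD(1)[OF Y] vfD(2)[OF X h] vfD(2)[OF X' h]])
  then show "lie_bracket (\<lambda>y. X y + X' y) Y x h = (lie_bracket X Y x + lie_bracket X' Y x) h"
    by (simp add: lie_bracket_def)
qed

lemma R_add1:
  assumes X: "X \<in> vector_fields A" and X': "X' \<in> vector_fields A" and Y: "Y \<in> vector_fields A" and Z: "Z \<in> vector_fields A"
  shows "R (\<lambda>y. X y + X' y) Y Z x = R X Y Z x + R X' Y Z x"
proof -
  note L = lin_onD(1)[OF D_lin_on]
  have 1: "D x (X x + X' x) (\<lambda>y. D y (Y y) Z) = D x (X x) (\<lambda>y. D y (Y y) Z) + D x (X' x) (\<lambda>y. D y (Y y) Z)"
    by (rule L[OF D_vf[OF Y Z] vfD(1)[OF X] vfD(1)[OF X']])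
  have 2: "(\<lambda>y. D y (X y + X' y) Z) = (\<lambda>y. D y (X y) Z + D y (X' y) Z)"
    by (rule ext) (rule L[OF Z vfD(1)[OF X] vfD(1)[OF X']])
  have 3: "D x (lie_bracket X Y x + lie_bracket X' Y x) Z = D x (lie_bracket X Y x) Z + D x (lie_bracket X' Y x) Z"
    by (rule L[OF Z vfD(1)[OF lie_bracket_vf[OF X Y]] vfD(1)[OF lie_bracket_vf[OF X' Y]]])
  show ?thesis unfolding R_eq lie_bracket_add[OF X X' Y] 1 2 3 D_add[OF vfD(1)[OF Y] D_vf[OF X Z] D_vf[OF X' Z]]
    by (simp add: algebra_simps)
qed

lemma R_add3:
  assumes X: "X \<in> vector_fields A" and Y: "Y \<in> vector_fields A" and Z: "Z \<in> vector_fields A" and Z': "Z' \<in> vector_fields A"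
  shows "R X Y (\<lambda>y. Z y + Z' y) x = R X Y Z x + R X Y Z' x"
proof -
  have 1: "(\<lambda>y. D y (V y) (\<lambda>y. Z y + Z' y)) = (\<lambda>y. D y (V y) Z + D y (V y) Z')" if "V \<in> vector_fields A" for V
    by (rule ext) (rule D_add[OF vfD(1)[OF that] Z Z'])
  show ?thesis unfolding R_eq 1[OF X] 1[OF Y] D_add[OF vfD(1)[OF X] D_vf[OF Y Z] D_vf[OF Y Z']]
      D_add[OF vfD(1)[OF Y] D_vf[OF X Z] D_vf[OF X Z']] D_add[OF vfD(1)[OF lie_bracket_vf[OF X Y]] Z Z']
    by (simp add: algebra_simps)
qed

text \<open>In the frame expansion of \<open>X\<close> the coefficients vanish at \<open>x\<close>. Only their first derivatives along \<open>Y\<close>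
  remain, and these cancel between the second covariant derivative and the bracket.\<close>

lemma R_vanish1:
  assumes X: "X \<in> vector_fields A" and Y: "Y \<in> vector_fields A" and Z: "Z \<in> vector_fields A" and X0: "X x = 0"
  shows "R X Y Z x = 0"
proof -
  define c where "c k y = g y (X y) (full_frame k y)" for k y
  have c: "c k \<in> smooth_funs A" if "k \<in> full_index" for k unfolding c_def[abs_def] by (rule metric_smooth[OF X full_frame_vf[OF that]])
  have c0: "c k x = 0" if "k \<in> full_index" for k unfolding c_def X0 by (rule g_lin(5)[OF full_frame_tangent[OF that]])
  have DF: "(\<lambda>y. D y (full_frame k y) Z) \<in> vector_fields A" if "k \<in> full_index" for k by (rule D_vf[OF full_frame_vf[OF that] Z])
  have rep: "X y = (\<Sum>k\<in>full_index. c k y *\<^sub>R full_frame k y)" for y unfolding c_def by (rule full_frame_expand[OF vfD(1)[OF X]])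
  have repD: "(\<lambda>y. D y (X y) Z) = (\<lambda>y. \<Sum>k\<in>full_index. c k y *\<^sub>R D y (full_frame k y) Z)"
    unfolding c_def by (rule ext) (rule tangent_expand[OF vfD(1)[OF X] D_lin_on[OF Z]])
  have "D x (Y x) (\<lambda>y. D y (X y) Z) = (\<Sum>k\<in>full_index. Y x (c k) *\<^sub>R D x (full_frame k x) Z + c k x *\<^sub>R D x (Y x) (\<lambda>y. D y (full_frame k y) Z))"
    unfolding repD by (rule D_sum[OF vfD(1)[OF Y] finite_full_index c DF])
  also have "\<dots> = (\<Sum>k\<in>full_index. Y x (c k) *\<^sub>R D x (full_frame k x) Z)"
    by (rule sum.cong[OF refl]) (simp add: c0)
  finally have 1: "D x (Y x) (\<lambda>y. D y (X y) Z) = (\<Sum>k\<in>full_index. Y x (c k) *\<^sub>R D x (full_frame k x) Z)" .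
  have 2: "lie_bracket X Y x = (\<Sum>k\<in>full_index. (- Y x (c k)) *\<^sub>R full_frame k x)"
  proof (rule tangent_eqI[of _ x])
    show "lie_bracket X Y x \<in> T x" by (rule vfD(1)[OF lie_bracket_vf[OF X Y]])
    show "(\<Sum>k\<in>full_index. (- Y x (c k)) *\<^sub>R full_frame k x) \<in> T x" by (intro tangent_closed full_frame_tangent)
    fix h assume h: "h \<in> smooth_funs A"
    have Fh: "(\<lambda>y. full_frame k y h) \<in> smooth_funs A" if "k \<in> full_index" for k by (rule vfD(2)[OF full_frame_vf[OF that] h])
    have "(\<lambda>y. X y h) = (\<lambda>y. \<Sum>k\<in>full_index. c k y * full_frame k y h)"
      unfolding rep sum_tvec_apply scaleR_fun_def real_scaleR_def ..
    then have "Y x (\<lambda>y. X y h) = Y x (\<lambda>y. \<Sum>k\<in>full_index. c k y * full_frame k y h)" by (rule arg_cong)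
    also have "\<dots> = (\<Sum>k\<in>full_index. Y x (\<lambda>y. c k y * full_frame k y h))"
      by (rule tangent_sum[OF vfD(1)[OF Y]]) (rule smooth_funs_mult[OF c Fh])
    also have "\<dots> = (\<Sum>k\<in>full_index. Y x (c k) * full_frame k x h)"
    proof (rule sum.cong[OF refl])
      fix k assume k: "k \<in> full_index"
      show "Y x (\<lambda>y. c k y * full_frame k y h) = Y x (c k) * full_frame k x h"
        unfolding tangentD(3)[OF vfD(1)[OF Y] c[OF k] Fh[OF k]] c0[OF k] by simp
    qed
    finally show "lie_bracket X Y x h = (\<Sum>k\<in>full_index. (- Y x (c k)) *\<^sub>R full_frame k x) h"
      unfolding lie_bracket_def X0 sum_tvec_apply scaleR_fun_def real_scaleR_def
      by (simp add: sum_negf)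
  qed
  have "D x (lie_bracket X Y x) Z = (\<Sum>k\<in>full_index. (- Y x (c k)) *\<^sub>R D x (full_frame k x) Z)"
    unfolding 2 by (rule lin_on_sum[OF D_lin_on[OF Z] subspace_tangent full_frame_tangent])
  then show ?thesis unfolding R_eq 1 X0 D_zero[OF D_vf[OF Y Z]] by (simp add: sum_negf)
qed

text \<open>For a field with frame coefficients \<open>c k\<close> that vanish at \<open>x\<close>, the first derivatives of \<open>c k\<close> cancel by
  symmetry and the second ones against the bracket term.\<close>

lemma R_vanish3:
  assumes X: "X \<in> vector_fields A" and Y: "Y \<in> vector_fields A" and Z: "Z \<in> vector_fields A" and Z0: "Z x = 0"
  shows "R X Y Z x = 0"
proof -
  define c where "c k y = g y (Z y) (full_frame k y)" for k y
  have c: "c k \<in> smooth_funs A" if "k \<in> full_index" for k unfolding c_def[abs_def] by (rule metric_smooth[OF Z full_frame_vf[OF that]])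
  have c0: "c k x = 0" if "k \<in> full_index" for k unfolding c_def Z0 by (rule g_lin(5)[OF full_frame_tangent[OF that]])
  have rep: "Z = (\<lambda>y. \<Sum>k\<in>full_index. c k y *\<^sub>R full_frame k y)" unfolding c_def by (rule ext) (rule full_frame_expand[OF vfD(1)[OF Z]])
  have first: "D y v Z = (\<Sum>k\<in>full_index. v (c k) *\<^sub>R full_frame k y + c k y *\<^sub>R D y v (full_frame k))" if "v \<in> T y" for y v
    by (subst rep) (rule D_sum[OF that finite_full_index c full_frame_vf])
  have second: "D x (U x) (\<lambda>y. D y (V y) Z) =
      (\<Sum>k\<in>full_index. U x (\<lambda>y. V y (c k)) *\<^sub>R full_frame k x + V x (c k) *\<^sub>R D x (U x) (full_frame k) + U x (c k) *\<^sub>R D x (V x) (full_frame k))"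
    if U: "U \<in> vector_fields A" and V: "V \<in> vector_fields A" for U V
  proof -
    have f: "(\<lambda>y. \<Sum>k\<in>full_index. V y (c k) *\<^sub>R full_frame k y) \<in> vector_fields A"
      by (rule vf_sum) (rule vf_scale[OF full_frame_vf vfD(2)[OF V c]])
    have f': "(\<lambda>y. \<Sum>k\<in>full_index. c k y *\<^sub>R D y (V y) (full_frame k)) \<in> vector_fields A"
      by (rule vf_sum) (rule vf_scale[OF D_vf[OF V full_frame_vf] c])
    have "(\<lambda>y. D y (V y) Z) = (\<lambda>y. (\<Sum>k\<in>full_index. V y (c k) *\<^sub>R full_frame k y) + (\<Sum>k\<in>full_index. c k y *\<^sub>R D y (V y) (full_frame k)))"
      by (rule ext) (simp only: first[OF vfD(1)[OF V]] sum.distrib)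
    then have 1: "D x (U x) (\<lambda>y. D y (V y) Z) = D x (U x) (\<lambda>y. \<Sum>k\<in>full_index. V y (c k) *\<^sub>R full_frame k y)
        + D x (U x) (\<lambda>y. \<Sum>k\<in>full_index. c k y *\<^sub>R D y (V y) (full_frame k))"
      by (simp only: D_add[OF vfD(1)[OF U] f f'])
    have 2: "D x (U x) (\<lambda>y. \<Sum>k\<in>full_index. V y (c k) *\<^sub>R full_frame k y) =
        (\<Sum>k\<in>full_index. U x (\<lambda>y. V y (c k)) *\<^sub>R full_frame k x + V x (c k) *\<^sub>R D x (U x) (full_frame k))"
      by (rule D_sum[OF vfD(1)[OF U] finite_full_index, where c = "\<lambda>k y. V y (c k)" and G = full_frame])
        (rule vfD(2)[OF V c] full_frame_vf, assumption)+
    have 3: "D x (U x) (\<lambda>y. \<Sum>k\<in>full_index. c k y *\<^sub>R D y (V y) (full_frame k)) =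
        (\<Sum>k\<in>full_index. U x (c k) *\<^sub>R D x (V x) (full_frame k) + c k x *\<^sub>R D x (U x) (\<lambda>y. D y (V y) (full_frame k)))"
      by (rule D_sum[OF vfD(1)[OF U] finite_full_index, where c = c and G = "\<lambda>k y. D y (V y) (full_frame k)"])
        (rule c D_vf[OF V full_frame_vf], assumption)+
    have 4: "(\<Sum>k\<in>full_index. U x (c k) *\<^sub>R D x (V x) (full_frame k) + c k x *\<^sub>R D x (U x) (\<lambda>y. D y (V y) (full_frame k))) =
        (\<Sum>k\<in>full_index. U x (c k) *\<^sub>R D x (V x) (full_frame k))"
      by (rule sum.cong[OF refl]) (simp add: c0)
    show ?thesis unfolding 1 2 3 4 by (simp only: sum.distrib)
  qed
  have third: "D x (lie_bracket X Y x) Z = (\<Sum>k\<in>full_index. (X x (\<lambda>y. Y y (c k)) - Y x (\<lambda>y. X y (c k))) *\<^sub>R full_frame k x)"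
    unfolding first[OF vfD(1)[OF lie_bracket_vf[OF X Y]]]
    by (rule sum.cong[OF refl]) (simp add: c0 lie_bracket_def)
  show ?thesis unfolding R_eq second[OF X Y] second[OF Y X] third
    by (simp add: sum.distrib sum_subtractf algebra_simps)
qed

lemma R_tensor:
  assumes V: "X \<in> vector_fields A" "Y \<in> vector_fields A" "Z \<in> vector_fields A"
    "X' \<in> vector_fields A" "Y' \<in> vector_fields A" "Z' \<in> vector_fields A"
    and eq: "X x = X' x" "Y x = Y' x" "Z x = Z' x"
  shows "R X Y Z x = R X' Y' Z' x"
proof -
  have 1: "R P Q S x = R P' Q S x" if P: "P \<in> vector_fields A" "P' \<in> vector_fields A" "Q \<in> vector_fields A" "S \<in> vector_fields A"
    and e: "P x = P' x" for P P' Q S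
  proof -
    have d: "(\<lambda>y. P y - P' y) \<in> vector_fields A" by (rule vf_diff[OF P(1,2)])
    have "R (\<lambda>y. P' y + (P y - P' y)) Q S x = R P' Q S x + R (\<lambda>y. P y - P' y) Q S x"
      by (rule R_add1[OF P(2) d P(3,4)])
    moreover have "R (\<lambda>y. P y - P' y) Q S x = 0" by (rule R_vanish1[OF d P(3,4)]) (simp add: e)
    moreover have "(\<lambda>y. P' y + (P y - P' y)) = P" by (rule ext) simp
    ultimately show ?thesis by simp
  qed
  have 3: "R P Q S x = R P Q S' x" if P: "P \<in> vector_fields A" "Q \<in> vector_fields A" "S \<in> vector_fields A" "S' \<in> vector_fields A"
    and e: "S x = S' x" for P Q S S'
  proof -
    have d: "(\<lambda>y. S y - S' y) \<in> vector_fields A" by (rule vf_diff[OF P(3,4)])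
    have "R P Q (\<lambda>y. S' y + (S y - S' y)) x = R P Q S' x + R P Q (\<lambda>y. S y - S' y) x"
      by (rule R_add3[OF P(1,2,4) d])
    moreover have "R P Q (\<lambda>y. S y - S' y) x = 0" by (rule R_vanish3[OF P(1,2) d]) (simp add: e)
    moreover have "(\<lambda>y. S' y + (S y - S' y)) = S" by (rule ext) simp
    ultimately show ?thesis by simp
  qed
  have "R X Y Z x = R X' Y Z x" by (rule 1[OF V(1,4,2,3) eq(1)])
  also have "\<dots> = - R Y X' Z x" by (rule R_swap[OF V(2,4,3)])
  also have "R Y X' Z x = R Y' X' Z x" by (rule 1[OF V(2,5,4,3) eq(2)])
  also have "- R Y' X' Z x = R X' Y' Z x" by (rule R_swap[OF V(5,4,3), symmetric])
  also have "\<dots> = R X' Y' Z' x" by (rule 3[OF V(4,5,3,6) eq(3)])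
  finally show ?thesis .
qed

lemma extend_vf:
  assumes "v \<in> T x" shows "extend A x v \<in> vector_fields A \<and> extend A x v x = v"
proof -
  obtain X where "X \<in> vector_fields A" "X x = v" by (rule vector_field_extension[OF assms])
  then have "X \<in> vector_fields A \<and> X x = v" by (rule conjI)
  then show ?thesis unfolding extend_def
    by (rule someI[of "\<lambda>X. X \<in> vector_fields A \<and> X x = v" X])
qed

lemma curvature_at_eq:
  assumes X: "X \<in> vector_fields A" and Y: "Y \<in> vector_fields A" and Z: "Z \<in> vector_fields A"
  shows "curvature_at A D x (X x) (Y x) (Z x) = R X Y Z x"
  unfolding curvature_at_def R_def[symmetric]
  using extend_vf[OF vfD(1)[OF X, of x]] extend_vf[OF vfD(1)[OF Y, of x]] extend_vf[OF vfD(1)[OF Z, of x]]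
  by (intro R_tensor X Y Z) simp_all

text \<open>The Reeb direction does not contribute to the trace, because the connection preserves horizontal
  fields.\<close>

lemma ricci_eq:
  assumes Z: "Z \<in> horizontal_fields" shows "ricci A g D x (Z x) = (\<Sum>a\<in>I. g x (R (E a) Z Z x) (E a x))"
proof -
  note Z' = horD(1)[OF Z]
  let ?\<beta> = "\<lambda>u u'. g x (curvature_at A D x u (Z x) (Z x)) u'"
  have ca: "curvature_at A D x u (Z x) (Z x) = R (extend A x u) Z Z x" if "u \<in> T x" for u
    using curvature_at_eq[of "extend A x u" Z Z x] extend_vf[OF that] Z' by simp
  have caT: "curvature_at A D x u (Z x) (Z x) \<in> T x" if "u \<in> T x" for u
    unfolding ca[OF that] using extend_vf[OF that] Z' by (intro R_T) auto
  have add: "curvature_at A D x (u + v) (Z x) (Z x) = curvature_at A D x u (Z x) (Z x) + curvature_at A D x v (Z x) (Z x)"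
    if u: "u \<in> T x" and v: "v \<in> T x" for u v
  proof -
    note eu = extend_vf[OF u] and ev = extend_vf[OF v]
    have "curvature_at A D x (u + v) (Z x) (Z x) = R (\<lambda>y. extend A x u y + extend A x v y) Z Z x"
      using curvature_at_eq[OF vf_add[OF conjunct1[OF eu] conjunct1[OF ev]] Z' Z', of x]
      by (simp only: conjunct2[OF eu] conjunct2[OF ev])
    then show ?thesis
      by (simp only: ca[OF u] ca[OF v] R_add1[OF conjunct1[OF eu] conjunct1[OF ev] Z' Z'])
  qed
  have scale: "curvature_at A D x (c *\<^sub>R u) (Z x) (Z x) = c *\<^sub>R curvature_at A D x u (Z x) (Z x)"
    if u: "u \<in> T x" for c u
  proof -
    note eu = extend_vf[OF u]
    let ?U = "extend A x u"
    have U: "?U \<in> vector_fields A" and Ux: "?U x = u" using eu by auto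
    have "curvature_at A D x (c *\<^sub>R u) (Z x) (Z x) = R (\<lambda>y. c *\<^sub>R ?U y) Z Z x"
      using curvature_at_eq[OF vf_cscale[OF U, of c] Z' Z', of x] by (simp only: Ux)
    also have "\<dots> = c *\<^sub>R R ?U Z Z x"
    proof -
      have 1: "D x (c *\<^sub>R ?U x) (\<lambda>y. D y (Z y) Z) = c *\<^sub>R D x (?U x) (\<lambda>y. D y (Z y) Z)"
        by (rule lin_onD(2)[OF D_lin_on[OF D_vf[OF Z' Z']] vfD(1)[OF U]])
      have 2: "(\<lambda>y. D y (c *\<^sub>R ?U y) Z) = (\<lambda>y. c *\<^sub>R D y (?U y) Z)"
        by (rule ext) (rule lin_onD(2)[OF D_lin_on[OF Z'] vfD(1)[OF U]])
      have 3: "D x (Z x) (\<lambda>y. c *\<^sub>R D y (?U y) Z) = c *\<^sub>R D x (Z x) (\<lambda>y. D y (?U y) Z)"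
        using D_scale[OF vfD(1)[OF Z'] D_vf[OF U Z'] smooth_funs_const[of c]] tangent_const[OF vfD(1)[OF Z'], where c = c] by simp
      have 4: "lie_bracket (\<lambda>y. c *\<^sub>R ?U y) Z x = c *\<^sub>R lie_bracket ?U Z x"
      proof (rule tangent_eqI[of _ x])
        show "lie_bracket (\<lambda>y. c *\<^sub>R ?U y) Z x \<in> T x" by (rule vfD(1)[OF lie_bracket_vf[OF vf_cscale[OF U] Z']])
        show "c *\<^sub>R lie_bracket ?U Z x \<in> T x" by (intro tangent_closed vfD(1)[OF lie_bracket_vf[OF U Z']])
        fix h assume h: "h \<in> smooth_funs A"
        have "Z x (\<lambda>y. c * ?U y h) = c * Z x (\<lambda>y. ?U y h)" by (rule tangentD(2)[OF vfD(1)[OF Z'] vfD(2)[OF U h]])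
        then show "lie_bracket (\<lambda>y. c *\<^sub>R ?U y) Z x h = (c *\<^sub>R lie_bracket ?U Z x) h"
          by (simp add: lie_bracket_def scaleR_fun_def right_diff_distrib)
      qed
      have 5: "D x (c *\<^sub>R lie_bracket ?U Z x) Z = c *\<^sub>R D x (lie_bracket ?U Z x) Z"
        by (rule lin_onD(2)[OF D_lin_on[OF Z'] vfD(1)[OF lie_bracket_vf[OF U Z']]])
      show ?thesis unfolding R_eq 4 1 2 3 5 by (simp add: scaleR_diff_right)
    qed
    finally show ?thesis by (simp only: ca[OF u])
  qed
  have "ricci A g D x (Z x) = (\<Sum>k\<in>full_index. ?\<beta> (full_frame k x) (full_frame k x))"
    unfolding ricci_def
  proof (rule form_trace_tight[OF tangent_tight subspace_tangent order_refl])
    show "lin_on (T x) (\<lambda>u. ?\<beta> u v)" if "v \<in> T x" for v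
      using that by (simp add: lin_on_def add scale g_lin caT)
    show "lin_on (T x) (?\<beta> u)" if "u \<in> T x" for u
      by (rule lin_on_g(2)[OF caT[OF that]])
  qed
  also have "\<dots> = g x (R w Z Z x) (w x) + (\<Sum>a\<in>I. g x (R (E a) Z Z x) (E a x))"
    unfolding full_index_sum full_frame_simps curvature_at_eq[OF reeb_field Z' Z']
    by (simp add: curvature_at_eq[OF E_vf Z' Z'])
  also have "g x (R w Z Z x) (w x) = 0"
  proof -
    have h: "D x (w x) (\<lambda>y. D y (Z y) Z) \<in> T x" "g x (w x) (D x (w x) (\<lambda>y. D y (Z y) Z)) = 0"
      "D x (Z x) (\<lambda>y. D y (w y) Z) \<in> T x" "g x (w x) (D x (Z x) (\<lambda>y. D y (w y) Z)) = 0"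
      "D x (lie_bracket w Z x) Z \<in> T x" "g x (w x) (D x (lie_bracket w Z x) Z) = 0"
      by (rule D_T[OF wT D_vf[OF Z' Z']] D_hor[OF D_hor_field[OF Z' Z] wT]
          D_T[OF vfD(1)[OF Z'] D_vf[OF reeb_field Z']] D_hor[OF D_hor_field[OF reeb_field Z] vfD(1)[OF Z']]
          D_T[OF vfD(1)[OF lie_bracket_vf[OF reeb_field Z']] Z'] D_hor[OF Z vfD(1)[OF lie_bracket_vf[OF reeb_field Z']]])+
    have "g x (w x) (R w Z Z x) = 0" unfolding R_eq using h wT by (simp add: g_lin' tangent_closed)
    then show ?thesis using metric_sym[OF wT R_T[OF reeb_field Z' Z'], of x] by simp
  qed
  finally show ?thesis by simp
qed

section \<open>Horizontal gradient and sub-Laplacian in a frame\<close>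

definition hgrad :: "('m \<Rightarrow> real) \<Rightarrow> 'm vfield" where
  "hgrad f x = (\<Sum>a\<in>I. E a x f *\<^sub>R E a x)"

lemma hgrad_hor: assumes f: "f \<in> smooth_funs A" shows "hgrad f \<in> horizontal_fields"
proof (rule horI)
  show "hgrad f \<in> vector_fields A" unfolding hgrad_def[abs_def]
    by (rule vf_sum) (rule vf_scale[OF E_vf vfD(2)[OF E_vf f]])
  show "g x (w x) (hgrad f x) = 0" for x unfolding hgrad_def g_frame_sum(2)[OF wT]
    by (rule sum.neutral) (simp add: wE)
qed

lemma g_hgrad:
  assumes v: "v \<in> T x" "g x (w x) v = 0" shows "g x (hgrad f x) v = v f"
proof -
  have "v f = (\<Sum>a\<in>I. g x v (E a x) *\<^sub>R E a x) f" using frame_hor[OF v] by (rule fun_cong)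
  also have "\<dots> = (\<Sum>a\<in>I. E a x f * g x (E a x) v)"
    unfolding sum_tvec_apply scaleR_fun_def real_scaleR_def
    by (rule sum.cong[OF refl]) (simp add: metric_sym[OF v(1) ET])
  finally show ?thesis unfolding hgrad_def g_frame_sum(1)[OF v(1)] by (rule sym)
qed

lemma g_hgrad_hor: "X \<in> horizontal_fields \<Longrightarrow> g x (hgrad f x) (X x) = X x f"
  by (rule g_hgrad[OF horD(3) horD(2)])

lemma grad_eq:
  assumes f: "f \<in> smooth_funs A" shows "grad A g f x = hgrad f x + w x f *\<^sub>R w x"
proof (rule grad_eqI)
  note hT = horD(3)[OF hgrad_hor[OF f]]
  show "hgrad f x + w x f *\<^sub>R w x \<in> T x" by (intro tangent_closed hT wT)
  fix v assume v: "v \<in> T x"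
  define u where "u = v - g x (w x) v *\<^sub>R w x"
  have uT: "u \<in> T x" unfolding u_def by (intro tangent_closed v wT)
  have uw: "g x (w x) u = 0" using v wT reeb_unit by (simp add: u_def g_lin' tangent_closed)
  have "u f = v f - g x (w x) v * w x f" by (simp add: u_def scaleR_fun_def)
  moreover have "g x (hgrad f x) u = g x (hgrad f x) v"
    using v wT hT horD(4)[OF hgrad_hor[OF f]] by (simp add: u_def g_lin' tangent_closed)
  ultimately show "g x (hgrad f x + w x f *\<^sub>R w x) v = v f"
    using g_hgrad[OF uT uw, of f] v wT hT by (simp add: g_lin tangent_closed mult.commute)
qed

lemma hor_grad_eq:
  assumes f: "f \<in> smooth_funs A" shows "hor_grad A g \<alpha> f x = hgrad f x"
  unfolding hor_grad_def hor_def
proof (rule orth_proj_eqI[OF contact_dist_subspace(2,1)])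
  note h = horD(2,3)[OF hgrad_hor[OF f]]
  show "hgrad f x \<in> contact_dist A \<alpha> x" using h by (simp add: contact_dist_eq)
  show "grad A g f x \<in> T x" unfolding grad_eq[OF f] by (intro tangent_closed h wT)
  show "g x (grad A g f x - hgrad f x) s = 0" if "s \<in> contact_dist A \<alpha> x" for s
    using that wT unfolding grad_eq[OF f] contact_dist_eq by (simp add: g_lin)
qed

lemma ver_grad_eq:
  assumes f: "f \<in> smooth_funs A" shows "ver_grad A g \<alpha> f x = w x f *\<^sub>R w x"
  unfolding ver_grad_def ver_def
proof (rule orth_proj_eqI)
  note h = horD(2,3)[OF hgrad_hor[OF f]]
  let ?P = "{u \<in> T x. \<forall>s\<in>contact_dist A \<alpha> x. g x u s = 0}"
  show "?P \<subseteq> T x" by auto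
  show "subspace ?P"
    using contact_dist_subspace(2)[of x] by (auto simp: subspace_def tangent_closed g_lin subset_iff)
  show "w x f *\<^sub>R w x \<in> ?P" using wT by (auto simp: tangent_closed g_lin contact_dist_eq)
  show "grad A g f x \<in> T x" unfolding grad_eq[OF f] by (intro tangent_closed h wT)
  fix s assume s: "s \<in> ?P"
  have "hgrad f x \<in> contact_dist A \<alpha> x" using h by (simp add: contact_dist_eq)
  then have "g x s (hgrad f x) = 0" using s by auto
  then show "g x (grad A g f x - w x f *\<^sub>R w x) s = 0"
    using s metric_sym[of s x "hgrad f x"] h unfolding grad_eq[OF f] by simp
qed

lemma norm_ver_grad: "f \<in> smooth_funs A \<Longrightarrow> norm_sq g x (ver_grad A g \<alpha> f x) = (w x f)\<^sup>2"
  using wT by (simp add: norm_sq_def ver_grad_eq g_lin g_lin' tangent_closed reeb_unit power2_eq_square)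

definition hor_div :: "'m vfield \<Rightarrow> 'm \<Rightarrow> real" where
  "hor_div Y x = (\<Sum>a\<in>I. g x (D x (E a x) Y) (E a x))"

definition Lap :: "('m \<Rightarrow> real) \<Rightarrow> 'm \<Rightarrow> real" where
  "Lap f = hor_div (hgrad f)"

text \<open>Along a horizontal vector the Levi-Civita and Tanaka derivatives of the gradient differ by terms in
  \<open>w\<close> and \<open>J\<close> that have no trace on the contact distribution.\<close>

lemma sub_laplacian_eq:
  assumes f: "f \<in> smooth_funs A" shows "sub_laplacian A g \<alpha> nabla f x = Lap f x"
proof -
  note Z = hgrad_hor[OF f] and wf = vfD(2)[OF reeb_field f]
  have gr: "grad A g f = (\<lambda>y. hgrad f y + w y f *\<^sub>R w y)" by (rule ext) (rule grad_eq[OF f])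
  have gv: "grad A g f \<in> vector_fields A" unfolding gr by (rule vf_add[OF horD(1)[OF Z] vf_scale[OF reeb_field wf]])
  have sub: "u \<in> contact_dist A \<alpha> x \<Longrightarrow> u \<in> T x" for u using contact_dist_subspace(2) by blast
  note L = nabla_lin_on[OF gv, of x]
  have "sub_laplacian A g \<alpha> nabla f x = (\<Sum>a\<in>I. g x (nabla x (E a x) (grad A g f)) (E a x))"
    unfolding sub_laplacian_def
  proof (rule form_trace_tight[OF contact_tight contact_dist_subspace])
    show "lin_on (contact_dist A \<alpha> x) (\<lambda>u. g x (nabla x u (grad A g f)) v)" if "v \<in> contact_dist A \<alpha> x" for v
      unfolding lin_on_def
    proof (intro conjI ballI allI)
      fix u assume u: "u \<in> contact_dist A \<alpha> x"
      show "g x (nabla x (u + u') (grad A g f)) v = g x (nabla x u (grad A g f)) v + g x (nabla x u' (grad A g f)) v"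
        if u': "u' \<in> contact_dist A \<alpha> x" for u'
        unfolding lin_onD(1)[OF L sub[OF u] sub[OF u']]
        by (rule g_lin(1)[OF sub[OF \<open>v \<in> _\<close>] nabla_T[OF sub[OF u] gv] nabla_T[OF sub[OF u'] gv]])
      show "g x (nabla x (c *\<^sub>R u) (grad A g f)) v = c *\<^sub>R g x (nabla x u (grad A g f)) v" for c
        unfolding lin_onD(2)[OF L sub[OF u]] real_scaleR_def
        by (rule g_lin(2)[OF sub[OF \<open>v \<in> _\<close>] nabla_T[OF sub[OF u] gv]])
    qed
    show "lin_on (contact_dist A \<alpha> x) (g x (nabla x u (grad A g f)))" if "u \<in> contact_dist A \<alpha> x" for u
      unfolding lin_on_def using g_lin'[OF nabla_T[OF sub[OF that] gv]] sub by auto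
  qed
  also have "\<dots> = Lap f x" unfolding Lap_def hor_div_def
  proof (rule sum.cong[OF refl])
    fix a assume a: "a \<in> I"
    note Ea = ET[OF a, of x]
    have JE: "g x (J x (E a x)) (E a x) = 0"
      using J_skew[OF Ea Ea] metric_sym[OF JT[OF Ea] Ea] by simp
    have "nabla x (E a x) (grad A g f) = nabla x (E a x) (hgrad f)
        + (E a x (\<lambda>y. w y f) *\<^sub>R w x + w x f *\<^sub>R (- (1/2) *\<^sub>R J x (E a x)))"
      unfolding gr nabla_add[OF Ea horD(1)[OF Z] vf_scale[OF reeb_field wf]] nabla_scale[OF Ea reeb_field wf]
        nabla_reeb[OF Ea] ..
    then have "g x (nabla x (E a x) (grad A g f)) (E a x) = g x (nabla x (E a x) (hgrad f)) (E a x)"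
      using Ea wT[of x] JT[OF Ea] nabla_T[OF Ea horD(1)[OF Z]] wE[OF a, of x] JE
      by (simp add: g_lin tangent_closed)
    moreover have "g x (D x (E a x) (hgrad f)) (E a x) = g x (nabla x (E a x) (hgrad f)) (E a x)"
      unfolding tanaka_def horD(2)[OF Z] wE[OF a]
      using Ea wT[of x] nabla_T[OF Ea horD(1)[OF Z]] wE[OF a, of x] by (simp add: g_lin tangent_closed)
    ultimately show "g x (nabla x (E a x) (grad A g f)) (E a x) = g x (D x (E a x) (hgrad f)) (E a x)" by simp
  qed
  finally show ?thesis .
qed

lemma hessian:
  assumes f: "f \<in> smooth_funs A" and X: "X \<in> vector_fields A" and Y: "Y \<in> horizontal_fields"
  shows "g x (D x (X x) (hgrad f)) (Y x) = X x (\<lambda>y. Y y f) - D x (X x) Y f"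
proof -
  have "X x (\<lambda>y. g y (hgrad f y) (Y y)) = g x (D x (X x) (hgrad f)) (Y x) + g x (hgrad f x) (D x (X x) Y)"
    by (rule D_metric[OF horD(1)[OF hgrad_hor[OF f]] horD(1)[OF Y] vfD(1)[OF X]])
  moreover have "(\<lambda>y. g y (hgrad f y) (Y y)) = (\<lambda>y. Y y f)" by (rule ext) (rule g_hgrad_hor[OF Y])
  moreover have "g x (hgrad f x) (D x (X x) Y) = D x (X x) Y f"
    by (rule g_hgrad[OF D_T[OF vfD(1)[OF X] horD(1)[OF Y]] D_hor[OF Y vfD(1)[OF X]]])
  ultimately show ?thesis by simp
qed

lemma Lap_eq:
  assumes f: "f \<in> smooth_funs A"
  shows "Lap f x = (\<Sum>a\<in>I. E a x (\<lambda>y. E a y f) - D x (E a x) (E a) f)"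
  unfolding Lap_def hor_div_def by (rule sum.cong[OF refl]) (rule hessian[OF f E_vf E_hor])

lemma DEE_T: "a \<in> I \<Longrightarrow> D x (E a x) (E a) \<in> T x"
  by (rule D_T[OF ET E_vf])

lemma Lap_smooth: assumes f: "f \<in> smooth_funs A" shows "Lap f \<in> smooth_funs A"
  unfolding Lap_def hor_div_def[abs_def]
  by (rule smooth_funs_sum) (rule metric_smooth[OF D_vf[OF E_vf horD(1)[OF hgrad_hor[OF f]]] E_vf])

lemma Lap_add:
  assumes f: "f \<in> smooth_funs A" and h: "h \<in> smooth_funs A"
  shows "Lap (\<lambda>y. f y + h y) x = Lap f x + Lap h x"
proof -
  have "E a x (\<lambda>y. E a y (\<lambda>z. f z + h z)) - D x (E a x) (E a) (\<lambda>z. f z + h z) =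
      (E a x (\<lambda>y. E a y f) - D x (E a x) (E a) f) + (E a x (\<lambda>y. E a y h) - D x (E a x) (E a) h)" if a: "a \<in> I" for a
    unfolding tangentD(1)[OF ET[OF a] f h] tangentD(1)[OF DEE_T[OF a] f h]
      tangentD(1)[OF ET[OF a] vfD(2)[OF E_vf[OF a] f] vfD(2)[OF E_vf[OF a] h]] by simp
  then show ?thesis unfolding Lap_eq[OF smooth_funs_add[OF f h]] Lap_eq[OF f] Lap_eq[OF h]
    by (simp flip: sum.distrib)
qed

lemma Lap_cmult:
  assumes f: "f \<in> smooth_funs A" shows "Lap (\<lambda>y. c * f y) x = c * Lap f x"
proof -
  have "E a x (\<lambda>y. E a y (\<lambda>z. c * f z)) - D x (E a x) (E a) (\<lambda>z. c * f z) =
      c * (E a x (\<lambda>y. E a y f) - D x (E a x) (E a) f)" if a: "a \<in> I" for a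
    unfolding tangentD(2)[OF ET[OF a] f] tangentD(2)[OF DEE_T[OF a] f]
      tangentD(2)[OF ET[OF a] vfD(2)[OF E_vf[OF a] f]] by (simp add: right_diff_distrib)
  then show ?thesis unfolding Lap_eq[OF smooth_funs_mult[OF smooth_funs_const f]] Lap_eq[OF f] sum_distrib_left
    by (intro sum.cong) auto
qed

lemma hgrad_norm: assumes f: "f \<in> smooth_funs A"
  shows "g x (hgrad f x) (hgrad h x) = (\<Sum>a\<in>I. E a x f * E a x h)"
proof -
  have "g x (hgrad f x) (hgrad h x) = (\<Sum>a\<in>I. E a x h * g x (hgrad f x) (E a x))"
    unfolding hgrad_def[of h] by (rule g_frame_sum(2)[OF horD(3)[OF hgrad_hor[OF f]]])
  then show ?thesis by (simp add: g_hgrad_hor[OF E_hor] mult.commute)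
qed

lemma Lap_square:
  assumes h: "h \<in> smooth_funs A"
  shows "Lap (\<lambda>y. (h y)\<^sup>2) x = 2 * h x * Lap h x + 2 * g x (hgrad h x) (hgrad h x)"
proof -
  have sq: "v (\<lambda>y. (h y)\<^sup>2) = 2 * h x * v h" if "v \<in> T x" for v x
    using tangentD(3)[OF that h h] by (simp add: power2_eq_square)
  have "E a x (\<lambda>y. E a y (\<lambda>y. (h y)\<^sup>2)) - D x (E a x) (E a) (\<lambda>y. (h y)\<^sup>2) =
      2 * h x * (E a x (\<lambda>y. E a y h) - D x (E a x) (E a) h) + 2 * (E a x h * E a x h)" if a: "a \<in> I" for a
  proof -
    have "E a x (\<lambda>y. 2 * h y * E a y h) = E a x (\<lambda>y. 2 * h y) * E a x h + (2 * h x) * E a x (\<lambda>y. E a y h)"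
      by (rule tangentD(3)[OF ET[OF a] smooth_funs_mult[OF smooth_funs_const h] vfD(2)[OF E_vf[OF a] h]])
    then show ?thesis unfolding sq[OF ET[OF a]] sq[OF DEE_T[OF a]] tangentD(2)[OF ET[OF a] h]
      by (simp add: algebra_simps)
  qed
  then have "(\<Sum>a\<in>I. E a x (\<lambda>y. E a y (\<lambda>y. (h y)\<^sup>2)) - D x (E a x) (E a) (\<lambda>y. (h y)\<^sup>2)) =
      (\<Sum>a\<in>I. 2 * h x * (E a x (\<lambda>y. E a y h) - D x (E a x) (E a) h) + 2 * (E a x h * E a x h))"
    by (rule sum.cong[OF refl])
  then show ?thesis
    unfolding Lap_eq[OF smooth_funs_power[OF h]] Lap_eq[OF h] hgrad_norm[OF h] sum_distrib_left sum.distrib[symmetric] .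
qed

lemma Lap_at_max:
  assumes f: "f \<in> smooth_funs A" and max: "\<And>y. f y \<le> f x" shows "Lap f x \<le> 0"
  unfolding Lap_eq[OF f]
proof (rule sum_nonpos)
  fix a assume a: "a \<in> I"
  show "E a x (\<lambda>y. E a y f) - D x (E a x) (E a) f \<le> 0"
    using second_order_at_max[OF f max E_vf[OF a]] tangent_at_max[OF f max DEE_T[OF a]] by simp
qed

section \<open>Bochner formula\<close>

text \<open>The tensor given by a tight frame is the inverse metric on the contact distribution, which is
  parallel.\<close>

lemma frame_parallel:
  fixes \<beta> :: "'m tvec \<Rightarrow> 'm tvec \<Rightarrow> real"
  assumes v: "v \<in> T x" and L1: "\<And>u. u \<in> T x \<Longrightarrow> lin_on (T x) (\<lambda>z. \<beta> z u)" and L2: "\<And>u. u \<in> T x \<Longrightarrow> lin_on (T x) (\<beta> u)"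
  shows "(\<Sum>a\<in>I. \<beta> (E a x) (D x v (E a))) = - (\<Sum>a\<in>I. \<beta> (D x v (E a)) (E a x))"
proof -
  have DT: "D x v (E a) \<in> T x" and Dh: "g x (w x) (D x v (E a)) = 0" if "a \<in> I" for a
    by (rule D_T[OF v E_vf[OF that]], rule D_hor[OF E_hor[OF that] v])
  have key: "(\<Sum>a\<in>I. g x (E b x) (E a x) *\<^sub>R D x v (E a)) = - (\<Sum>a\<in>I. g x (E b x) (D x v (E a)) *\<^sub>R E a x)"
    if b: "b \<in> I" for b
  proof -
    have c: "(\<lambda>y. g y (E b y) (E a y)) \<in> smooth_funs A" if "a \<in> I" for a by (rule metric_smooth[OF E_vf[OF b] E_vf[OF that]])
    have "E b = (\<lambda>y. \<Sum>a\<in>I. g y (E b y) (E a y) *\<^sub>R E a y)"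
      by (rule ext) (rule frame_hor[OF ET[OF b] wE[OF b]])
    then have "D x v (E b) = D x v (\<lambda>y. \<Sum>a\<in>I. g y (E b y) (E a y) *\<^sub>R E a y)" by (rule arg_cong)
    then have 1: "D x v (E b) = (\<Sum>a\<in>I. v (\<lambda>y. g y (E b y) (E a y)) *\<^sub>R E a x + g x (E b x) (E a x) *\<^sub>R D x v (E a))"
      by (rule trans)
        (rule D_sum[OF v fin, where c = "\<lambda>a y. g y (E b y) (E a y)" and G = E], (rule c E_vf, assumption)+)
    have 2: "(\<Sum>a\<in>I. v (\<lambda>y. g y (E b y) (E a y)) *\<^sub>R E a x + g x (E b x) (E a x) *\<^sub>R D x v (E a))
      = (\<Sum>a\<in>I. g x (D x v (E b)) (E a x) *\<^sub>R E a x) + ((\<Sum>a\<in>I. g x (E b x) (D x v (E a)) *\<^sub>R E a x)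
        + (\<Sum>a\<in>I. g x (E b x) (E a x) *\<^sub>R D x v (E a)))"
      unfolding sum.distrib[symmetric]
      by (rule sum.cong[OF refl]) (simp add: D_metric[OF E_vf[OF b] E_vf v] scaleR_add_left)
    have 3: "(\<Sum>a\<in>I. g x (D x v (E b)) (E a x) *\<^sub>R E a x) = D x v (E b)"
      by (rule frame_hor[OF DT[OF b] Dh[OF b], symmetric])
    have "(\<Sum>a\<in>I. g x (E b x) (D x v (E a)) *\<^sub>R E a x) + (\<Sum>a\<in>I. g x (E b x) (E a x) *\<^sub>R D x v (E a)) = 0"
      using 1 unfolding 2 3 by simp
    then show ?thesis by (simp add: eq_neg_iff_add_eq_0 add.commute)
  qed
  have "(\<Sum>a\<in>I. \<beta> (E a x) (D x v (E a))) = (\<Sum>a\<in>I. \<Sum>b\<in>I. g x (E a x) (E b x) * \<beta> (E b x) (D x v (E a)))"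
    by (rule sum.cong[OF refl]) (rule expand_hor[OF ET wE L1[OF DT]])
  also have "\<dots> = (\<Sum>b\<in>I. \<Sum>a\<in>I. g x (E a x) (E b x) * \<beta> (E b x) (D x v (E a)))" by (rule sum.swap)
  also have "\<dots> = (\<Sum>b\<in>I. - (\<Sum>a\<in>I. g x (E b x) (D x v (E a)) * \<beta> (E b x) (E a x)))"
  proof (rule sum.cong[OF refl])
    fix b assume b: "b \<in> I"
    note L = L2[OF ET[OF b, of x]]
    have e1: "\<beta> (E b x) (\<Sum>a\<in>I. c a *\<^sub>R D x v (E a)) = (\<Sum>a\<in>I. c a * \<beta> (E b x) (D x v (E a)))" for c
      using lin_on_sum[OF L subspace_tangent, of I "\<lambda>a. D x v (E a)" c] DT by simp
    have e2: "\<beta> (E b x) (\<Sum>a\<in>I. c a *\<^sub>R E a x) = (\<Sum>a\<in>I. c a * \<beta> (E b x) (E a x))" for c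
      using lin_on_sum[OF L subspace_tangent, of I "\<lambda>a. E a x" c] ET by simp
    have "(\<Sum>a\<in>I. g x (E a x) (E b x) * \<beta> (E b x) (D x v (E a))) = \<beta> (E b x) (\<Sum>a\<in>I. g x (E b x) (E a x) *\<^sub>R D x v (E a))"
      unfolding e1
      by (rule sum.cong[OF refl]) (simp add: metric_sym[OF ET ET[OF b]])
    also have "\<dots> = \<beta> (E b x) (\<Sum>a\<in>I. (- g x (E b x) (D x v (E a))) *\<^sub>R E a x)"
      unfolding key[OF b] by (simp add: sum_negf)
    also have "\<dots> = - (\<Sum>a\<in>I. g x (E b x) (D x v (E a)) * \<beta> (E b x) (E a x))"
      unfolding e2 by (simp add: sum_negf)
    finally show "(\<Sum>a\<in>I. g x (E a x) (E b x) * \<beta> (E b x) (D x v (E a))) =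
        - (\<Sum>a\<in>I. g x (E b x) (D x v (E a)) * \<beta> (E b x) (E a x))" .
  qed
  also have "\<dots> = - (\<Sum>a\<in>I. \<Sum>b\<in>I. g x (D x v (E a)) (E b x) * \<beta> (E b x) (E a x))"
    unfolding sum_negf by (subst sum.swap) (simp add: metric_sym[OF ET DT] cong: sum.cong)
  also have "\<dots> = - (\<Sum>a\<in>I. \<beta> (D x v (E a)) (E a x))"
    by (rule arg_cong[where f = uminus], rule sum.cong[OF refl]) (rule expand_hor[OF DT Dh L1[OF ET], symmetric])
  finally show ?thesis .
qed

lemma D_form_lin:
  assumes Z: "Z \<in> vector_fields A"
  shows "u \<in> T x \<Longrightarrow> lin_on (T x) (\<lambda>z. g x (D x z Z) u)" "u \<in> T x \<Longrightarrow> lin_on (T x) (\<lambda>v. g x (D x u Z) v)"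
  using lin_on_g(2)[OF D_T[OF _ Z]] lin_onD[OF D_lin_on[OF Z]] D_T[OF _ Z]
  by (auto simp: lin_on_def g_lin)

lemma frame_parallel_D:
  assumes Z: "Z \<in> vector_fields A" and v: "v \<in> T x"
  shows "(\<Sum>a\<in>I. g x (D x (E a x) Z) (D x v (E a))) = - (\<Sum>a\<in>I. g x (D x (D x v (E a)) Z) (E a x))"
  by (rule frame_parallel[OF v D_form_lin[OF Z]])

lemma frame_D_trace: assumes v: "v \<in> T x" shows "(\<Sum>a\<in>I. g x (D x v (E a)) (E a x)) = 0"
proof -
  have "(\<Sum>a\<in>I. g x (E a x) (D x v (E a))) = - (\<Sum>a\<in>I. g x (D x v (E a)) (E a x))"
    by (rule frame_parallel[OF v lin_on_g])
  moreover have "(\<Sum>a\<in>I. g x (E a x) (D x v (E a))) = (\<Sum>a\<in>I. g x (D x v (E a)) (E a x))"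
    by (rule sum.cong[OF refl]) (rule metric_sym[OF ET D_T[OF v E_vf]])
  ultimately show ?thesis by simp
qed

lemma reeb_bracket: "Y \<in> horizontal_fields \<Longrightarrow> lie_bracket w Y x = D x (w x) Y"
  using D_torsion[OF reeb_field horD(1), of Y x] D_reeb[OF horD(3), of Y x] g_w_J[OF horD(3), of Y x] by simp

lemma reeb_bracket_hor: "Y \<in> horizontal_fields \<Longrightarrow> lie_bracket w Y \<in> horizontal_fields"
  using D_hor_field[OF reeb_field, of Y] reeb_bracket[of Y] by presburger

lemma D_reeb_hgrad:
  assumes f: "f \<in> smooth_funs A" shows "D x (w x) (hgrad f) = hgrad (\<lambda>y. w y f) x"
proof -
  note Z = hgrad_hor[OF f] and wf = vfD(2)[OF reeb_field f]
  have e: "g x (D x (w x) (hgrad f)) (E a x) = E a x (\<lambda>y. w y f)" if a: "a \<in> I" for a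
    unfolding hessian[OF f reeb_field E_hor[OF a]] reeb_bracket[OF E_hor[OF a], symmetric]
    by (simp add: lie_bracket_def)
  have "D x (w x) (hgrad f) = (\<Sum>a\<in>I. g x (D x (w x) (hgrad f)) (E a x) *\<^sub>R E a x)"
    by (rule frame_hor[OF D_T[OF wT horD(1)[OF Z]] D_hor[OF Z wT]])
  then show ?thesis unfolding hgrad_def[of "\<lambda>y. w y f"] by (simp add: e cong: sum.cong)
qed

text \<open>The torsion is vertical, and the total squared length of the frame is constant, so that the terms
  \<open>\<langle>D\<^sub>Y E\<^sub>a, E\<^sub>a\<rangle>\<close> sum to zero.\<close>

lemma hor_div_bracket:
  assumes Y: "Y \<in> horizontal_fields" shows "hor_div Y x = (\<Sum>a\<in>I. g x (lie_bracket (E a) Y x) (E a x))"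
proof -
  have "(\<Sum>a\<in>I. g x (lie_bracket (E a) Y x) (E a x)) = hor_div Y x - (\<Sum>a\<in>I. g x (D x (Y x) (E a)) (E a x))"
    unfolding hor_div_def sum_subtractf[symmetric]
    by (rule sum.cong[OF refl]) (rule bracket_pairing[OF E_hor Y E_hor])
  then show ?thesis using frame_D_trace[OF horD(3)[OF Y]] by simp
qed

text \<open>The bracket formula for the divergence involves only the metric, which the flow of \<open>w\<close>
  preserves, so that no curvature term appears.\<close>

lemma reeb_hor_div:
  assumes Y: "Y \<in> horizontal_fields" shows "w x (hor_div Y) = hor_div (lie_bracket w Y) x"
proof -
  note Y' = horD(1)[OF Y] and wY = reeb_bracket_hor[OF Y]
  have met: "w x (\<lambda>y. g y (P y) (Q y)) = g x (lie_bracket w P x) (Q x) + g x (P x) (lie_bracket w Q x)"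
    if P: "P \<in> vector_fields A" and Q: "Q \<in> horizontal_fields" for P Q
  proof -
    have "lie_bracket w P x = D x (w x) P"
      using D_torsion[OF reeb_field P, of x] D_reeb[OF vfD(1)[OF P]] g_w_J[OF vfD(1)[OF P]] by simp
    then show ?thesis using D_metric[OF P horD(1)[OF Q] wT, of x] reeb_bracket[OF Q, of x] by simp
  qed
  have b: "lie_bracket (E a) Y \<in> vector_fields A" if "a \<in> I" for a by (rule lie_bracket_vf[OF E_vf[OF that] Y'])
  have "w x (hor_div Y) = w x (\<lambda>x. \<Sum>a\<in>I. g x (lie_bracket (E a) Y x) (E a x))"
    by (rule arg_cong[where f = "w x"], rule ext) (rule hor_div_bracket[OF Y])
  also have "\<dots> = (\<Sum>a\<in>I. w x (\<lambda>x. g x (lie_bracket (E a) Y x) (E a x)))"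
    by (rule tangent_sum[OF wT]) (rule metric_smooth[OF b E_vf])
  also have "\<dots> = (\<Sum>a\<in>I. g x (lie_bracket (E a) (lie_bracket w Y) x) (E a x)
      + (g x (D x (D x (w x) (E a)) Y) (E a x) - g x (D x (Y x) (lie_bracket w (E a))) (E a x)
      + (g x (D x (E a x) Y) (D x (w x) (E a)) - g x (D x (Y x) (E a)) (lie_bracket w (E a) x))))"
  proof (rule sum.cong[OF refl])
    fix a assume a: "a \<in> I"
    note Ea = E_hor[OF a] and wE' = reeb_bracket_hor[OF E_hor[OF a]]
    have 1: "w x (\<lambda>x. g x (lie_bracket (E a) Y x) (E a x)) =
      g x (lie_bracket w (lie_bracket (E a) Y) x) (E a x) + g x (lie_bracket (E a) Y x) (lie_bracket w (E a) x)"
      by (rule met[OF b[OF a] Ea])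
    have 2: "g x (lie_bracket w (lie_bracket (E a) Y) x) (E a x) =
      g x (lie_bracket (lie_bracket w (E a)) Y x) (E a x) + g x (lie_bracket (E a) (lie_bracket w Y) x) (E a x)"
      unfolding jacobi_identity[OF reeb_field horD(1)[OF Ea] Y']
      by (rule g_lin(1)[OF ET[OF a] vfD(1)[OF lie_bracket_vf[OF horD(1)[OF wE'] Y']] vfD(1)[OF lie_bracket_vf[OF horD(1)[OF Ea] horD(1)[OF wY]]]])
    have 3: "g x (lie_bracket (lie_bracket w (E a)) Y x) (E a x) =
      g x (D x (D x (w x) (E a)) Y) (E a x) - g x (D x (Y x) (lie_bracket w (E a))) (E a x)"
      unfolding bracket_pairing[OF wE' Y Ea] reeb_bracket[OF Ea, of x] ..
    have 4: "g x (lie_bracket (E a) Y x) (lie_bracket w (E a) x) =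
      g x (D x (E a x) Y) (D x (w x) (E a)) - g x (D x (Y x) (E a)) (lie_bracket w (E a) x)"
      using bracket_pairing[OF Ea Y wE', of x] unfolding reeb_bracket[OF Ea, of x] .
    show "w x (\<lambda>x. g x (lie_bracket (E a) Y x) (E a x)) =
      g x (lie_bracket (E a) (lie_bracket w Y) x) (E a x)
      + (g x (D x (D x (w x) (E a)) Y) (E a x) - g x (D x (Y x) (lie_bracket w (E a))) (E a x)
      + (g x (D x (E a x) Y) (D x (w x) (E a)) - g x (D x (Y x) (E a)) (lie_bracket w (E a) x)))"
      using 1 2 3 4 by linarith
  qed
  also have "\<dots> = (\<Sum>a\<in>I. g x (lie_bracket (E a) (lie_bracket w Y) x) (E a x))
     + ((\<Sum>a\<in>I. g x (D x (D x (w x) (E a)) Y) (E a x)) + (\<Sum>a\<in>I. g x (D x (E a x) Y) (D x (w x) (E a))))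
     - (\<Sum>a\<in>I. g x (D x (Y x) (lie_bracket w (E a))) (E a x) + g x (D x (Y x) (E a)) (lie_bracket w (E a) x))"
    by (simp add: sum.distrib sum_subtractf)
  finally have main: "w x (hor_div Y) = (\<Sum>a\<in>I. g x (lie_bracket (E a) (lie_bracket w Y) x) (E a x))
     + ((\<Sum>a\<in>I. g x (D x (D x (w x) (E a)) Y) (E a x)) + (\<Sum>a\<in>I. g x (D x (E a x) Y) (D x (w x) (E a))))
     - (\<Sum>a\<in>I. g x (D x (Y x) (lie_bracket w (E a))) (E a x) + g x (D x (Y x) (E a)) (lie_bracket w (E a) x))" .
  have z1: "(\<Sum>a\<in>I. g x (D x (D x (w x) (E a)) Y) (E a x)) + (\<Sum>a\<in>I. g x (D x (E a x) Y) (D x (w x) (E a))) = 0"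
    using frame_parallel_D[OF Y' wT] by simp
  have z2: "(\<Sum>a\<in>I. g x (D x (Y x) (lie_bracket w (E a))) (E a x) + g x (D x (Y x) (E a)) (lie_bracket w (E a) x)) = 0"
  proof -
    have "(\<Sum>a\<in>I. g x (D x (Y x) (lie_bracket w (E a))) (E a x) + g x (D x (Y x) (E a)) (lie_bracket w (E a) x))
      = (\<Sum>a\<in>I. Y x (\<lambda>y. g y (D y (w y) (E a)) (E a y)))"
    proof (rule sum.cong[OF refl])
      fix a assume a: "a \<in> I"
      note Ea = E_hor[OF a] and wE' = reeb_bracket_hor[OF E_hor[OF a]]
      have "Y x (\<lambda>y. g y (lie_bracket w (E a) y) (E a y)) = g x (D x (Y x) (lie_bracket w (E a))) (E a x) + g x (lie_bracket w (E a) x) (D x (Y x) (E a))"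
        by (rule D_metric[OF horD(1)[OF wE'] horD(1)[OF Ea] horD(3)[OF Y]])
      then show "g x (D x (Y x) (lie_bracket w (E a))) (E a x) + g x (D x (Y x) (E a)) (lie_bracket w (E a) x)
        = Y x (\<lambda>y. g y (D y (w y) (E a)) (E a y))"
        unfolding reeb_bracket[OF Ea, symmetric]
        using metric_sym[OF horD(3)[OF wE'] D_T[OF horD(3)[OF Y] E_vf[OF a]], of x] by simp
    qed
    also have "\<dots> = Y x (\<lambda>y. \<Sum>a\<in>I. g y (D y (w y) (E a)) (E a y))"
      by (rule tangent_sum[OF horD(3)[OF Y], symmetric]) (rule metric_smooth[OF D_vf[OF reeb_field E_vf] E_vf])
    also have "\<dots> = 0"
      unfolding frame_D_trace[OF wT] by (rule tangent_const[OF horD(3)[OF Y]])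
    finally show ?thesis .
  qed
  show ?thesis using main z1 z2 unfolding hor_div_bracket[OF wY] by simp
qed

text \<open>The covariant derivative of a horizontal gradient along \<open>w\<close> is the horizontal gradient of the
  \<open>w\<close>-derivative, so the claim is an instance of the one for divergences.\<close>

lemma reeb_Lap:
  assumes f: "f \<in> smooth_funs A" shows "w x (Lap f) = Lap (\<lambda>y. w y f) x"
proof -
  have "lie_bracket w (hgrad f) = hgrad (\<lambda>y. w y f)"
    by (rule ext) (simp only: reeb_bracket[OF hgrad_hor[OF f]] D_reeb_hgrad[OF f])
  then show ?thesis unfolding Lap_def using reeb_hor_div[OF hgrad_hor[OF f], of x] by (simp only:)
qed

lemma reeb_norm_hgrad:
  assumes f: "f \<in> smooth_funs A"
  shows "w x (\<lambda>y. g y (hgrad f y) (hgrad f y)) = 2 * g x (hgrad f x) (hgrad (\<lambda>y. w y f) x)"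
proof -
  note Z = hgrad_hor[OF f] and Q = hgrad_hor[OF vfD(2)[OF reeb_field f]]
  show ?thesis
    unfolding D_metric[OF horD(1)[OF Z] horD(1)[OF Z] wT] D_reeb_hgrad[OF f]
    using metric_sym[OF horD(3)[OF Z] horD(3)[OF Q], of x] by simp
qed

text \<open>The skew part of the Hessian of \<open>f\<close> is the torsion of the connection applied to \<open>f\<close>.\<close>

lemma hessian_swap:
  assumes f: "f \<in> smooth_funs A" and X: "X \<in> horizontal_fields" and Y: "Y \<in> horizontal_fields"
  shows "g x (D x (X x) (hgrad f)) (Y x) = g x (D x (Y x) (hgrad f)) (X x) - g x (X x) (J x (Y x)) * w x f"
proof -
  have "D x (X x) Y f - D x (Y x) X f = lie_bracket X Y x f + g x (X x) (J x (Y x)) * w x f"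
    using fun_cong[OF D_torsion[OF horD(1)[OF X] horD(1)[OF Y], of x], of f] by (simp add: scaleR_fun_def)
  then show ?thesis
    unfolding hessian[OF f horD(1)[OF X] Y] hessian[OF f horD(1)[OF Y] X] by (simp add: lie_bracket_def)
qed

text \<open>Differentiating the symmetry relation of the Hessian moves the second derivative onto
  \<open>D\<^sub>Z Z\<close>. Of the terms produced by the asymmetry, those with \<open>w f\<close> itself cancel because
  \<open>J\<close> is parallel, and one with a derivative of \<open>w f\<close> remains.\<close>

lemma bochner_second_derivative:
  assumes f: "f \<in> smooth_funs A" and a: "a \<in> I"
  defines "Z \<equiv> hgrad f"
  shows "g x (D x (E a x) (\<lambda>y. D y (E a y) Z)) (Z x) - g x (D x (D x (E a x) (E a)) Z) (Z x) =
    g x (D x (E a x) (\<lambda>y. D y (Z y) Z)) (E a x) - g x (D x (D x (E a x) Z) Z) (E a x)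
    - g x (E a x) (J x (Z x)) * E a x (\<lambda>y. w y f)"
proof -
  note ZH = hgrad_hor[OF f, folded Z_def] and Ea = E_hor[OF a]
  note Z' = horD(1)[OF ZH] and Ea' = horD(1)[OF Ea] and ZT = horD(3)[OF ZH] and EaT = horD(3)[OF Ea]
  note wf = vfD(2)[OF reeb_field f]
  note swap = hessian_swap[OF f, folded Z_def]
  note DaZ = D_hor_field[OF Ea' ZH] and DZZ = D_hor_field[OF Z' ZH] and Daa = D_hor_field[OF Ea' Ea]
  have jz: "(\<lambda>y. g y (E a y) (J y (Z y))) \<in> smooth_funs A" by (rule metric_smooth[OF Ea' J_vf[OF Z']])
  have "(\<lambda>y. g y (D y (E a y) Z) (Z y)) = (\<lambda>y. g y (D y (Z y) Z) (E a y) - g y (E a y) (J y (Z y)) * w y f)"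
    by (rule ext) (rule swap[OF Ea ZH])
  then have "E a x (\<lambda>y. g y (D y (E a y) Z) (Z y)) =
      E a x (\<lambda>y. g y (D y (Z y) Z) (E a y) - g y (E a y) (J y (Z y)) * w y f)" by (rule arg_cong)
  also have "\<dots> = E a x (\<lambda>y. g y (D y (Z y) Z) (E a y)) - (E a x (\<lambda>y. g y (E a y) (J y (Z y))) * w x f
      + g x (E a x) (J x (Z x)) * E a x (\<lambda>y. w y f))"
    unfolding tangent_diff[OF EaT metric_smooth[OF horD(1)[OF DZZ] Ea'] smooth_funs_mult[OF jz wf]]
      tangentD(3)[OF EaT jz wf] ..
  finally have 1: "g x (D x (E a x) (\<lambda>y. D y (E a y) Z)) (Z x) + g x (D x (E a x) Z) (D x (E a x) Z) =
      g x (D x (E a x) (\<lambda>y. D y (Z y) Z)) (E a x) + g x (D x (Z x) Z) (D x (E a x) (E a))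
      - ((g x (D x (E a x) (E a)) (J x (Z x)) + g x (E a x) (D x (E a x) (\<lambda>y. J y (Z y)))) * w x f
      + g x (E a x) (J x (Z x)) * E a x (\<lambda>y. w y f))"
    unfolding D_metric[OF horD(1)[OF DaZ] Z' EaT] D_metric[OF horD(1)[OF DZZ] Ea' EaT] D_metric[OF Ea' J_vf[OF Z'] EaT] .
  have 2: "g x (D x (D x (E a x) (E a)) Z) (Z x) = g x (D x (Z x) Z) (D x (E a x) (E a))
      - g x (D x (E a x) (E a)) (J x (Z x)) * w x f"
    by (rule swap[OF Daa ZH])
  have 3: "g x (D x (E a x) Z) (D x (E a x) Z) = g x (D x (D x (E a x) Z) Z) (E a x)
      - g x (E a x) (J x (D x (E a x) Z)) * w x f"
    by (rule swap[OF Ea DaZ])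
  have 4: "g x (E a x) (D x (E a x) (\<lambda>y. J y (Z y))) = g x (E a x) (J x (D x (E a x) Z))"
  proof -
    have "g x (D x (E a x) (\<lambda>y. J y (Z y))) (E a x) + g x (D x (E a x) Z) (J x (E a x)) = 0"
      using J_parallel[OF Ea ZH Ea, of x] unfolding dJ_def .
    moreover have "g x (D x (E a x) Z) (J x (E a x)) = - g x (J x (D x (E a x) Z)) (E a x)"
      using J_skew[OF horD(3)[OF DaZ] EaT, of x] by simp
    ultimately show ?thesis
      using metric_sym[OF EaT D_T[OF EaT J_vf[OF Z']], of x] metric_sym[OF EaT JT[OF horD(3)[OF DaZ]], of x] by simp
  qed
  show ?thesis using 1 2 3 unfolding 4 by (simp add: algebra_simps)
qed

text \<open>Commuting the two covariant derivatives gives the Ricci term. The term with \<open>J\<close> occurs once from the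
  asymmetry of the Hessian and once from the torsion in the commutator, hence the factor two.\<close>

lemma bochner:
  assumes f: "f \<in> smooth_funs A"
  defines "Z \<equiv> hgrad f"
  shows "1/2 * Lap (\<lambda>y. g y (Z y) (Z y)) x = (\<Sum>a\<in>I. g x (D x (E a x) Z) (D x (E a x) Z))
    + Z x (Lap f) + ricci A g D x (Z x) - 2 * J x (Z x) (\<lambda>y. w y f)"
proof -
  note ZH = hgrad_hor[OF f, folded Z_def]
  note Z' = horD(1)[OF ZH] and ZT = horD(3)[OF ZH] and wf = vfD(2)[OF reeb_field f]
  let ?N = "\<lambda>y. g y (Z y) (Z y)" and ?q = "\<lambda>y. w y f"
  have dN: "v ?N = 2 * g y (D y v Z) (Z y)" if "v \<in> T y" for v y
    unfolding D_metric[OF Z' Z' that] using metric_sym[OF ZT D_T[OF that Z']] by simp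
  have JZH: "J x (Z x) \<in> T x" "g x (w x) (J x (Z x)) = 0" by (rule JT[OF ZT], rule g_w_J[OF ZT])
  have JZq: "(\<Sum>a\<in>I. g x (E a x) (J x (Z x)) * E a x ?q) = J x (Z x) ?q"
    using g_hgrad[OF JZH, of ?q] unfolding hgrad_def g_frame_sum(1)[OF JZH(1)] by (simp add: mult.commute)
  have summand: "E a x (\<lambda>y. E a y ?N) - D x (E a x) (E a) ?N =
      2 * (g x (D x (E a x) Z) (D x (E a x) Z) + g x (R (E a) Z Z x) (E a x)
        + (g x (D x (Z x) (\<lambda>y. D y (E a y) Z)) (E a x) - g x (D x (D x (Z x) (E a)) Z) (E a x))
        - 2 * (g x (E a x) (J x (Z x)) * E a x ?q))" if a: "a \<in> I" for a
  proof -
    note Ea = E_hor[OF a] and Ea' = E_vf[OF a] and EaT = ET[OF a]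
    note DaZ = D_hor_field[OF Ea' ZH]
    have "(\<lambda>y. E a y ?N) = (\<lambda>y. 2 * g y (D y (E a y) Z) (Z y))" by (rule ext) (rule dN[OF EaT])
    then have "E a x (\<lambda>y. E a y ?N) = E a x (\<lambda>y. 2 * g y (D y (E a y) Z) (Z y))" by (rule arg_cong)
    also have "\<dots> = 2 * (g x (D x (E a x) (\<lambda>y. D y (E a y) Z)) (Z x) + g x (D x (E a x) Z) (D x (E a x) Z))"
      unfolding tangentD(2)[OF EaT metric_smooth[OF horD(1)[OF DaZ] Z']] D_metric[OF horD(1)[OF DaZ] Z' EaT] ..
    finally have 1: "E a x (\<lambda>y. E a y ?N) = 2 * (g x (D x (E a x) (\<lambda>y. D y (E a y) Z)) (Z x) + g x (D x (E a x) Z) (D x (E a x) Z))" .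
    have 2: "D x (E a x) (E a) ?N = 2 * g x (D x (D x (E a x) (E a)) Z) (Z x)" by (rule dN[OF DEE_T[OF a]])
    note 3 = bochner_second_derivative[OF f a, of x, folded Z_def]
    have DT: "D x (E a x) Z \<in> T x" "D x (Z x) (E a) \<in> T x" by (rule D_T[OF EaT Z'], rule D_T[OF ZT Ea'])
    have wsT: "g x (E a x) (J x (Z x)) *\<^sub>R w x \<in> T x" by (intro tangent_closed wT)
    have "lie_bracket (E a) Z x = D x (E a x) Z - D x (Z x) (E a) - g x (E a x) (J x (Z x)) *\<^sub>R w x"
      using D_torsion[OF Ea' Z', of x] by (simp add: algebra_simps)
    then have "D x (lie_bracket (E a) Z x) Z = D x (D x (E a x) Z + (-1) *\<^sub>R D x (Z x) (E a) + (- g x (E a x) (J x (Z x))) *\<^sub>R w x) Z"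
      by simp
    also have "\<dots> = D x (D x (E a x) Z) Z + (-1) *\<^sub>R D x (D x (Z x) (E a)) Z + (- g x (E a x) (J x (Z x))) *\<^sub>R D x (w x) Z"
      by (simp only: lin_onD[OF D_lin_on[OF Z']] DT wT tangent_closed(2,3))
    finally have 4: "D x (lie_bracket (E a) Z x) Z = D x (D x (E a x) Z) Z + (-1) *\<^sub>R D x (D x (Z x) (E a)) Z
      + (- g x (E a x) (J x (Z x))) *\<^sub>R hgrad ?q x"
      unfolding D_reeb_hgrad[OF f, folded Z_def] .
    have "g x (R (E a) Z Z x) (E a x) = g x (D x (E a x) (\<lambda>y. D y (Z y) Z)) (E a x)
        - g x (D x (Z x) (\<lambda>y. D y (E a y) Z)) (E a x)
        - (g x (D x (D x (E a x) Z) Z) (E a x) - g x (D x (D x (Z x) (E a)) Z) (E a x) - g x (E a x) (J x (Z x)) * E a x ?q)"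
      unfolding R_eq 4
      using D_T[OF EaT D_vf[OF Z' Z'], of x] D_T[OF ZT D_vf[OF Ea' Z'], of x] D_T[OF DT(1) Z'] D_T[OF DT(2) Z']
        horD(3)[OF hgrad_hor[OF wf], of x] EaT[of x] g_hgrad_hor[OF Ea, of x ?q]
      by (simp add: g_lin tangent_closed)
    then show ?thesis using 1 2 3 by (simp add: algebra_simps)
  qed
  have Zf: "Z x (Lap f) = (\<Sum>a\<in>I. g x (D x (Z x) (\<lambda>y. D y (E a y) Z)) (E a x) - g x (D x (D x (Z x) (E a)) Z) (E a x))"
  proof -
    have "Z x (Lap f) = (\<Sum>a\<in>I. Z x (\<lambda>y. g y (D y (E a y) Z) (E a y)))"
      unfolding Lap_def hor_div_def[abs_def] Z_def[symmetric]
      by (rule tangent_sum[OF ZT]) (rule metric_smooth[OF D_vf[OF E_vf Z'] E_vf])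
    also have "\<dots> = (\<Sum>a\<in>I. g x (D x (Z x) (\<lambda>y. D y (E a y) Z)) (E a x) + g x (D x (E a x) Z) (D x (Z x) (E a)))"
      by (rule sum.cong[OF refl]) (rule D_metric[OF D_vf[OF E_vf Z'] E_vf ZT])
    finally show ?thesis using frame_parallel_D[OF Z' ZT, of x] by (simp add: sum.distrib sum_subtractf)
  qed
  have "Lap ?N x = 2 * ((\<Sum>a\<in>I. g x (D x (E a x) Z) (D x (E a x) Z)) + (\<Sum>a\<in>I. g x (R (E a) Z Z x) (E a x))
      + Z x (Lap f) - 2 * J x (Z x) ?q)"
    unfolding Lap_eq[OF metric_smooth[OF Z' Z']] Zf JZq[symmetric]
    by (simp add: summand sum.distrib sum_subtractf flip: sum_distrib_left cong: sum.cong)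
  then show ?thesis unfolding ricci_eq[OF ZH] by simp
qed

text \<open>The skew part of the Hessian is \<open>- (w f / 2) d \<alpha>\<close>. Completing the square around the multiple
  of the metric with parameter \<open>l\<close> and around this skew part gives a Cauchy--Schwarz bound that is
  already linearised in \<open>Lap f\<close>.\<close>

lemma hessian_norm_bound:
  assumes f: "f \<in> smooth_funs A" and n: "n \<ge> 1"
  shows "l / real n * Lap f x - l\<^sup>2 / (2 * real n) + real n / 2 * (w x f)\<^sup>2 \<le>
    (\<Sum>a\<in>I. g x (D x (E a x) (hgrad f)) (D x (E a x) (hgrad f)))"
proof -
  define Z where "Z = hgrad f"
  note ZH = hgrad_hor[OF f, folded Z_def] and swap = hessian_swap[OF f, folded Z_def]
  note Z' = horD(1)[OF ZH]
  have DT: "D x (E a x) Z \<in> T x" if "a \<in> I" for a by (rule D_T[OF ET[OF that] Z'])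
  have JE: "J x (E a x) \<in> T x" if "a \<in> I" for a by (rule JT[OF ET[OF that]])
  have JEE: "g x (J x (E a x)) (E a x) = 0" "g x (E a x) (J x (E a x)) = 0" if "a \<in> I" for a
    using J_skew[OF ET[OF that] ET[OF that], of x] metric_sym[OF JE[OF that] ET[OF that]] by auto
  have JJ: "g x (J x (E a x)) (J x (E a x)) = g x (E a x) (E a x)" if "a \<in> I" for a
    by (rule J_iso_hor[OF ET[OF that] E_hor[OF that]])
  define S where "S = (\<Sum>a\<in>I. g x (D x (E a x) Z) (J x (E a x)))"
  have "S = (\<Sum>a\<in>I. g x (D x (J x (E a x)) Z) (E a x) + g x (E a x) (E a x) * w x f)"
    unfolding S_def
  proof (rule sum.cong[OF refl])
    fix a assume a: "a \<in> I"
    have "g x (E a x) (J x (J x (E a x))) = - g x (E a x) (E a x)"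
      unfolding JJ_hor[OF E_hor[OF a]] using ET[OF a] by (simp add: g_lin')
    then show "g x (D x (E a x) Z) (J x (E a x)) = g x (D x (J x (E a x)) Z) (E a x) + g x (E a x) (E a x) * w x f"
      using swap[OF E_hor[OF a] J_hor[OF E_hor[OF a]], of x] by simp
  qed
  also have "\<dots> = (\<Sum>a\<in>I. g x (D x (J x (E a x)) Z) (E a x)) + 2 * real n * w x f"
    unfolding sum.distrib sum_distrib_right[symmetric] frame_norm_sum ..
  also have "(\<Sum>a\<in>I. g x (D x (J x (E a x)) Z) (E a x)) = - S"
  proof -
    have "(\<Sum>a\<in>I. g x (D x (J x (E a x)) Z) (E a x)) =
        (\<Sum>a\<in>I. \<Sum>b\<in>I. g x (J x (E a x)) (E b x) * g x (D x (E b x) Z) (E a x))"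
      by (rule sum.cong[OF refl]) (rule expand_hor[OF JE g_w_J[OF ET] D_form_lin(1)[OF Z' ET]])
    also have "\<dots> = (\<Sum>b\<in>I. \<Sum>a\<in>I. g x (J x (E a x)) (E b x) * g x (D x (E b x) Z) (E a x))" by (rule sum.swap)
    also have "\<dots> = (\<Sum>b\<in>I. - g x (D x (E b x) Z) (J x (E b x)))"
    proof (rule sum.cong[OF refl])
      fix b assume b: "b \<in> I"
      have "g x (D x (E b x) Z) (J x (E b x)) = (\<Sum>a\<in>I. g x (J x (E b x)) (E a x) * g x (D x (E b x) Z) (E a x))"
        by (rule expand_hor[OF JE[OF b] g_w_J[OF ET[OF b]] lin_on_g(2)[OF DT[OF b]]])
      also have "\<dots> = - (\<Sum>a\<in>I. g x (J x (E a x)) (E b x) * g x (D x (E b x) Z) (E a x))"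
        unfolding sum_negf[symmetric]
      proof (rule sum.cong[OF refl])
        fix a assume a: "a \<in> I"
        have "g x (J x (E b x)) (E a x) = - g x (J x (E a x)) (E b x)"
          using J_skew[OF ET[OF b] ET[OF a], of x] metric_sym[OF ET[OF b] JE[OF a]] by simp
        then show "g x (J x (E b x)) (E a x) * g x (D x (E b x) Z) (E a x) = - (g x (J x (E a x)) (E b x) * g x (D x (E b x) Z) (E a x))" by simp
      qed
      finally show "(\<Sum>a\<in>I. g x (J x (E a x)) (E b x) * g x (D x (E b x) Z) (E a x)) = - g x (D x (E b x) Z) (J x (E b x))" by simp
    qed
    finally show ?thesis by (simp add: S_def sum_negf)
  qed
  finally have S: "S = real n * w x f" by simp
  define q where "q = w x f"
  define m where "m = l / (2 * real n)"
  define V where "V a = D x (E a x) Z - (m *\<^sub>R E a x + (q / 2) *\<^sub>R J x (E a x))" for a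
  have sq: "g x (V a) (V a) = g x (D x (E a x) Z) (D x (E a x) Z) + (m\<^sup>2 + q\<^sup>2 / 4) * g x (E a x) (E a x)
      - 2 * m * g x (D x (E a x) Z) (E a x) - q * g x (D x (E a x) Z) (J x (E a x))" if a: "a \<in> I" for a
    unfolding V_def
    using metric_sym[OF DT[OF a] ET[OF a]] metric_sym[OF DT[OF a] JE[OF a]]
    by (simp add: g_lin g_lin' tangent_closed DT[OF a] ET[OF a] JE[OF a] JEE[OF a] JJ[OF a] algebra_simps power2_eq_square)
  have "0 \<le> (\<Sum>a\<in>I. g x (V a) (V a))"
    by (rule sum_nonneg, rule g_nonneg) (simp add: V_def tangent_closed DT ET JE)
  also have "\<dots> = (\<Sum>a\<in>I. g x (D x (E a x) Z) (D x (E a x) Z)) + (m\<^sup>2 + q\<^sup>2 / 4) * (2 * real n)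
      - 2 * m * Lap f x - q * S"
    unfolding Lap_def hor_div_def S_def Z_def[symmetric] frame_norm_sum[of x, symmetric]
    by (simp add: sq sum.distrib sum_subtractf sum_distrib_left cong: sum.cong)
  also have "\<dots> = (\<Sum>a\<in>I. g x (D x (E a x) Z) (D x (E a x) Z)) - (l / real n * Lap f x - l\<^sup>2 / (2 * real n) + real n / 2 * q\<^sup>2)"
    unfolding S q_def[symmetric] m_def using n by (simp add: field_simps power2_eq_square)
  finally show ?thesis by (simp add: Z_def q_def)
qed

text \<open>The square of \<open>\<nabla>h - J (\<nabla>f) / (2 b)\<close> is nonnegative, and \<open>J\<close> is isometric.\<close>

lemma mixed_term_bound:
  assumes f: "f \<in> smooth_funs A" and h: "h \<in> smooth_funs A" and b: "b > 0"
  shows "2 * J x (hgrad f x) h - 2 * b * g x (hgrad h x) (hgrad h x) \<le> g x (hgrad f x) (hgrad f x) / (2 * b)"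
proof -
  note Z = hgrad_hor[OF f] and Q = hgrad_hor[OF h]
  note ZT = horD(3)[OF Z, of x] and QT = horD(3)[OF Q, of x]
  have JZ: "J x (hgrad f x) \<in> T x" by (rule JT[OF ZT])
  define V where "V = hgrad h x - (1 / (2 * b)) *\<^sub>R J x (hgrad f x)"
  have "0 \<le> g x V V" by (rule g_nonneg) (simp add: V_def tangent_closed QT JZ)
  also have "g x V V = g x (hgrad h x) (hgrad h x) - 1 / b * J x (hgrad f x) h
      + (1 / (2 * b))\<^sup>2 * g x (hgrad f x) (hgrad f x)"
    unfolding V_def
    using metric_sym[OF QT JZ] g_hgrad[OF JZ g_w_J[OF ZT], of h] J_iso_hor[OF ZT Z]
    using b by (simp add: g_lin g_lin' tangent_closed QT JZ power2_eq_square) (simp add: field_simps)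
  finally have "0 \<le> 2 * b * (g x (hgrad h x) (hgrad h x) - 1 / b * J x (hgrad f x) h
      + (1 / (2 * b))\<^sup>2 * g x (hgrad f x) (hgrad f x))"
    using b by simp
  also have "\<dots> = 2 * b * g x (hgrad h x) (hgrad h x) - 2 * J x (hgrad f x) h + g x (hgrad f x) (hgrad f x) / (2 * b)"
    using b by (simp add: field_simps power2_eq_square)
  finally show ?thesis by linarith
qed

end


section \<open>Evolution along the Hamilton--Jacobi equation\<close>

locale heat_solution = framed_sasakian A g n J w \<alpha> nabla I E
  for A :: "('m::{t2_space, second_countable_topology}, 'e::euclidean_space) atlas"
    and g n J w \<alpha> nabla and I :: "'i set" and E +
  fixes f :: "real \<Rightarrow> 'm \<Rightarrow> real" and V :: "'m \<Rightarrow> real"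
  assumes n1: "n \<ge> 1"
    and f_st: "spacetime_smooth A f" and V_sm: "V \<in> smooth_funs A"
    and evol: "t > 0 \<Longrightarrow> time_deriv f t x = Lap (f t) x - 1/2 * g x (hgrad (f t) x) (hgrad (f t) x) + V x"
    and ricci_nonneg: "v \<in> T x \<Longrightarrow> ricci A g D x v \<ge> 0"
begin

abbreviation "fd \<equiv> time_deriv f"
abbreviation "N t y \<equiv> g y (hgrad (f t) y) (hgrad (f t) y)"
abbreviation "q t y \<equiv> w y (f t)"

lemma f_sm: "t > 0 \<Longrightarrow> f t \<in> smooth_funs A" by (rule spacetime_slice[OF f_st])

lemma fd_st: "spacetime_smooth A fd" by (rule spacetime_time_deriv[OF f_st])

lemma fd_sm: "t > 0 \<Longrightarrow> fd t \<in> smooth_funs A" by (rule spacetime_slice[OF fd_st])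

lemma q_st: "spacetime_smooth A q" by (rule spacetime_vector_field[OF f_st reeb_field])

lemma q_sm: "t > 0 \<Longrightarrow> q t \<in> smooth_funs A" by (rule spacetime_slice[OF q_st])

lemma N_sm: "t > 0 \<Longrightarrow> N t \<in> smooth_funs A"
  using horD(1)[OF hgrad_hor[OF f_sm]] metric_smooth by blast

lemma time_deriv_vector_field:
  assumes r: "spacetime_smooth A r" and X: "X \<in> vector_fields A" and t: "t > 0"
  shows "time_deriv (\<lambda>s y. X y (r s)) t = (\<lambda>y. X y (time_deriv r t))"
  unfolding time_deriv_def[of "\<lambda>s y. X y (r s)"]
  by (rule ext) (rule DERIV_imp_deriv[OF tangent_time_commute[OF r vfD(1)[OF X] t]])

lemma Lap_time:
  assumes r: "spacetime_smooth A r" and t: "t > 0"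
  shows "((\<lambda>s. Lap (r s) x) has_real_derivative Lap (time_deriv r t) x) (at t)"
proof -
  have "((\<lambda>s. \<Sum>a\<in>I. E a x (\<lambda>y. E a y (r s)) - D x (E a x) (E a) (r s)) has_real_derivative
      (\<Sum>a\<in>I. E a x (\<lambda>y. E a y (time_deriv r t)) - D x (E a x) (E a) (time_deriv r t))) (at t)"
  proof (intro DERIV_sum DERIV_diff)
    fix a assume a: "a \<in> I"
    show "((\<lambda>s. E a x (\<lambda>y. E a y (r s))) has_real_derivative E a x (\<lambda>y. E a y (time_deriv r t))) (at t)"
      using tangent_time_commute[OF spacetime_vector_field[OF r E_vf[OF a]] ET[OF a] t]
      unfolding time_deriv_vector_field[OF r E_vf[OF a] t] .
    show "((\<lambda>s. D x (E a x) (E a) (r s)) has_real_derivative D x (E a x) (E a) (time_deriv r t)) (at t)"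
      by (rule tangent_time_commute[OF r DEE_T[OF a] t])
  qed
  then have "((\<lambda>s. \<Sum>a\<in>I. E a x (\<lambda>y. E a y (r s)) - D x (E a x) (E a) (r s)) has_real_derivative
      Lap (time_deriv r t) x) (at t)"
    unfolding Lap_eq[OF spacetime_slice[OF spacetime_time_deriv[OF r] t]] .
  then show ?thesis
  proof (rule has_field_derivative_transform_within_open[of _ _ _ "{0<..}"])
    fix s :: real assume "s \<in> {0<..}"
    then show "(\<Sum>a\<in>I. E a x (\<lambda>y. E a y (r s)) - D x (E a x) (E a) (r s)) = Lap (r s) x"
      using Lap_eq[OF spacetime_slice[OF r], of s x] by simp
  qed (use t in auto)
qed

lemma N_time:
  assumes t: "t > 0"
  shows "((\<lambda>s. N s x) has_real_derivative 2 * g x (hgrad (f t) x) (hgrad (fd t) x)) (at t)"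
proof -
  have "((\<lambda>s. \<Sum>a\<in>I. E a x (f s) * E a x (f s)) has_real_derivative
      (\<Sum>a\<in>I. E a x (fd t) * E a x (f t) + E a x (fd t) * E a x (f t))) (at t)"
    by (intro DERIV_sum DERIV_mult tangent_time_commute[OF f_st ET t])
  moreover have "(\<Sum>a\<in>I. E a x (fd t) * E a x (f t) + E a x (fd t) * E a x (f t)) = 2 * g x (hgrad (f t) x) (hgrad (fd t) x)"
    unfolding hgrad_norm[OF f_sm[OF t]] sum_distrib_left by (rule sum.cong) auto
  ultimately have "((\<lambda>s. \<Sum>a\<in>I. E a x (f s) * E a x (f s)) has_real_derivative 2 * g x (hgrad (f t) x) (hgrad (fd t) x)) (at t)"
    by simp
  then show ?thesis
  proof (rule has_field_derivative_transform_within_open[of _ _ _ "{0<..}"])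
    fix s :: real assume "s \<in> {0<..}"
    then show "(\<Sum>a\<in>I. E a x (f s) * E a x (f s)) = N s x" using hgrad_norm[OF f_sm, of s x "f s"] by simp
  qed (use t in auto)
qed

lemma fd_time:
  assumes t: "t > 0"
  shows "((\<lambda>s. fd s x) has_real_derivative Lap (fd t) x - g x (hgrad (f t) x) (hgrad (fd t) x)) (at t)"
proof -
  have "((\<lambda>s. Lap (f s) x - 1/2 * N s x + V x) has_real_derivative
      (Lap (fd t) x - 1/2 * (2 * g x (hgrad (f t) x) (hgrad (fd t) x)) + 0)) (at t)"
    by (intro DERIV_add DERIV_diff DERIV_cmult DERIV_const Lap_time[OF f_st t] N_time[OF t])
  then have "((\<lambda>s. Lap (f s) x - 1/2 * N s x + V x) has_real_derivative
      (Lap (fd t) x - g x (hgrad (f t) x) (hgrad (fd t) x))) (at t)" by simp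
  then show ?thesis
    by (rule has_field_derivative_transform_within_open[of _ _ _ "{0<..}"]) (use t evol in auto)
qed

lemma hgrad_apply:
  assumes "h \<in> smooth_funs A" shows "hgrad h x k = g x (hgrad h x) (hgrad k x)"
  unfolding hgrad_norm[OF assms] unfolding hgrad_def sum_tvec_apply scaleR_fun_def real_scaleR_def ..

lemma tangent_fd:
  assumes t: "t > 0" and v: "v \<in> T x"
  shows "v (fd t) = v (Lap (f t)) - 1/2 * v (N t) + v V"
proof -
  note L = Lap_smooth[OF f_sm[OF t]] and half = smooth_funs_mult[OF smooth_funs_const[of "1/2"] N_sm[OF t]]
  have "fd t = (\<lambda>y. (Lap (f t) y - 1/2 * N t y) + V y)" by (rule ext) (rule evol[OF t])
  then have "v (fd t) = v (\<lambda>y. (Lap (f t) y - 1/2 * N t y) + V y)" by (rule arg_cong)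
  also have "\<dots> = v (Lap (f t)) - 1/2 * v (N t) + v V"
    unfolding tangentD(1)[OF v smooth_funs_diff[OF L half] V_sm] tangent_diff[OF v L half]
      tangentD(2)[OF v N_sm[OF t]] ..
  finally show ?thesis .
qed

lemma q_time:
  assumes t: "t > 0"
  shows "((\<lambda>s. q s x) has_real_derivative
    Lap (q t) x - g x (hgrad (f t) x) (hgrad (q t) x) + w x V) (at t)"
proof -
  have "((\<lambda>s. q s x) has_real_derivative w x (fd t)) (at t)"
    by (rule tangent_time_commute[OF f_st wT t])
  moreover have "w x (fd t) = Lap (q t) x - g x (hgrad (f t) x) (hgrad (q t) x) + w x V"
    unfolding tangent_fd[OF t wT] reeb_Lap[OF f_sm[OF t]] reeb_norm_hgrad[OF f_sm[OF t]] by simp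
  ultimately show ?thesis by simp
qed

text \<open>The left-hand side of the Harnack inequality with free coefficients. The weight \<open>b\<close> of the vertical
  term depends on time in the application and is a number for the spatial computations.\<close>

definition harnack_quantity :: "real \<Rightarrow> real \<Rightarrow> real \<Rightarrow> 'm \<Rightarrow> real" where
  "harnack_quantity a b t y = (a * fd t y + 1/2 * N t y) + (-1 * V y + b * (q t y)\<^sup>2)"

lemma harnack_quantity_parts:
  assumes "t > 0"
  shows "(\<lambda>y. a * fd t y) \<in> smooth_funs A" "(\<lambda>y. 1/2 * N t y) \<in> smooth_funs A"
    "(\<lambda>y. -1 * V y) \<in> smooth_funs A" "(\<lambda>y. (q t y)\<^sup>2) \<in> smooth_funs A" "(\<lambda>y. b * (q t y)\<^sup>2) \<in> smooth_funs A"
  using smooth_funs_mult[OF smooth_funs_const] fd_sm[OF assms] N_sm[OF assms] V_sm smooth_funs_power[OF q_sm[OF assms]]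
  by blast+

lemma harnack_quantity_sm: "t > 0 \<Longrightarrow> harnack_quantity a b t \<in> smooth_funs A"
  unfolding harnack_quantity_def[abs_def]
  by (rule smooth_funs_add[OF smooth_funs_add smooth_funs_add]) (rule harnack_quantity_parts, assumption)+

lemma tangent_harnack_quantity:
  assumes t: "t > 0" and v: "v \<in> T x"
  shows "v (harnack_quantity a b t) = a * v (fd t) + 1/2 * v (N t) - v V + 2 * b * q t x * v (q t)"
proof -
  note p = harnack_quantity_parts[OF t]
  have "v (\<lambda>y. (q t y)\<^sup>2) = 2 * q t x * v (q t)"
    using tangentD(3)[OF v q_sm[OF t] q_sm[OF t]] by (simp add: power2_eq_square)
  then show ?thesis
    unfolding harnack_quantity_def[abs_def] tangentD(1)[OF v smooth_funs_add[OF p(1,2)] smooth_funs_add[OF p(3,5)]]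
      tangentD(1)[OF v p(1,2)] tangentD(1)[OF v p(3,5)] tangentD(2)[OF v fd_sm[OF t]] tangentD(2)[OF v N_sm[OF t]]
      tangentD(2)[OF v V_sm] tangentD(2)[OF v p(4)] by simp
qed

lemma Lap_harnack_quantity:
  assumes t: "t > 0"
  shows "Lap (harnack_quantity a b t) x = a * Lap (fd t) x + 1/2 * Lap (N t) x - Lap V x
    + b * (2 * q t x * Lap (q t) x + 2 * g x (hgrad (q t) x) (hgrad (q t) x))"
proof -
  note p = harnack_quantity_parts[OF t]
  show ?thesis
    unfolding harnack_quantity_def[abs_def] Lap_add[OF smooth_funs_add[OF p(1,2)] smooth_funs_add[OF p(3,5)]]
      Lap_add[OF p(1,2)] Lap_add[OF p(3,5)] Lap_cmult[OF fd_sm[OF t]] Lap_cmult[OF N_sm[OF t]]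
      Lap_cmult[OF V_sm] Lap_cmult[OF p(4)] Lap_square[OF q_sm[OF t]] by simp
qed

lemma harnack_quantity_time:
  assumes t: "t > 0" and b: "(b has_real_derivative b') (at t)"
  shows "((\<lambda>s. harnack_quantity a (b s) s x) has_real_derivative
    a * (Lap (fd t) x - g x (hgrad (f t) x) (hgrad (fd t) x)) + g x (hgrad (f t) x) (hgrad (fd t) x)
    + b' * (q t x)\<^sup>2 + 2 * b t * q t x * (Lap (q t) x - g x (hgrad (f t) x) (hgrad (q t) x) + w x V)) (at t)"
proof -
  have sq: "((\<lambda>s. (q s x)\<^sup>2) has_real_derivative
      2 * q t x * (Lap (q t) x - g x (hgrad (f t) x) (hgrad (q t) x) + w x V)) (at t)"
    using DERIV_mult[OF q_time[OF t] q_time[OF t], of x x] by (simp add: power2_eq_square algebra_simps)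
  have "((\<lambda>s. harnack_quantity a (b s) s x) has_real_derivative
    (a * (Lap (fd t) x - g x (hgrad (f t) x) (hgrad (fd t) x)) + 1/2 * (2 * g x (hgrad (f t) x) (hgrad (fd t) x)))
    + (0 + (b' * (q t x)\<^sup>2 + (2 * q t x * (Lap (q t) x - g x (hgrad (f t) x) (hgrad (q t) x) + w x V)) * b t))) (at t)"
    unfolding harnack_quantity_def
    by (intro DERIV_add DERIV_cmult DERIV_const fd_time[OF t] N_time[OF t] DERIV_mult[OF b sq])
  then show ?thesis by (simp add: algebra_simps)
qed

text \<open>At a spatial maximum the sub-Laplacian of the quantity is nonpositive and its derivative along the
  horizontal gradient of \<open>f\<close> vanishes. So the left-hand side, the time derivative, can be replaced by
  the expression in which all third derivatives cancel through the Bochner formula. The number \<open>l\<close> is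
  the parameter of the Hessian bound.\<close>

lemma harnack_quantity_evolution:
  assumes t: "t > 0" and b: "b > 0" and max: "\<And>y. harnack_quantity a b t y \<le> harnack_quantity a b t x"
  shows "a * (Lap (fd t) x - g x (hgrad (f t) x) (hgrad (fd t) x)) + g x (hgrad (f t) x) (hgrad (fd t) x)
    + b' * (q t x)\<^sup>2 + 2 * b * q t x * (Lap (q t) x - g x (hgrad (f t) x) (hgrad (q t) x) + w x V)
    \<le> Lap V x + l\<^sup>2 / (2 * real n) - l / real n * Lap (f t) x + N t x / (2 * b)
      + (b' - real n / 2) * (q t x)\<^sup>2 + 2 * b * q t x * w x V"
proof -
  note fs = f_sm[OF t]
  note ZT = horD(3)[OF hgrad_hor[OF fs], of x]
  have L: "Lap (harnack_quantity a b t) x \<le> 0" by (rule Lap_at_max[OF harnack_quantity_sm[OF t] max])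
  have Z0: "hgrad (f t) x (harnack_quantity a b t) = 0" by (rule tangent_at_max[OF harnack_quantity_sm[OF t] max ZT])
  have Zfd: "hgrad (f t) x (fd t) = hgrad (f t) x (Lap (f t)) - 1/2 * hgrad (f t) x (N t) + hgrad (f t) x V"
    by (rule tangent_fd[OF t ZT])
  have boch: "1/2 * Lap (N t) x = (\<Sum>a\<in>I. g x (D x (E a x) (hgrad (f t))) (D x (E a x) (hgrad (f t))))
    + hgrad (f t) x (Lap (f t)) + ricci A g D x (hgrad (f t) x) - 2 * J x (hgrad (f t) x) (q t)"
    by (rule bochner[OF fs])
  have ric: "ricci A g D x (hgrad (f t) x) \<ge> 0" by (rule ricci_nonneg[OF ZT])
  note hes = hessian_norm_bound[OF fs n1, of l x] and mix = mixed_term_bound[OF fs q_sm[OF t] b, of x]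
  note Lx = L[unfolded Lap_harnack_quantity[OF t]] and Zx = Z0[unfolded tangent_harnack_quantity[OF t ZT]]
  define u1 where "u1 = g x (hgrad (f t) x) (hgrad (fd t) x)"
  define u2 where "u2 = g x (hgrad (f t) x) (hgrad (q t) x)"
  have u: "hgrad (f t) x (fd t) = u1" "hgrad (f t) x (q t) = u2"
    by (simp_all only: u1_def u2_def hgrad_apply[OF fs])
  have Z: "a * u1 + 1/2 * hgrad (f t) x (N t) - hgrad (f t) x V + 2 * b * q t x * u2 = 0"
    using Zx unfolding u .
  have Lb: "a * Lap (fd t) x + 1/2 * Lap (N t) x - Lap V x
      + 2 * b * q t x * Lap (q t) x + 2 * b * g x (hgrad (q t) x) (hgrad (q t) x) \<le> 0"
    using Lx by (simp add: algebra_simps)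
  have "a * (Lap (fd t) x - u1) + u1 + b' * (q t x)\<^sup>2 + 2 * b * q t x * (Lap (q t) x - u2 + w x V)
    = (a * Lap (fd t) x + 1/2 * Lap (N t) x - Lap V x + 2 * b * q t x * Lap (q t) x + 2 * b * g x (hgrad (q t) x) (hgrad (q t) x))
      - (a * u1 + 1/2 * hgrad (f t) x (N t) - hgrad (f t) x V + 2 * b * q t x * u2)
      + (u1 + 1/2 * hgrad (f t) x (N t) - hgrad (f t) x V) - 1/2 * Lap (N t) x + Lap V x
      - 2 * b * g x (hgrad (q t) x) (hgrad (q t) x) + b' * (q t x)\<^sup>2 + 2 * b * q t x * w x V"
    by (simp add: algebra_simps)
  also have "\<dots> \<le> Lap V x + l\<^sup>2 / (2 * real n) - l / real n * Lap (f t) x + N t x / (2 * b)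
      + (b' - real n / 2) * (q t x)\<^sup>2 + 2 * b * q t x * w x V"
    using Lb Z Zfd boch ric hes mix unfolding u left_diff_distrib by linarith
  finally show ?thesis unfolding u1_def u2_def .
qed

end

section \<open>The choice of coefficients\<close>

text \<open>The value of \<open>l\<close> is the one for which \<open>N\<close> cancels when \<open>d\<close> is eliminated in favour of \<open>F\<close>. The
  derivative \<open>B c (1 - th\<^sup>2)\<close> of \<open>b\<close> leaves the coefficient \<open>- n th\<^sup>2 / 6\<close> of \<open>q\<^sup>2\<close>, which absorbs \<open>2 b q p\<close>
  at the cost of exactly the multiple of \<open>p\<^sup>2\<close> in the hypothesis on \<open>LV\<close>.\<close>

lemma coefficient_arithmetic:
  fixes n :: nat and \<kappa>1 \<kappa>2 th :: real
  assumes n: "n \<ge> 1" and k2: "\<kappa>2 > 0" and th: "th > 0"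
    and c: "c = 1 / (real n + 3) * sqrt (real n * \<kappa>2 / 2)"
    and B: "B = (1 + real n / 3) * sqrt (real n / (2 * \<kappa>2))"
    and b: "b = B * th" and l: "l = real n * (real n + 3) / (3 * b)"
    and F: "F = (1 + 3 / real n) * d + 1/2 * N - V + b * q\<^sup>2"
    and V: "V \<le> \<kappa>1" and LV: "LV + (real n)\<^sup>2 / (3 * \<kappa>2) * (1 + 3 / real n)\<^sup>2 * p\<^sup>2 \<le> \<kappa>2"
  shows "LV + l\<^sup>2 / (2 * real n) - l / real n * (d + 1/2 * N - V) + N / (2 * b)
      + (B * c * (1 - th\<^sup>2) - real n / 2) * q\<^sup>2 + 2 * b * q * p
    \<le> \<kappa>2 + \<kappa>2 / th\<^sup>2 - 2 * c / th * (F - 3 * \<kappa>1 / real n)"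
    and "c > 0" and "B > 0"
proof -
  define m where "m = real n"
  have m: "m > 0" using n by (simp add: m_def)
  define s where "s = sqrt (m / (2 * \<kappa>2))"
  have s: "s > 0" "s\<^sup>2 = m / (2 * \<kappa>2)" using m k2 by (simp_all add: s_def)
  have "sqrt (m * \<kappa>2 / 2) = \<kappa>2 * s"
  proof -
    have "m * \<kappa>2 / 2 = \<kappa>2\<^sup>2 * (m / (2 * \<kappa>2))" using k2 by (simp add: power2_eq_square)
    then have "sqrt (m * \<kappa>2 / 2) = sqrt (\<kappa>2\<^sup>2) * s" unfolding s_def by (simp only: real_sqrt_mult)
    then show ?thesis using k2 by simp
  qed
  then have cs: "c = \<kappa>2 * s / (m + 3)" and Bs: "B = (m + 3) / 3 * s"
    using c B by (simp_all add: m_def s_def add.commute add_divide_distrib)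
  show cpos: "c > 0" unfolding cs using s(1) m k2 by simp
  show Bpos: "B > 0" unfolding Bs using s(1) m by simp
  have Bc: "B * c = m / 6"
  proof -
    have "B * c = \<kappa>2 * s\<^sup>2 / 3" unfolding cs Bs using m by (simp add: field_simps power2_eq_square)
    then show ?thesis unfolding s(2) using k2 by simp
  qed
  have Bn: "m / (3 * B) = 2 * c"
    using Bc Bpos by (simp add: field_simps)
  have B2: "B\<^sup>2 = (m + 3)\<^sup>2 * m / (18 * \<kappa>2)"
    unfolding Bs power_mult_distrib s(2) power_divide by (simp add: field_simps)
  have bpos: "b > 0" using b Bpos th by simp
  have l2: "l\<^sup>2 / (2 * m) = \<kappa>2 / th\<^sup>2"
  proof -
    have "l\<^sup>2 / (2 * m) = m * (m + 3)\<^sup>2 / (18 * B\<^sup>2 * th\<^sup>2)"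
      unfolding l b m_def[symmetric] using m Bpos th by (simp add: field_simps power2_eq_square)
    also have "\<dots> = \<kappa>2 / th\<^sup>2" unfolding B2 using m k2 th by (simp add: field_simps)
    finally show ?thesis .
  qed
  have nb: "m / (3 * b) = 2 * c / th" unfolding b using Bn th by (simp add: field_simps)
  have lin: "l / m * (d + 1/2 * N - V) = m / (3 * b) * F - m / 3 * q\<^sup>2 + (1/2 * N - V) / b"
    unfolding l F m_def[symmetric] using m bpos by (simp add: field_simps power2_eq_square)
  have Vb: "V / b \<le> 2 * c / th * (3 * \<kappa>1 / m)"
  proof -
    have "V / b \<le> \<kappa>1 / b" using V bpos by (simp add: divide_right_mono)
    also have "\<dots> = m / (3 * b) * (3 * \<kappa>1 / m)" using m by simp
    finally show ?thesis unfolding nb .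
  qed
  have mix: "2 * b * q * p \<le> m / 6 * th\<^sup>2 * q\<^sup>2 + m\<^sup>2 / (3 * \<kappa>2) * (1 + 3 / m)\<^sup>2 * p\<^sup>2"
  proof -
    have e: "m\<^sup>2 / (3 * \<kappa>2) * (1 + 3 / m)\<^sup>2 = 6 / m * B\<^sup>2"
      unfolding B2 using m k2 by (simp add: field_simps power2_eq_square)
    have "0 \<le> m / 6 * (th * q - 6 / m * B * p)\<^sup>2" using m by simp
    also have "\<dots> = m / 6 * th\<^sup>2 * q\<^sup>2 - 2 * b * q * p + 6 / m * B\<^sup>2 * p\<^sup>2"
      unfolding b using m by (simp add: field_simps power2_eq_square)
    finally show ?thesis unfolding e by simp
  qed
  have "LV + l\<^sup>2 / (2 * m) - l / m * (d + 1/2 * N - V) + N / (2 * b)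
      + (m / 6 * (1 - th\<^sup>2) - m / 2) * q\<^sup>2 + 2 * b * q * p
    = LV + \<kappa>2 / th\<^sup>2 - 2 * c / th * F + V / b - m / 6 * th\<^sup>2 * q\<^sup>2 + 2 * b * q * p"
    unfolding lin l2 nb using bpos by (simp add: field_simps)
  also have "\<dots> \<le> \<kappa>2 + \<kappa>2 / th\<^sup>2 - 2 * c / th * F + 2 * c / th * (3 * \<kappa>1 / m)"
    using LV mix Vb unfolding m_def[symmetric] by linarith
  also have "\<dots> = \<kappa>2 + \<kappa>2 / th\<^sup>2 - 2 * c / th * (F - 3 * \<kappa>1 / m)" by (simp add: algebra_simps)
  finally show "LV + l\<^sup>2 / (2 * real n) - l / real n * (d + 1/2 * N - V) + N / (2 * b)
      + (B * c * (1 - th\<^sup>2) - real n / 2) * q\<^sup>2 + 2 * b * q * p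
    \<le> \<kappa>2 + \<kappa>2 / th\<^sup>2 - 2 * c / th * (F - 3 * \<kappa>1 / real n)"
    unfolding Bc m_def[symmetric] .
qed

section \<open>The maximum principle\<close>

context heat_solution
begin

text \<open>Multiplication by the hyperbolic tangent removes the pole at the time \<open>\<epsilon>\<close>. The difference of both
  sides is then continuous up to \<open>\<epsilon>\<close>, where it is negative, and at a positive maximum over
  \<open>[\<epsilon>, t1] \<times> M\<close> its time derivative would be negative.\<close>

lemma shifted_harnack:
  assumes cpt: "compact (UNIV :: 'm set)" and k2: "\<kappa>2 > 0"
    and c: "c = 1 / (real n + 3) * sqrt (real n * \<kappa>2 / 2)"
    and B: "B = (1 + real n / 3) * sqrt (real n / (2 * \<kappa>2))"
    and V: "\<And>x. V x \<le> \<kappa>1"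
    and LV: "\<And>x. Lap V x + (real n)\<^sup>2 / (3 * \<kappa>2) * (1 + 3 / real n)\<^sup>2 * (w x V)\<^sup>2 \<le> \<kappa>2"
    and e: "\<epsilon> > 0" and t1: "t1 > \<epsilon>"
  shows "tanh (c * (t1 - \<epsilon>)) * (harnack_quantity (1 + 3 / real n) (B * tanh (c * (t1 - \<epsilon>))) t1 x1 - 3 * \<kappa>1 / real n) \<le> \<kappa>2 / c"
proof (rule ccontr)
  define a where "a = 1 + 3 / real n"
  define k where "k = 3 * \<kappa>1 / real n"
  define th where "th t = tanh (c * (t - \<epsilon>))" for t
  define F where "F t x = harnack_quantity a (B * th t) t x" for t x
  define H where "H t x = th t * (F t x - k) - \<kappa>2 / c" for t x
  assume "\<not> ?thesis"
  then have H1: "H t1 x1 > 0" by (simp add: H_def F_def th_def a_def k_def)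
  have cpos: "c > 0" and Bpos: "B > 0"
  proof -
    have "sqrt (real n * \<kappa>2 / 2) > 0" "sqrt (real n / (2 * \<kappa>2)) > 0" using n1 k2 by simp_all
    then show "c > 0" "B > 0" unfolding c B by (simp_all add: add_pos_nonneg)
  qed
  have thpos: "th t > 0" if "t > \<epsilon>" for t using that cpos by (simp add: th_def)
  have thd: "(th has_real_derivative c * (1 - (th t)\<^sup>2)) (at t)" for t
    unfolding th_def[abs_def] by (auto intro!: derivative_eq_intros simp: cosh_real_pos less_imp_neq[symmetric] algebra_simps)
  let ?K = "{\<epsilon>..t1} \<times> (UNIV :: 'm set)"
  have sub: "?K \<subseteq> {0<..} \<times> UNIV" using e by auto
  have st: "continuous_on ?K (\<lambda>p. r (fst p) (snd p))" if "spacetime_smooth A r" for r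
    using continuous_on_subset[OF spacetime_continuous[OF that] sub] by (simp add: split_beta)
  have Nst: "spacetime_smooth A (\<lambda>t y. \<Sum>a\<in>I. E a y (f t) * E a y (f t))"
    by (rule spacetime_sum) (rule spacetime_mult[OF spacetime_vector_field[OF f_st E_vf] spacetime_vector_field[OF f_st E_vf]])
  have cN: "continuous_on ?K (\<lambda>p. N (fst p) (snd p))"
  proof (rule continuous_on_eq[OF st[OF Nst]])
    fix p assume "p \<in> ?K"
    then have "fst p > 0" using e by auto
    then show "(\<Sum>a\<in>I. E a (snd p) (f (fst p)) * E a (snd p) (f (fst p))) = N (fst p) (snd p)"
      by (rule hgrad_norm[OF f_sm, symmetric])
  qed
  have cth: "continuous_on ?K (\<lambda>p. th (fst p))"
    by (rule continuous_on_compose2[of UNIV th]) (auto intro!: continuous_intros continuous_at_imp_continuous_on DERIV_isCont thd)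
  have cH: "continuous_on ?K (\<lambda>p. H (fst p) (snd p))"
    unfolding H_def F_def harnack_quantity_def
    by (intro continuous_intros cth cN st[OF fd_st] st[OF q_st] st[OF spacetime_const_time[OF V_sm]])
  have "compact ?K" by (intro compact_Times compact_Icc cpt)
  moreover have "(t1, x1) \<in> ?K" using t1 by simp
  ultimately obtain p where p: "p \<in> ?K" "\<forall>z\<in>?K. H (fst z) (snd z) \<le> H (fst p) (snd p)"
    using continuous_attains_sup[OF _ _ cH] by blast
  define t x where "t = fst p" and "x = snd p"
  have tb: "\<epsilon> \<le> t" "t \<le> t1" using p(1) by (auto simp: t_def)
  have max: "H s y \<le> H t x" if "\<epsilon> \<le> s" "s \<le> t1" for s y
    using p(2)[rule_format, of "(s, y)"] that by (simp add: t_def x_def)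
  have Hpos: "H t x > 0" using H1 max[of t1 x1] t1 by simp
  have te: "t > \<epsilon>"
  proof (rule ccontr)
    assume "\<not> t > \<epsilon>"
    then have "t = \<epsilon>" using tb by simp
    then have "H t x = - (\<kappa>2 / c)" by (simp add: H_def th_def)
    then show False using Hpos k2 cpos by (simp add: divide_less_0_iff)
  qed
  then have t0: "t > 0" using e by simp
  note tht = thpos[OF te]
  let ?b = "B * th t" and ?b' = "B * c * (1 - (th t)\<^sup>2)"
  have bpos: "?b > 0" using Bpos tht by simp
  have bd: "((\<lambda>s. B * th s) has_real_derivative ?b') (at t)"
    using DERIV_cmult[OF thd, of B t] by (simp add: mult.assoc)
  define dF where "dF = a * (Lap (fd t) x - g x (hgrad (f t) x) (hgrad (fd t) x)) + g x (hgrad (f t) x) (hgrad (fd t) x)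
    + ?b' * (q t x)\<^sup>2 + 2 * ?b * q t x * (Lap (q t) x - g x (hgrad (f t) x) (hgrad (q t) x) + w x V)"
  have Fd: "((\<lambda>s. F s x) has_real_derivative dF) (at t)"
    unfolding F_def dF_def by (rule harnack_quantity_time[OF t0 bd])
  have Fmax: "harnack_quantity a ?b t y \<le> harnack_quantity a ?b t x" for y
  proof -
    have "th t * (F t y - k) \<le> th t * (F t x - k)" using max[of t y] tb by (simp add: H_def)
    then show ?thesis using tht by (simp add: F_def)
  qed
  define l where "l = real n * (real n + 3) / (3 * ?b)"
  have "dF \<le> Lap V x + l\<^sup>2 / (2 * real n) - l / real n * Lap (f t) x + N t x / (2 * ?b)
      + (?b' - real n / 2) * (q t x)\<^sup>2 + 2 * ?b * q t x * w x V"
    unfolding dF_def by (rule harnack_quantity_evolution[OF t0 bpos Fmax])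
  also have "Lap (f t) x = fd t x + 1/2 * N t x - V x" using evol[OF t0, of x] by simp
  also have "Lap V x + l\<^sup>2 / (2 * real n) - l / real n * (fd t x + 1/2 * N t x - V x) + N t x / (2 * ?b)
      + (?b' - real n / 2) * (q t x)\<^sup>2 + 2 * ?b * q t x * w x V
      \<le> \<kappa>2 + \<kappa>2 / (th t)\<^sup>2 - 2 * c / th t * (F t x - 3 * \<kappa>1 / real n)"
    by (rule coefficient_arithmetic(1)[OF n1 k2 tht c B refl l_def _ V LV])
      (simp add: F_def harnack_quantity_def a_def)
  finally have dF: "dF \<le> \<kappa>2 + \<kappa>2 / (th t)\<^sup>2 - 2 * c / th t * (F t x - k)" by (simp add: k_def)
  have Hd: "((\<lambda>s. H s x) has_real_derivative c * (1 - (th t)\<^sup>2) * (F t x - k) + dF * th t) (at t)"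
  proof -
    have "((\<lambda>s. H s x) has_real_derivative (c * (1 - (th t)\<^sup>2) * (F t x - k) + (dF - 0) * th t) - 0) (at t)"
      unfolding H_def by (intro DERIV_diff DERIV_mult DERIV_const thd Fd)
    then show ?thesis by simp
  qed
  have "c * (1 - (th t)\<^sup>2) * (F t x - k) + dF * th t < 0"
  proof -
    define Y where "Y = F t x - k"
    have Y: "\<kappa>2 / c < th t * Y" using Hpos by (simp add: H_def Y_def)
    have "dF * th t \<le> (\<kappa>2 + \<kappa>2 / (th t)\<^sup>2 - 2 * c / th t * Y) * th t"
      using dF tht unfolding Y_def[symmetric] by (intro mult_right_mono) auto
    also have "\<dots> = \<kappa>2 * th t + \<kappa>2 / th t - 2 * c * Y" using tht by (simp add: field_simps power2_eq_square)
    finally have "c * (1 - (th t)\<^sup>2) * Y + dF * th t \<le> \<kappa>2 * th t + \<kappa>2 / th t - c * Y * (1 + (th t)\<^sup>2)"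
      by (simp add: algebra_simps)
    also have "\<dots> = (1 + (th t)\<^sup>2) / th t * (\<kappa>2 - c * (th t * Y))" using tht by (simp add: field_simps power2_eq_square)
    also have "\<dots> < 0"
    proof -
      have "\<kappa>2 - c * (th t * Y) < 0" using Y cpos by (simp add: field_simps)
      moreover have "(1 + (th t)\<^sup>2) / th t > 0" using tht by (simp add: add_pos_nonneg)
      ultimately show ?thesis by (rule mult_pos_neg[rotated])
    qed
    finally show ?thesis unfolding Y_def .
  qed
  from DERIV_neg_dec_left[OF Hd this] obtain \<delta> where \<delta>: "\<delta> > 0" "\<forall>h>0. h < \<delta> \<longrightarrow> H t x < H (t - h) x" by blast
  \<comment> \<open>a slightly earlier time in \<open>[\<epsilon>, t1]\<close> with a larger value\<close>
  define h where "h = min (\<delta> / 2) (t - \<epsilon>)"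
  have "h > 0" "h < \<delta>" "\<epsilon> \<le> t - h" "t - h \<le> t1" using \<delta>(1) te tb by (auto simp: h_def min_def)
  then show False using \<delta>(2) max[of "t - h" x] by fastforce
qed

text \<open>The shift \<open>\<epsilon>\<close> tends to zero at a fixed point of positive time, where only the coefficients depend on
  \<open>\<epsilon>\<close>.\<close>

lemma harnack:
  assumes cpt: "compact (UNIV :: 'm set)" and k2: "\<kappa>2 > 0"
    and c: "c = 1 / (real n + 3) * sqrt (real n * \<kappa>2 / 2)"
    and B: "B = (1 + real n / 3) * sqrt (real n / (2 * \<kappa>2))"
    and V: "\<And>x. V x \<le> \<kappa>1"
    and LV: "\<And>x. Lap V x + (real n)\<^sup>2 / (3 * \<kappa>2) * (1 + 3 / real n)\<^sup>2 * (w x V)\<^sup>2 \<le> \<kappa>2"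
    and t: "t > 0"
  shows "harnack_quantity (1 + 3 / real n) (B * tanh (c * t)) t x \<le> \<kappa>2 / c * coth (c * t) + 3 * \<kappa>1 / real n"
proof -
  define P where "P s = tanh (c * (t - s)) * (((1 + 3 / real n) * fd t x + 1/2 * N t x)
    + (-1 * V x + B * tanh (c * (t - s)) * (q t x)\<^sup>2) - 3 * \<kappa>1 / real n)" for s
  have "sqrt (real n * \<kappa>2 / 2) > 0" using n1 k2 by simp
  then have cpos: "c > 0" unfolding c by (simp add: add_pos_nonneg)
  have "isCont P 0" unfolding P_def
    by (intro continuous_intros) (simp_all add: cosh_real_pos less_imp_neq[symmetric])
  then have "(P \<longlongrightarrow> P 0) (at_right 0)" by (simp add: isCont_def filterlim_at_split)
  moreover have "eventually (\<lambda>s. P s \<le> \<kappa>2 / c) (at_right 0)"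
    using eventually_at_right_less[of 0] eventually_at_right_real[OF t]
  proof eventually_elim
    case (elim s)
    then show ?case
      using shifted_harnack[OF cpt k2 c B V LV, of s t x] by (simp add: P_def harnack_quantity_def)
  qed
  ultimately have "P 0 \<le> \<kappa>2 / c" by (rule tendsto_upperbound) simp
  then have *: "tanh (c * t) * (harnack_quantity (1 + 3 / real n) (B * tanh (c * t)) t x - 3 * \<kappa>1 / real n) \<le> \<kappa>2 / c"
    by (simp add: P_def harnack_quantity_def)
  have th: "tanh (c * t) > 0" using cpos t by simp
  have "harnack_quantity (1 + 3 / real n) (B * tanh (c * t)) t x - 3 * \<kappa>1 / real n \<le> \<kappa>2 / c / tanh (c * t)"
    using * unfolding pos_le_divide_eq[OF th] by (simp only: mult.commute)
  also have "\<dots> = \<kappa>2 / c * coth (c * t)" by (simp add: tanh_def coth_def)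
  finally show ?thesis by simp
qed

end

section \<open>The Hamilton--Jacobi equation of the logarithm\<close>

context framed_sasakian
begin

text \<open>With \<open>u = e\<^sup>l\<close> only the product rule is needed for the second derivatives, since \<open>v u = u v l\<close>.\<close>

lemma Lap_log:
  assumes u: "u \<in> smooth_funs A" and pos: "\<And>y. u y > 0"
  shows "(\<lambda>y. ln (u y)) \<in> smooth_funs A"
    and "v \<in> T x \<Longrightarrow> v u = u x * v (\<lambda>y. ln (u y))"
    and "Lap u x = u x * (Lap (\<lambda>y. ln (u y)) x + g x (hgrad (\<lambda>y. ln (u y)) x) (hgrad (\<lambda>y. ln (u y)) x))"
proof -
  let ?l = "\<lambda>y. ln (u y)"
  show l: "?l \<in> smooth_funs A" by (rule smooth_funs_compose[OF u _ _ smooth_on_ln]) (use pos in auto)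
  show vl: "v u = u x * v ?l" if "v \<in> T x" for v x
  proof -
    have "v ?l = inverse (u x) * v u"
      by (rule tangent_chain[OF that u _ _ smooth_on_ln DERIV_ln]) (use pos in auto)
    then show ?thesis using pos[of x] by simp
  qed
  have "E a x (\<lambda>y. E a y u) - D x (E a x) (E a) u =
      u x * ((E a x (\<lambda>y. E a y ?l) - D x (E a x) (E a) ?l) + E a x ?l * E a x ?l)" if a: "a \<in> I" for a
  proof -
    have "(\<lambda>y. E a y u) = (\<lambda>y. u y * E a y ?l)" by (rule ext) (rule vl[OF ET[OF a]])
    then have "E a x (\<lambda>y. E a y u) = E a x (\<lambda>y. u y * E a y ?l)" by (rule arg_cong)
    also have "\<dots> = E a x u * E a x ?l + u x * E a x (\<lambda>y. E a y ?l)"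
      by (rule tangentD(3)[OF ET[OF a] u vfD(2)[OF E_vf[OF a] l]])
    finally show ?thesis unfolding vl[OF DEE_T[OF a]] vl[OF ET[OF a]] by (simp add: algebra_simps)
  qed
  then have "(\<Sum>a\<in>I. E a x (\<lambda>y. E a y u) - D x (E a x) (E a) u) =
      (\<Sum>a\<in>I. u x * ((E a x (\<lambda>y. E a y ?l) - D x (E a x) (E a) ?l) + E a x ?l * E a x ?l))"
    by (rule sum.cong[OF refl])
  then show "Lap u x = u x * (Lap ?l x + g x (hgrad ?l x) (hgrad ?l x))"
    unfolding Lap_eq[OF u] Lap_eq[OF l] hgrad_norm[OF l] sum_distrib_left[symmetric] sum.distrib .
qed

lemma log_solution:
  assumes \<rho>: "spacetime_smooth A \<rho>" and pos: "\<And>t x. t \<ge> 0 \<Longrightarrow> \<rho> t x > 0"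
    and U1: "U1 \<in> smooth_funs A"
    and heat: "\<And>t x. t > 0 \<Longrightarrow> ((\<lambda>s. \<rho> s x) has_real_derivative
        Lap (\<rho> t) x + g x (hgrad U1 x) (hgrad (\<rho> t) x) + U2 x * \<rho> t x) (at t within {0..})"
    and f: "f = (\<lambda>t x. - 2 * ln (\<rho> t x) - U1 x)"
  shows "spacetime_smooth A f"
    and "t > 0 \<Longrightarrow> time_deriv f t x = Lap (f t) x - 1/2 * g x (hgrad (f t) x) (hgrad (f t) x)
      + (Lap U1 x + 1/2 * g x (hgrad U1 x) (hgrad U1 x) - 2 * U2 x)"
proof -
  have "spacetime_smooth A (\<lambda>t x. (- 2) * ln (\<rho> t x) - U1 x)"
    using pos by (intro spacetime_diff spacetime_mult spacetime_const_time[OF U1] spacetime_ln[OF \<rho>]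
        spacetime_const_time[OF smooth_funs_const]) auto
  then show "spacetime_smooth A f" by (simp add: f)
  assume t: "t > 0"
  define u where "u = \<rho> t"
  have us: "u \<in> smooth_funs A" unfolding u_def by (rule spacetime_slice[OF \<rho> t])
  have up: "u y > 0" for y using pos t by (simp add: u_def)
  let ?l = "\<lambda>y. ln (u y)"
  note Ll = Lap_log[OF us up]
  have ls: "?l \<in> smooth_funs A" by (rule Ll(1))
  have nl: "(\<lambda>y. (-2) * ?l y) \<in> smooth_funs A" and nU: "(\<lambda>y. (-1) * U1 y) \<in> smooth_funs A"
    by (intro smooth_funs_mult smooth_funs_const ls U1)+
  have ft: "f t = (\<lambda>y. (-2) * ?l y + (-1) * U1 y)" by (simp add: f u_def fun_eq_iff)
  have fts: "f t \<in> smooth_funs A" unfolding ft by (rule smooth_funs_add[OF nl nU])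
  have Ef: "E a x (f t) = -2 * E a x ?l - E a x U1" if a: "a \<in> I" for a
    unfolding ft tangentD(1)[OF ET[OF a] nl nU] tangentD(2)[OF ET[OF a] ls] tangentD(2)[OF ET[OF a] U1] by simp
  have Lf: "Lap (f t) x = -2 * Lap ?l x - Lap U1 x"
    unfolding ft Lap_add[OF nl nU] Lap_cmult[OF ls] Lap_cmult[OF U1] by simp
  have Nf: "g x (hgrad (f t) x) (hgrad (f t) x) = 4 * g x (hgrad ?l x) (hgrad ?l x)
      + 4 * g x (hgrad U1 x) (hgrad ?l x) + g x (hgrad U1 x) (hgrad U1 x)"
  proof -
    have "(\<Sum>a\<in>I. E a x (f t) * E a x (f t)) =
        (\<Sum>a\<in>I. 4 * (E a x ?l * E a x ?l) + 4 * (E a x U1 * E a x ?l) + E a x U1 * E a x U1)"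
      by (rule sum.cong[OF refl]) (simp add: Ef algebra_simps)
    then show ?thesis
      unfolding hgrad_norm[OF fts] hgrad_norm[OF ls] hgrad_norm[OF U1] sum_distrib_left sum.distrib .
  qed
  have gU: "g x (hgrad U1 x) (hgrad u x) = u x * g x (hgrad U1 x) (hgrad ?l x)"
    unfolding hgrad_norm[OF U1] sum_distrib_left
  proof (rule sum.cong[OF refl])
    fix a assume a: "a \<in> I"
    show "E a x U1 * E a x u = u x * (E a x U1 * E a x ?l)" unfolding Ll(2)[OF ET[OF a]] by simp
  qed
  define r where "r = Lap ?l x + g x (hgrad ?l x) (hgrad ?l x) + g x (hgrad U1 x) (hgrad ?l x) + U2 x"
  have "((\<lambda>s. \<rho> s x) has_real_derivative u x * r) (at t within {0..})"
    using heat[OF t, of x] unfolding u_def[symmetric] gU Ll(3) by (simp add: r_def algebra_simps)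
  then have "((\<lambda>s. \<rho> s x) has_real_derivative u x * r) (at t)"
    using t by (simp add: at_within_interior[of t "{0..}"] interior_Ici)
  then have "((\<lambda>s. ln (\<rho> s x)) has_real_derivative inverse (\<rho> t x) * (u x * r)) (at t)"
    by (rule DERIV_chain2[OF DERIV_ln, rotated]) (use pos[of t x] t in simp)
  moreover have "inverse (\<rho> t x) * (u x * r) = r" using up[of x] by (simp add: u_def)
  ultimately have "((\<lambda>s. ln (\<rho> s x)) has_real_derivative r) (at t)" by (simp only:)
  then have "((\<lambda>s. f s x) has_real_derivative (-2 * r - 0)) (at t)"
    unfolding f by (intro DERIV_diff DERIV_cmult DERIV_const)
  then have "time_deriv f t x = -2 * r" unfolding time_deriv_def by (simp add: DERIV_imp_deriv)
  then show "time_deriv f t x = Lap (f t) x - 1/2 * g x (hgrad (f t) x) (hgrad (f t) x)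
      + (Lap U1 x + 1/2 * g x (hgrad U1 x) (hgrad U1 x) - 2 * U2 x)"
    unfolding Lf Nf r_def by (simp add: algebra_simps)
qed

end

section \<open>The Harnack inequality\<close>

theorem theorem1p3:
  fixes A :: "('m::{t2_space, second_countable_topology}, 'e::euclidean_space) atlas"
    and g :: "'m \<Rightarrow> 'm tvec \<Rightarrow> 'm tvec \<Rightarrow> real"
    and n :: nat
    and J :: "'m \<Rightarrow> 'm tvec \<Rightarrow> 'm tvec"
    and w :: "'m vfield"
    and \<alpha> :: "'m \<Rightarrow> 'm tvec \<Rightarrow> real"
    and nabla :: "'m connection"
    and U1 U2 V :: "'m \<Rightarrow> real"
    and \<kappa>1 \<kappa>2 c2 :: real
    and \<rho> f :: "real \<Rightarrow> 'm \<Rightarrow> real"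
  assumes "n \<ge> 1"
    and "sasakian_manifold A g n J w \<alpha>"
    and "compact (UNIV :: 'm set)"
    and "levi_civita A g nabla"
    and "\<forall>x. \<forall>v\<in>tangent_space A x. ricci A g (tanaka g J w nabla) x v \<ge> 0"
    and "U1 \<in> smooth_funs A" and "U2 \<in> smooth_funs A"
    and "V = (\<lambda>x. sub_laplacian A g \<alpha> nabla U1 x
                + 1/2 * norm_sq g x (hor_grad A g \<alpha> U1 x) - 2 * U2 x)"
    and "\<kappa>1 > 0" and "\<kappa>2 > 0"
    and "\<forall>x. V x \<le> \<kappa>1"
    and "\<forall>x. sub_laplacian A g \<alpha> nabla V x
              + (real n)\<^sup>2 / (3 * \<kappa>2) * (1 + 3 / real n)\<^sup>2 * norm_sq g x (ver_grad A g \<alpha> V x) \<le> \<kappa>2"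
    and "smooth_family_from_0 A \<rho>"
    and "\<forall>t\<ge>0. \<forall>x. \<rho> t x > 0"
    and "\<forall>t\<ge>0. \<forall>x. ((\<lambda>s. \<rho> s x) has_real_derivative
              sub_laplacian A g \<alpha> nabla (\<rho> t) x
              + g x (hor_grad A g \<alpha> U1 x) (hor_grad A g \<alpha> (\<rho> t) x)
              + U2 x * \<rho> t x) (at t within {0..})"
    and "f = (\<lambda>t x. - 2 * ln (\<rho> t x) - U1 x)"
    and "c2 = 1 / (real n + 3) * sqrt (real n * \<kappa>2 / 2)"
  shows "\<forall>t>0. \<forall>x.
           (1 + 3 / real n) * deriv (\<lambda>s. f s x) t
           + 1/2 * norm_sq g x (hor_grad A g \<alpha> (f t) x) - V x
           + (1 + real n / 3) * sqrt (real n / (2 * \<kappa>2)) * tanh (c2 * t)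
               * norm_sq g x (ver_grad A g \<alpha> (f t) x)
           \<le> \<kappa>2 / c2 * coth (c2 * t) + 3 * \<kappa>1 / real n"
proof (intro allI impI)
  fix t :: real and x :: 'm
  assume t: "t > 0"
  interpret S: sasakian_levi_civita A g n J w \<alpha> nabla
    by (rule sasakian_levi_civita.intro[OF assms(2) sasakian_levi_civita_axioms.intro[OF assms(4)]])
  obtain I :: "('m \<times> 'm tvec) set" and E where frame: "finite I" "\<forall>a\<in>I. E a \<in> vector_fields A"
    "\<forall>x. \<forall>a\<in>I. g x (E a x) (w x) = 0"
    "\<forall>x. \<forall>u\<in>tangent_space A x. u = g x u (w x) *\<^sub>R w x + (\<Sum>a\<in>I. g x u (E a x) *\<^sub>R E a x)"
    using S.global_frame_exists[OF S.reeb_field S.reeb_unit assms(3)] by (elim exE conjE)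
  have E_horizontal: "E a \<in> S.horizontal_fields" if a: "a \<in> I" for a
  proof (rule S.horI)
    show E: "E a \<in> vector_fields A" by (rule bspec[OF frame(2) a])
    show "g y (w y) (E a y) = 0" for y
      using S.metric_sym[OF S.wT S.vfD(1)[OF E], of y] frame(3) a by simp
  qed
  have rep: "u = g y (w y) u *\<^sub>R w y + (\<Sum>a\<in>I. g y u (E a y) *\<^sub>R E a y)" if u: "u \<in> tangent_space A y" for u y
    unfolding S.metric_sym[OF S.wT u] by (rule bspec[OF spec[OF frame(4)] u])
  interpret F: framed_sasakian A g n J w \<alpha> nabla I E
    by (rule framed_sasakian.intro[OF S.sasakian_levi_civita_axioms framed_sasakian_axioms.intro[OF frame(1) E_horizontal rep]])
  have V: "V = (\<lambda>x. F.Lap U1 x + 1/2 * g x (F.hgrad U1 x) (F.hgrad U1 x) - 2 * U2 x)"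
    unfolding assms(8) norm_sq_def F.sub_laplacian_eq[OF assms(6)] F.hor_grad_eq[OF assms(6)] ..
  have N: "(\<lambda>x. g x (F.hgrad U1 x) (F.hgrad U1 x)) \<in> smooth_funs A"
    by (rule S.metric_smooth[OF S.horD(1) S.horD(1)]; rule F.hgrad_hor[OF assms(6)])
  have V_sm: "V \<in> smooth_funs A" unfolding V
    by (rule S.smooth_funs_diff[OF S.smooth_funs_add[OF F.Lap_smooth[OF assms(6)]
            S.smooth_funs_mult[OF S.smooth_funs_const N]] S.smooth_funs_mult[OF S.smooth_funs_const assms(7)]])
  have \<rho>: "spacetime_smooth A \<rho>" by (rule S.smooth_family_imp_spacetime[OF assms(13)])
  have heat: "((\<lambda>s. \<rho> s y) has_real_derivative
      F.Lap (\<rho> s) y + g y (F.hgrad U1 y) (F.hgrad (\<rho> s) y) + U2 y * \<rho> s y) (at s within {0..})" if s: "s > 0" for s y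
  proof -
    have sm: "\<rho> s \<in> smooth_funs A" by (rule S.spacetime_slice[OF \<rho> s])
    show ?thesis
      using assms(15)[rule_format, of s y] s
      unfolding F.sub_laplacian_eq[OF sm] F.hor_grad_eq[OF sm] F.hor_grad_eq[OF assms(6)] by simp
  qed
  have pos: "\<rho> s y > 0" if "s \<ge> 0" for s y using assms(14) that by simp
  have f_st: "spacetime_smooth A f"
    by (rule F.log_solution(1)[OF \<rho> _ assms(6) _ assms(16)]; (rule pos heat, assumption)?)
  have f_evol: "time_deriv f s y = F.Lap (f s) y - 1/2 * g y (F.hgrad (f s) y) (F.hgrad (f s) y)
      + (F.Lap U1 y + 1/2 * g y (F.hgrad U1 y) (F.hgrad U1 y) - 2 * U2 y)" if "s > 0" for s y
    by (rule F.log_solution(2)[OF \<rho> _ assms(6) _ assms(16) that]; (rule pos heat, assumption)?)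
  interpret H: heat_solution A g n J w \<alpha> nabla I E f V
  proof (rule heat_solution.intro[OF F.framed_sasakian_axioms heat_solution_axioms.intro])
    show "n \<ge> 1" by (rule assms(1))
    show "spacetime_smooth A f" by (rule f_st)
    show "V \<in> smooth_funs A" by (rule V_sm)
    show "time_deriv f s y = F.Lap (f s) y - 1/2 * g y (F.hgrad (f s) y) (F.hgrad (f s) y) + V y" if "s > 0" for s y
      unfolding V by (rule f_evol[OF that])
    show "0 \<le> ricci A g (tanaka g J w nabla) y v" if "v \<in> tangent_space A y" for v y
      using assms(5) that by blast
  qed
  have LV: "F.Lap V y + (real n)\<^sup>2 / (3 * \<kappa>2) * (1 + 3 / real n)\<^sup>2 * (w y V)\<^sup>2 \<le> \<kappa>2" for y
    using spec[OF assms(12), of y] unfolding F.sub_laplacian_eq[OF V_sm] F.norm_ver_grad[OF V_sm] .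
  have ft: "f t \<in> smooth_funs A" by (rule H.f_sm[OF t])
  have "H.harnack_quantity (1 + 3 / real n) ((1 + real n / 3) * sqrt (real n / (2 * \<kappa>2)) * tanh (c2 * t)) t x
      \<le> \<kappa>2 / c2 * coth (c2 * t) + 3 * \<kappa>1 / real n"
    by (rule H.harnack[OF assms(3,10,17) refl _ LV t]) (use assms(11) in blast)
  then show "(1 + 3 / real n) * deriv (\<lambda>s. f s x) t
           + 1/2 * norm_sq g x (hor_grad A g \<alpha> (f t) x) - V x
           + (1 + real n / 3) * sqrt (real n / (2 * \<kappa>2)) * tanh (c2 * t)
               * norm_sq g x (ver_grad A g \<alpha> (f t) x)
           \<le> \<kappa>2 / c2 * coth (c2 * t) + 3 * \<kappa>1 / real n"
    unfolding H.harnack_quantity_def F.norm_ver_grad[OF ft] F.hor_grad_eq[OF ft] time_deriv_def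
    by (simp add: norm_sq_def)
qed

end
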